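(* Let $n\ge1$ and let $H_i:\mathbb R^2\to\mathbb R^+=[0,+\infty)$, $i=1,\dots,n$, be smooth proper functions, each having a unique minimum point and no other critical points in the plane. Put $$H(p,q)=\sum_{i=1}^n H_i(p_i,q_i),\qquad (p,q)\in\mathbb R^{2n}.$$ Then for every $E>\min H$ the set $X=\{(p,q)\in\mathbb R^{2n}\mid H(p,q)\le E\}$ satisfies Viterbo's inequality $$\operatorname{vol}X\ \ge\ \frac{c_{EHZ}(X)^n}{n!}.$$
   Context: $\mathbb R^{2n}$ has coordinates $(p,q)=(p_1,\dots,p_n,q_1,\dots,q_n)$ and symplectic form $\omega=\sum_{i=1}^n dp_i\wedge dq_i$; $\operatorname{vol}$ is Lebesgue measure on $\mathbb R^{2n}$. A function is proper if it tends to $+\infty$ at infinity. For $X=\{H\le E\}$ with $\partial X=\{H=E\}$ a regular level, a closed characteristic on $\partial X$ is a closed curve $\gamma$ in $\partial X$ whose velocity $\dot\gamma$ is nonzero and always lies in the one-dimensional kernel of the restriction of $\omega$ to $T\partial X$, oriented in the direction of the Hamiltonian flow $\dot q_i=\partial H/\partial p_i$, $\dot p_i=-\partial H/\partial q_i$. Its action is $\int_\gamma\sum_{i=1}^n p_i\,dq_i$. The quantity $c_{EHZ}(X)$ denotes the smallest action (the infimum of the actions) of a closed characteristic on $\partial X$; for convex $X$ this is the Ekeland--Hofer--Zehnder capacity. No convexity of $H$ is assumed here. *)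

theory Defs
  imports "HOL-Analysis.Analysis"
begin

text \<open>
  The phase space \<open>\<real>\<^sup>2\<^sup>n\<close> with coordinates \<open>(p, q)\<close> is \<open>(real ^ 'n) \<times> (real ^ 'n)\<close>, where
  \<open>n = CARD('n)\<close>; the momenta are the first component.
\<close>

text \<open>
  \<open>k\<close> times continuously differentiable on the whole space, and \<open>C\<^sup>\<infinity>\<close>. Iterated derivatives are
  taken as directional derivatives along fixed vectors.
\<close>

fun Ck :: "nat \<Rightarrow> ('a::euclidean_space \<Rightarrow> 'b::real_normed_vector) \<Rightarrow> bool" where
  "Ck 0 f \<longleftrightarrow> continuous_on UNIV f"
| "Ck (Suc k) f \<longleftrightarrow> (\<forall>x. f differentiable (at x)) \<and>
     (\<forall>v. Ck k (\<lambda>x. frechet_derivative f (at x) v))"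

definition smooth :: "('a::euclidean_space \<Rightarrow> 'b::real_normed_vector) \<Rightarrow> bool" where
  "smooth f \<longleftrightarrow> (\<forall>k. Ck k f)"

definition proper_function :: "('a::real_normed_vector \<Rightarrow> real) \<Rightarrow> bool" where
  "proper_function f \<longleftrightarrow> filterlim f at_top at_infinity"

definition minimum_point :: "('a \<Rightarrow> real) \<Rightarrow> 'a \<Rightarrow> bool" where
  "minimum_point f z \<longleftrightarrow> (\<forall>w. f z \<le> f w)"

definition critical_point :: "('a::real_normed_vector \<Rightarrow> real) \<Rightarrow> 'a \<Rightarrow> bool" where
  "critical_point f z \<longleftrightarrow> frechet_derivative f (at z) = (\<lambda>v. 0)"

definition split_hamiltonian ::
    "('n::finite \<Rightarrow> real \<times> real \<Rightarrow> real) \<Rightarrow> (real ^ 'n) \<times> (real ^ 'n) \<Rightarrow> real" where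
  "split_hamiltonian h = (\<lambda>(p, q). \<Sum>i\<in>UNIV. h i (p $ i, q $ i))"

text \<open>The symplectic form \<open>\<Sum>\<^sub>i dp\<^sub>i \<and> dq\<^sub>i\<close>.\<close>

definition symplectic_form ::
    "(real ^ 'n) \<times> (real ^ 'n) \<Rightarrow> (real ^ 'n) \<times> (real ^ 'n) \<Rightarrow> real" where
  "symplectic_form v w = (\<Sum>i\<in>UNIV. fst v $ i * snd w $ i - snd v $ i * fst w $ i)"

text \<open>The Hamiltonian vector field: \<open>\<dot>p\<^sub>i = - \<partial>H/\<partial>q\<^sub>i\<close> and \<open>\<dot>q\<^sub>i = \<partial>H/\<partial>p\<^sub>i\<close>.\<close>

definition hamiltonian_field ::
    "((real ^ 'n) \<times> (real ^ 'n) \<Rightarrow> real) \<Rightarrow> (real ^ 'n) \<times> (real ^ 'n) \<Rightarrow> (real ^ 'n) \<times> (real ^ 'n)" where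
  "hamiltonian_field H z =
     ((\<chi> i. - frechet_derivative H (at z) (0, axis i 1)),
      (\<chi> i. frechet_derivative H (at z) (axis i 1, 0)))"

text \<open>
  Tangent space at \<open>z\<close> of the level set of \<open>H\<close> through \<open>z\<close>; this is the geometric tangent space
  when the level is regular.
\<close>

definition level_tangent ::
    "('a::real_normed_vector \<Rightarrow> real) \<Rightarrow> 'a \<Rightarrow> 'a set" where
  "level_tangent H z = {v. frechet_derivative H (at z) v = 0}"

definition characteristic_line ::
    "((real ^ 'n) \<times> (real ^ 'n) \<Rightarrow> real) \<Rightarrow> (real ^ 'n) \<times> (real ^ 'n) \<Rightarrow> ((real ^ 'n) \<times> (real ^ 'n)) set" where
  "characteristic_line H z =
     {v \<in> level_tangent H z. \<forall>w \<in> level_tangent H z. symplectic_form v w = 0}"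

text \<open>
  Closed characteristics on the boundary \<open>{H = E}\<close> of \<open>{H \<le> E}\<close>, for \<open>E\<close> a regular value of \<open>H\<close>.
  Closed curves are \<open>C\<^sup>1\<close> loops parametrized by the unit interval. Multiply covered loops are
  allowed, and the parametrization need not be the one by the Hamiltonian flow.
\<close>

definition closed_characteristic ::
    "((real ^ 'n) \<times> (real ^ 'n) \<Rightarrow> real) \<Rightarrow> real \<Rightarrow> (real \<Rightarrow> (real ^ 'n) \<times> (real ^ 'n)) \<Rightarrow> bool" where
  "closed_characteristic H E \<gamma> \<longleftrightarrow>
     \<gamma> C1_differentiable_on {0..1} \<and>
     pathfinish \<gamma> = pathstart \<gamma> \<and>
     path_image \<gamma> \<subseteq> {z. H z = E} \<and>
     (\<forall>t\<in>{0..1}.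
        vector_derivative \<gamma> (at t) \<noteq> 0 \<and>
        vector_derivative \<gamma> (at t) \<in> characteristic_line H (\<gamma> t) \<and>
        (\<exists>c>0. vector_derivative \<gamma> (at t) = c *\<^sub>R hamiltonian_field H (\<gamma> t)))"

text \<open>The action \<open>\<integral>\<^sub>\<gamma> \<Sum>\<^sub>i p\<^sub>i dq\<^sub>i\<close>.\<close>

definition action :: "(real \<Rightarrow> (real ^ 'n) \<times> (real ^ 'n)) \<Rightarrow> real" where
  "action \<gamma> =
     integral {0..1} (\<lambda>t. \<Sum>i\<in>UNIV. fst (\<gamma> t) $ i * snd (vector_derivative \<gamma> (at t)) $ i)"

text \<open>
  \<open>c_EHZ H E\<close> is the capacity \<open>c\<^sub>E\<^sub>H\<^sub>Z(X)\<close> of \<open>X = {H \<le> E}\<close>, for \<open>E\<close> a regular value of \<open>H\<close>.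
  It depends only on \<open>X\<close>: for two functions with the same regular sublevel set \<open>X\<close>, the differentials
  along the boundary are positive multiples of each other, so the characteristic line and its
  orientation agree.
  The infimum is taken in the extended reals, so that it is \<open>\<infinity>\<close> (rather than an unspecified real)
  if there are no closed characteristics.
\<close>

definition c_EHZ :: "((real ^ 'n) \<times> (real ^ 'n) \<Rightarrow> real) \<Rightarrow> real \<Rightarrow> ereal" where
  "c_EHZ H E = (INF \<gamma> \<in> {\<gamma>. closed_characteristic H E \<gamma>}. ereal (action \<gamma>))"

end

theory Submission
  imports Defs "HOL-Complex_Analysis.Complex_Analysis"
begin

text \<open>
  Write \<open>area\<^sub>i(e)\<close> for the area of the planar region \<open>{H\<^sub>i \<le> e}\<close>. Above its minimum, every level of
  \<open>H\<^sub>i\<close> is one periodic orbit of the planar Hamiltonian flow; its action is \<open>area\<^sub>i(e)\<close> and its period is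
  the derivative \<open>area\<^sub>i'(e)\<close> (\<open>area_derivative\<close>).

  Distribute the energy: minimise \<open>\<Sum>\<^sub>i area\<^sub>i(e\<^sub>i)\<close> over all \<open>e\<^sub>i \<ge> min H\<^sub>i\<close> with \<open>\<Sum>\<^sub>i e\<^sub>i = E\<close>, and let \<open>c\<close> be
  the minimum. The Lagrange condition at a minimiser says that the derivatives \<open>area\<^sub>i'(e\<^sub>i)\<close>, that is the
  periods, agree for all \<open>i\<close> with \<open>e\<^sub>i > min H\<^sub>i\<close> (\<open>equal_periods\<close>). Hence the orbits on these levels,
  together with the constant orbits at the remaining minima, form one closed orbit of \<open>H\<close> on \<open>{H = E}\<close>.
  Its action is \<open>c\<close>, so that \<open>c\<^sub>E\<^sub>H\<^sub>Z \<le> c\<close>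
  (\<open>closed_characteristic_of_minimal_energies\<close>). Minimality of \<open>c\<close> and strict monotonicity of the areas
  also show that \<open>\<Sum>\<^sub>i area\<^sub>i(H\<^sub>i) \<le> c\<close> implies \<open>H \<le> E\<close> (\<open>sublevel_inclusion\<close>). Since
  \<open>z \<mapsto> area\<^sub>i(H\<^sub>i(z))\<close> carries planar Lebesgue measure to Lebesgue measure on \<open>[0, \<infinity>)\<close>
  (\<open>distr_area\<close>), the set \<open>X\<close> contains a set with the volume \<open>c\<^sup>n / n!\<close> of the simplex
  \<open>{a \<ge> 0. \<Sum>\<^sub>i a\<^sub>i \<le> c}\<close>. To pass from \<open>c\<^sub>E\<^sub>H\<^sub>Z \<le> c\<close> to \<open>n\<close>-th powers one needs \<open>c\<^sub>E\<^sub>H\<^sub>Z \<ge> 0\<close>: a component of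
  a closed characteristic is constant or runs through a periodic orbit a whole number of times in the
  direction of the flow (\<open>action_nonneg\<close>).

  Two planar facts carry the argument. First, \<open>\<integral> p dq\<close> along a simple closed curve is plus or minus the
  enclosed area (\<open>area_inside\<close>); this is proved by integrating the winding number over the plane with
  Fubini's theorem. Second, the identities for action and period are obtained without differentiating the
  flow in its initial conditions: a periodic orbit on the level \<open>e\<close> is pushed by \<open>r\<close> along a
  normal field on which \<open>dH\<^sub>i\<close> equals one. The pushed curve encloses an area that is a quadratic polynomial
  in \<open>r\<close>, with the action as constant term and the period as linear coefficient, and it lies
  between the levels \<open>e + r - C r\<^sup>2\<close> and \<open>e + r + C r\<^sup>2\<close>. By the maximum principle its inside is
  sandwiched between the two sublevels, which gives orientation, action and period at once.

  The plane is identified with the complex numbers by \<open>z = p + \<i>q\<close>, so that the Hamiltonian field is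
  \<open>\<i>\<close> times the gradient.
\<close>

section \<open>Area enclosed by a closed plane curve\<close>

text \<open>
  Together with the next lemma this makes the Cauchy kernel integrable over a square, uniformly in the
  position of its pole: \<open>1/\<bar>u\<bar>\<close> is dominated by a product of two functions of one variable, each with
  an integrable singularity.
\<close>
lemma inverse_sqrt_kernel_bound:
  fixes R :: real
  assumes R: "0 < R"
  obtains C :: real where "0 \<le> C"
    "\<And>a. \<bar>a\<bar> \<le> R \<Longrightarrow>
       (\<integral>\<^sup>+x. ennreal (indicator {-R..R} x * \<bar>a - x\<bar> powr (-1/2)) \<partial>lborel) \<le> ennreal C"
proof -
  define g :: "real \<Rightarrow> real" where "g u = indicator {0..2*R} u * \<bar>u\<bar> powr (-1/2)" for u
  define C0 where "C0 = (2*R) powr (1/2) / (1/2)"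
  have C0: "C0 \<ge> 0" unfolding C0_def by simp
  have g_meas[measurable]: "g \<in> borel_measurable borel"
    unfolding g_def by measurable
  have "((\<lambda>x. x powr (-1/2)) has_integral C0) {0..2*R}"
    using has_integral_powr_from_0[of "-1/2" "2*R"] R unfolding C0_def by (simp add: field_simps)
  then have "((\<lambda>x. \<bar>x\<bar> powr (-1/2)) has_integral C0) {0..2*R}"
    by (rule has_integral_eq[rotated]) auto
  then have I1: "(\<integral>\<^sup>+u. ennreal (g u) \<partial>lborel) = ennreal C0"
    using nn_integral_has_integral_lebesgue[of "{0..2*R}" "\<lambda>x. \<bar>x\<bar> powr (-1/2)" C0]
    by (simp add: g_def mult.commute)
  have I2: "(\<integral>\<^sup>+u. ennreal (g (- u)) \<partial>lborel) = ennreal C0"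
    using nn_integral_real_affine[of "\<lambda>u. ennreal (g u)" "-1" 0] I1 by simp
  show thesis
  proof (rule that[of "C0 + C0"])
    fix a :: real assume a: "\<bar>a\<bar> \<le> R"
    have "(\<integral>\<^sup>+x. ennreal (indicator {-R..R} x * \<bar>a - x\<bar> powr (-1/2)) \<partial>lborel)
        \<le> (\<integral>\<^sup>+x. ennreal (g (a - x) + g (- (a - x))) \<partial>lborel)"
      using a by (intro nn_integral_mono ennreal_leI) (auto simp: g_def indicator_def)
    also have "\<dots> = (\<integral>\<^sup>+u. ennreal (g u + g (- u)) \<partial>lborel)"
      using nn_integral_real_affine[of "\<lambda>u. ennreal (g u + g (- u))" "-1" a] by simp
    also have "\<dots> = (\<integral>\<^sup>+u. ennreal (g u) + ennreal (g (- u)) \<partial>lborel)"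
      by (intro nn_integral_cong) (simp add: g_def)
    also have "\<dots> = ennreal C0 + ennreal C0"
      using I1 I2 by (subst nn_integral_add) auto
    finally show "(\<integral>\<^sup>+x. ennreal (indicator {-R..R} x * \<bar>a - x\<bar> powr (-1/2)) \<partial>lborel)
        \<le> ennreal (C0 + C0)" by (simp only: ennreal_plus[OF C0 C0])
  qed (use C0 in simp)
qed

text \<open>
  This amounts to \<open>\<bar>u\<bar>\<^sup>2 \<ge> \<bar>Re u\<bar> \<cdot> \<bar>Im u\<bar>\<close>, which holds because \<open>\<bar>u\<bar>\<close> bounds both coordinates.
\<close>
lemma norm_inverse_le_powr:
  assumes "Re u \<noteq> 0" "Im u \<noteq> 0"
  shows "norm (1 / u) \<le> \<bar>Re u\<bar> powr (-1/2) * \<bar>Im u\<bar> powr (-1/2)"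
proof -
  define a b where "a = sqrt \<bar>Re u\<bar>" and "b = sqrt \<bar>Im u\<bar>"
  have ab: "a > 0" "b > 0" using assms by (auto simp: a_def b_def)
  have "(a*b)^2 \<le> (a^2)^2 + (b^2)^2"
  proof -
    have "0 \<le> (a^2 - b^2)^2 + a^2*b^2" by simp
    then show ?thesis by (simp add: algebra_simps power2_eq_square)
  qed
  also have "\<dots> = (norm u)^2" by (simp add: a_def b_def cmod_power2)
  finally have "a * b \<le> norm u" using norm_ge_zero power2_le_imp_le by blast
  then have "1 / norm u \<le> 1 / (a * b)" using ab by (intro divide_left_mono mult_pos_pos) (use assms in auto)
  moreover have "\<bar>Re u\<bar> powr (-1/2) = 1/a" "\<bar>Im u\<bar> powr (-1/2) = 1/b"
    using powr_minus_divide[of "\<bar>Re u\<bar>" "1/2"] powr_minus_divide[of "\<bar>Im u\<bar>" "1/2"]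
    by (simp_all add: a_def b_def powr_half_sqrt)
  ultimately show ?thesis by (simp add: norm_divide)
qed

text \<open>
  The antiderivative is \<open>-Ln (z - Complex x y)\<close>. At the right end its argument lies in the left half plane;
  moving it to the right half plane crosses the branch cut of \<open>Ln\<close> and contributes the jump
  \<open>\<i> pi sgn (Im z - y)\<close>. What remains is holomorphic in \<open>z\<close> for \<open>\<bar>Re z\<bar> < R\<close>, so only the jump survives
  integration of the formula in \<open>z\<close> along a closed curve.
\<close>
lemma has_integral_Cauchy_kernel_horizontal:
  assumes "\<bar>Re z\<bar> < R" "Im z \<noteq> y"
  shows "((\<lambda>x. 1 / (z - Complex x y)) has_integral
     (Ln (z + R - \<i> * y) - Ln (R - z + \<i> * y) - \<i> * pi * sgn (Im z - y))) {-R..R}"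
proof -
  have R: "R > 0" using assms by auto
  have nz: "Im z - y \<noteq> 0" using assms by simp
  have der: "((\<lambda>x. - Ln (z - Complex x y)) has_vector_derivative 1 / (z - Complex x y)) (at x within {-R..R})"
    for x
  proof -
    have e: "Complex x y = of_real x + \<i> * of_real y" for x by (simp add: complex_eq_iff)
    have "Im (z - Complex x y) \<noteq> 0" using assms by simp
    then have "z - Complex x y \<notin> \<real>\<^sub>\<le>\<^sub>0" using complex_nonpos_Reals_iff by blast
    then have "((\<lambda>w. - Ln (z - (w + \<i> * y))) has_field_derivative 1 / (z - Complex x y)) (at (of_real x))"
      unfolding e by (auto intro!: derivative_eq_intros simp: divide_simps)
    then have "((\<lambda>x. - Ln (z - (of_real x + \<i> * y))) has_vector_derivative 1 / (z - Complex x y)) (at x)"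
      by (rule has_vector_derivative_real_field)
    then show ?thesis unfolding e by (rule has_vector_derivative_at_within)
  qed
  have "((\<lambda>x. 1 / (z - Complex x y)) has_integral
     (- Ln (z - Complex R y) - - Ln (z - Complex (-R) y))) {-R..R}"
    by (rule fundamental_theorem_of_calculus[OF _ der]) (use R in simp)
  also have "z - Complex (-R) y = z + R - \<i> * y" by (simp add: complex_eq_iff)
  also have "z - Complex R y = - (R - z + \<i> * y)" by (simp add: complex_eq_iff)
  also have "- Ln (- (R - z + \<i> * y)) - - Ln (z + R - \<i> * y)
     = Ln (z + R - \<i> * y) - Ln (R - z + \<i> * y) - \<i> * pi * sgn (Im z - y)"
  proof -
    define u where "u = R - z + \<i> * y"
    have u: "Re u > 0" "Im u = y - Im z" using assms by (auto simp: u_def)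
    then have u0: "u \<noteq> 0" by auto
    have "Ln (- u) = Ln u + \<i> * pi * sgn (Im z - y)"
    proof (cases "Im u \<le> 0")
      case True
      then show ?thesis using u nz by (simp add: Ln_minus[OF u0] sgn_if)
    next
      case False
      then show ?thesis using u nz by (simp add: Ln_minus[OF u0] sgn_if)
    qed
    then show ?thesis unfolding u_def by simp
  qed
  finally show ?thesis .
qed

lemma integral_sgn_diff:
  fixes b R :: real
  assumes "\<bar>b\<bar> < R"
  shows "((\<lambda>y. sgn (b - y)) has_integral 2 * b) {-R..R}"
proof -
  have bR: "-R \<le> b" "b \<le> R" using assms by auto
  have 1: "((\<lambda>y. sgn (b - y)) has_integral (b + R)) {-R..b}"
  proof (rule has_integral_spike_finite[of "{b}"])
    show "((\<lambda>y. 1) has_integral (b + R)) {-R..b}"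
      using has_integral_const_real[of "1::real" "-R" b] bR by (simp add: algebra_simps)
  qed (auto simp: sgn_if)
  have 2: "((\<lambda>y. sgn (b - y)) has_integral - (R - b)) {b..R}"
  proof (rule has_integral_spike_finite[of "{b}"])
    show "((\<lambda>y. -1) has_integral - (R - b)) {b..R}"
      using has_integral_const_real[of "-1::real" b R] bR by (simp add: algebra_simps)
  qed (auto simp: sgn_if)
  have "((\<lambda>y. sgn (b - y)) has_integral (b + R) + - (R - b)) {-R..R}"
    by (rule has_integral_combine[OF _ _ 1 2]) (use assms in auto)
  then show ?thesis by simp
qed

lemma lborel_complex: "distr lborel borel (\<lambda>w. Complex (snd w) (fst w)) = lborel"
proof (rule lborel_eqI[symmetric])
  let ?C = "\<lambda>w::real\<times>real. Complex (snd w) (fst w)"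
  have [measurable]: "?C \<in> borel_measurable borel"
    by (intro borel_measurable_continuous_onI) (auto simp: Complex_eq intro!: continuous_intros)
  fix l u :: complex
  assume lu: "\<And>b. b \<in> Basis \<Longrightarrow> l \<bullet> b \<le> u \<bullet> b"
  have le: "Re l \<le> Re u" "Im l \<le> Im u" using lu[of 1] lu[of \<i>] by (auto simp: Basis_complex_def)
  have "emeasure (distr lborel borel ?C) (box l u) = emeasure lborel (?C -` box l u)"
    by (subst emeasure_distr) auto
  also have "?C -` box l u = box (Im l, Re l) (Im u, Re u)"
    by (auto simp: in_box_complex_iff mem_box Basis_prod_def)
  also have "emeasure lborel \<dots> = ennreal ((Im u - Im l) * (Re u - Re l))"
    using le by (subst emeasure_lborel_box) (auto simp: Basis_prod_def prod.insert_if)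
  also have "\<dots> = ennreal (prod ((\<bullet>) (u - l)) Basis)"
    by (simp add: Basis_complex_def mult.commute)
  finally show "emeasure (distr lborel borel ?C) (box l u) = ennreal (prod ((\<bullet>) (u - l)) Basis)" .
qed simp

text \<open>
  A closed curve that is given with its derivative on the whole line, so that derivatives at the
  end points of \<open>[0, 1]\<close> are two-sided.
\<close>
locale C1_loop =
  fixes \<gamma> D :: "real \<Rightarrow> complex"
  assumes deriv: "\<And>t. (\<gamma> has_vector_derivative D t) (at t)"
    and cont_D: "continuous_on UNIV D"
    and loop: "\<gamma> 1 = \<gamma> 0"
begin

lemma cont: "continuous_on S \<gamma>"
  by (rule continuous_on_vector_derivative) (rule has_vector_derivative_at_within[OF deriv])

lemma valid: "valid_path \<gamma>"
  unfolding valid_path_def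
  by (intro C1_differentiable_imp_piecewise)
    (use deriv continuous_on_subset[OF cont_D] in \<open>auto simp: C1_differentiable_on_def\<close>)

lemma finish_start: "pathfinish \<gamma> = pathstart \<gamma>"
  using loop by (simp add: pathfinish_def pathstart_def)

lemma vector_derivative_eq: "vector_derivative \<gamma> (at t) = D t"
  using deriv by (rule vector_derivative_at)

text \<open>
  Cauchy's theorem on the half plane on which the logarithm is holomorphic.
\<close>
lemma contour_integral_Ln_zero:
  assumes "\<And>t. t \<in> {0..1} \<Longrightarrow> Re (c * \<gamma> t + a) > 0"
  shows "integral {0..1} (\<lambda>t. D t * Ln (c * \<gamma> t + a)) = 0"
proof -
  have "contour_integral \<gamma> (\<lambda>z. Ln (c * z + a)) = 0"
  proof (rule contour_integral_unique, rule Cauchy_theorem_convex_simple)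
    show "(\<lambda>z. Ln (c * z + a)) holomorphic_on {z. Re (c * z + a) > 0}"
      by (intro holomorphic_intros) (auto simp: complex_nonpos_Reals_iff)
    show "convex {z. Re (c * z + a) > 0}"
    proof -
      have "convex ((\<lambda>z. cnj c \<bullet> z) -` {- Re a <..})"
        by (intro convex_linear_vimage convex_real_interval bounded_linear.linear bounded_linear_inner_right)
      also have "(\<lambda>z. cnj c \<bullet> z) -` {- Re a <..} = {z. Re (c * z + a) > 0}"
        by (auto simp: inner_complex_def)
      finally show ?thesis .
    qed
  qed (use valid finish_start assms in \<open>auto simp: path_image_def\<close>)
  then show ?thesis by (simp add: contour_integral_integral vector_derivative_eq mult.commute)
qed

text \<open>
  Integrating over \<open>y\<close> first changes nothing, because the integrals can be exchanged. With
  \<open>s = \<plusminus>1\<close> and \<open>c = \<plusminus>1\<close> these are the two holomorphic terms of the row integral of the Cauchy kernel.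
\<close>
lemma contour_integral_Ln_family_zero:
  assumes "\<And>t. t \<in> {0..1} \<Longrightarrow> Re (c * \<gamma> t + a) > 0"
  shows "((\<lambda>t. D t * integral {-R..R} (\<lambda>y. Ln (c * \<gamma> t + a + \<i> * of_real (s * y)))) has_integral 0) {0..1}"
proof -
  let ?g = "\<lambda>t y. D t * Ln (c * \<gamma> t + a + \<i> * of_real (s * y))"
  have cg: "continuous_on ({0..1} \<times> {-R..R}) (\<lambda>(t, y). ?g t y)"
    unfolding split_beta
    by (intro continuous_intros continuous_on_Ln continuous_on_compose2[OF cont_D] continuous_on_compose2[OF cont])
      (use assms in \<open>auto simp: complex_nonpos_Reals_iff not_le\<close>)
  have e: "integral {-R..R} (?g t) = D t * integral {-R..R} (\<lambda>y. Ln (c * \<gamma> t + a + \<i> * of_real (s * y)))" for t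
    by simp
  have c1: "continuous_on {0..1} (\<lambda>t. integral {-R..R} (?g t))"
    using integral_continuous_on_param[of "{0..1}" "-R" R ?g] cg by simp
  have "integral {0..1} (\<lambda>t. integral {-R..R} (?g t)) = integral {-R..R} (\<lambda>y. integral {0..1} (\<lambda>t. ?g t y))"
    using integral_swap_continuous[of 0 "-R" 1 R ?g] cg by (simp add: cbox_Pair_eq)
  also have "\<dots> = integral {-R..R} (\<lambda>y. 0)"
  proof (rule integral_cong)
    fix y
    have "Re (c * \<gamma> t + (a + \<i> * of_real (s * y))) > 0" if "t \<in> {0..1}" for t
      using assms[OF that] by simp
    from contour_integral_Ln_zero[OF this]
    show "integral {0..1} (\<lambda>t. ?g t y) = 0" by (simp add: add.assoc)
  qed
  finally have "integral {0..1} (\<lambda>t. integral {-R..R} (?g t)) = 0" by simp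
  moreover have "(\<lambda>t. integral {-R..R} (?g t)) integrable_on {0..1}"
    by (rule integrable_continuous_interval[OF c1])
  ultimately show ?thesis unfolding e using integrable_integral by fastforce
qed


text \<open>
  A differentiable curve has measure zero, hence the winding number is defined almost everywhere.
\<close>
lemma null_path: "AE w in lborel. Complex (snd w) (fst w) \<notin> path_image \<gamma>"
proof -
  let ?c = "\<lambda>t. (Im (\<gamma> t), Re (\<gamma> t))"
  have "?c differentiable_on {0..1}"
  proof -
    have "(?c has_derivative (\<lambda>h. (Im (h *\<^sub>R D t), Re (h *\<^sub>R D t)))) (at t)" for t
      using deriv[of t] unfolding has_vector_derivative_def
      by (auto intro!: derivative_eq_intros)
    then show ?thesis
      by (meson differentiable_def differentiable_on_def has_derivative_at_withinI)
  qed
  then have "negligible (?c ` {0..1})"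
    by (intro negligible_differentiable_image_lowdim) simp_all
  moreover have "closed (?c ` {0..1})"
    by (intro compact_imp_closed compact_continuous_image continuous_intros cont) auto
  ultimately have "?c ` {0..1} \<in> null_sets lborel"
    by (simp add: negligible_iff_null_sets borel_closed null_sets_completion_iff)
  then show ?thesis
    by (rule AE_I') (force simp: path_image_def complex_eq_iff)
qed

context
  fixes R :: real
  assumes bound: "\<And>t. t \<in> {0..1} \<Longrightarrow> \<bar>Re (\<gamma> t)\<bar> < R \<and> \<bar>Im (\<gamma> t)\<bar> < R"
begin

text \<open>
  The integrand of the winding number about the point \<open>w = (y, x)\<close>, cut off to a square. The ordinate
  comes first because the horizontal integral is the inner one.
\<close>
definition kernel :: "real \<Rightarrow> real \<times> real \<Rightarrow> complex" where
  "kernel t w = (indicator {0..1} t * (indicator {-R..R} (fst w) * indicator {-R..R} (snd w))) *\<^sub>R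
     (D t / (\<gamma> t - Complex (snd w) (fst w)))"

lemma kernel_measurable [measurable]:
  "(\<lambda>(t, w). kernel t w) \<in> borel_measurable (lborel \<Otimes>\<^sub>M lborel)"
proof -
  have [measurable]: "D \<in> borel_measurable borel" "\<gamma> \<in> borel_measurable borel"
    using cont_D cont by (auto intro: borel_measurable_continuous_onI)
  have e: "Complex x y = of_real x + \<i> * of_real y" for x y by (simp add: complex_eq_iff)
  show ?thesis unfolding kernel_def e lborel_prod[symmetric] by measurable
qed

lemma kernel_bound:
  obtains B where "\<And>t. (\<integral>\<^sup>+w. ennreal (norm (kernel t w)) \<partial>lborel) \<le> ennreal B * indicator {0..1} t"
proof -
  have R: "R > 0" using bound[of 0] by auto
  obtain C where C: "0 \<le> C" "\<And>a. \<bar>a\<bar> \<le> R \<Longrightarrow>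
       (\<integral>\<^sup>+x. ennreal (indicator {-R..R} x * \<bar>a - x\<bar> powr (-1/2)) \<partial>lborel) \<le> ennreal C"
    using inverse_sqrt_kernel_bound[OF R] by blast
  have "bounded (D ` {0..1})"
    by (intro compact_imp_bounded compact_continuous_image continuous_on_subset[OF cont_D]) auto
  then obtain M where M: "\<And>t. t \<in> {0..1} \<Longrightarrow> norm (D t) \<le> M" unfolding bounded_iff by blast
  then have M0: "M \<ge> 0" using norm_ge_zero[of "D 0"] by (meson atLeastAtMost_iff order.trans order_refl zero_le_one)
  show thesis
  proof (rule that[of "M * (C * C)"])
    fix t :: real
    show "(\<integral>\<^sup>+w. ennreal (norm (kernel t w)) \<partial>lborel) \<le> ennreal (M * (C * C)) * indicator {0..1} t"
    proof (cases "t \<in> {0..1}")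
      case False
      then show ?thesis by (simp add: kernel_def)
    next
      case True
      let ?h = "\<lambda>a x. indicator {-R..R} x * \<bar>a - x\<bar> powr (-1/2)"
      have "(\<integral>\<^sup>+w. ennreal (norm (kernel t w)) \<partial>(lborel \<Otimes>\<^sub>M lborel))
         = (\<integral>\<^sup>+y. \<integral>\<^sup>+x. ennreal (norm (kernel t (y, x))) \<partial>lborel \<partial>lborel)"
      proof (rule lborel.nn_integral_fst[symmetric])
        have "(\<lambda>w. (\<lambda>(t, w). kernel t w) (t, w)) \<in> borel_measurable lborel"
          by measurable
        then show "(\<lambda>w. ennreal (norm (kernel t w))) \<in> borel_measurable (lborel \<Otimes>\<^sub>M lborel)"
          unfolding lborel_prod by measurable
      qed
      also have "\<dots> \<le> (\<integral>\<^sup>+y. \<integral>\<^sup>+x. ennreal M * (ennreal (?h (Im (\<gamma> t)) y) * ennreal (?h (Re (\<gamma> t)) x)) \<partial>lborel \<partial>lborel)"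
      proof (rule nn_integral_mono_AE, rule AE_mp[OF AE_lborel_singleton[of "Im (\<gamma> t)"]], rule AE_I2, rule impI)
        fix y assume y: "y \<noteq> Im (\<gamma> t)"
        show "(\<integral>\<^sup>+x. ennreal (norm (kernel t (y, x))) \<partial>lborel)
           \<le> (\<integral>\<^sup>+x. ennreal M * (ennreal (?h (Im (\<gamma> t)) y) * ennreal (?h (Re (\<gamma> t)) x)) \<partial>lborel)"
        proof (rule nn_integral_mono_AE, rule AE_mp[OF AE_lborel_singleton[of "Re (\<gamma> t)"]], rule AE_I2, rule impI)
          fix x assume x: "x \<noteq> Re (\<gamma> t)"
          let ?u = "\<gamma> t - Complex x y"
          have "norm (1 / ?u) \<le> \<bar>Re ?u\<bar> powr (-1/2) * \<bar>Im ?u\<bar> powr (-1/2)"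
            by (rule norm_inverse_le_powr) (use x y in auto)
          then have "norm (D t) * norm (1 / ?u) \<le> M * (\<bar>Re ?u\<bar> powr (-1/2) * \<bar>Im ?u\<bar> powr (-1/2))"
            using M[OF True] M0 by (intro mult_mono) auto
          then have "norm (kernel t (y, x)) \<le> M * (?h (Im (\<gamma> t)) y * ?h (Re (\<gamma> t)) x)"
            using True by (auto simp: kernel_def indicator_def norm_divide mult_ac)
          then show "ennreal (norm (kernel t (y, x))) \<le> ennreal M * (ennreal (?h (Im (\<gamma> t)) y) * ennreal (?h (Re (\<gamma> t)) x))"
            using M0 by (simp add: ennreal_mult[symmetric] ennreal_leI)
        qed
      qed
      also have "\<dots> = ennreal M * ((\<integral>\<^sup>+y. ennreal (?h (Im (\<gamma> t)) y) \<partial>lborel) * (\<integral>\<^sup>+x. ennreal (?h (Re (\<gamma> t)) x) \<partial>lborel))"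
        by (simp add: nn_integral_cmult nn_integral_multc)
      also have "\<dots> \<le> ennreal M * (ennreal C * ennreal C)"
        using bound[OF True] by (intro mult_mono C) auto
      finally show ?thesis using True M0 C(1) by (simp add: ennreal_mult lborel_prod)
    qed
  qed
qed

lemma kernel_integrable: "integrable (lborel \<Otimes>\<^sub>M lborel) (\<lambda>(t, w). kernel t w)"
proof (rule integrableI_bounded)
  obtain B where B: "\<And>t. (\<integral>\<^sup>+w. ennreal (norm (kernel t w)) \<partial>lborel) \<le> ennreal B * indicator {0..1} t"
    using kernel_bound by blast
  have "(\<integral>\<^sup>+p. ennreal (norm (case p of (t, w) \<Rightarrow> kernel t w)) \<partial>(lborel \<Otimes>\<^sub>M lborel))
     = (\<integral>\<^sup>+t. \<integral>\<^sup>+w. ennreal (norm (kernel t w)) \<partial>lborel \<partial>lborel)"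
    by (subst lborel.nn_integral_fst[symmetric]) auto
  also have "\<dots> \<le> (\<integral>\<^sup>+(t::real). ennreal B * indicator {0..1} t \<partial>lborel)"
    by (rule nn_integral_mono) (rule B)
  also have "\<dots> = ennreal B" by (simp add: nn_integral_cmult)
  finally show "(\<integral>\<^sup>+p. ennreal (norm (case p of (t, w) \<Rightarrow> kernel t w)) \<partial>(lborel \<Otimes>\<^sub>M lborel)) < \<infinity>"
    by (simp add: le_less_trans)
qed (rule kernel_measurable)

lemma kernel_integrable_section: "integrable (lborel \<Otimes>\<^sub>M lborel) (\<lambda>(y, x). kernel t (y, x))"
proof -
  have m: "(\<lambda>w. (\<lambda>(t, w). kernel t w) (t, w)) \<in> borel_measurable lborel" by measurable
  obtain B where B: "\<And>t. (\<integral>\<^sup>+w. ennreal (norm (kernel t w)) \<partial>lborel) \<le> ennreal B * indicator {0..1} t"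
    using kernel_bound by blast
  have "ennreal B * indicator {0..1} t < \<infinity>" by (auto simp: indicator_def)
  then show ?thesis unfolding lborel_prod using m le_less_trans[OF B]
    by (intro integrableI_bounded) (auto simp: split_beta)
qed


lemma LBINT_kernel_time:
  assumes "Complex x y \<notin> path_image \<gamma>"
  shows "(LBINT t. kernel t (y, x)) =
    (indicator {-R..R} y * indicator {-R..R} x) *\<^sub>R (2 * pi * \<i> * winding_number \<gamma> (Complex x y))"
proof -
  have c: "continuous_on {0..1} (\<lambda>t. D t / (\<gamma> t - Complex x y))"
    by (intro continuous_intros cont continuous_on_subset[OF cont_D]) (use assms in \<open>force simp: path_image_def\<close>)+
  have "(LBINT t. kernel t (y, x)) =
      (indicator {-R..R} y * indicator {-R..R} x) *\<^sub>R (LBINT t:{0..1}. D t / (\<gamma> t - Complex x y))"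
    unfolding set_lebesgue_integral_def integral_scaleR_right[symmetric]
    by (intro Bochner_Integration.integral_cong refl) (simp add: kernel_def mult_ac)
  also have "(LBINT t:{0..1}. D t / (\<gamma> t - Complex x y)) = integral {0..1} (\<lambda>t. D t / (\<gamma> t - Complex x y))"
    by (rule set_borel_integral_eq_integral borel_integrable_atLeastAtMost' c)+
  also have "\<dots> = 2 * pi * \<i> * winding_number \<gamma> (Complex x y)"
    unfolding winding_number_valid_path[OF valid assms] contour_integral_integral vector_derivative_eq by simp
  finally show ?thesis .
qed

text \<open>
  The two logarithms are kept in the form that \<open>contour_integral_Ln_family_zero\<close> integrates to zero; the
  last term collects the jumps, since the integral of \<open>sgn (Im z - y)\<close> over \<open>[-R, R]\<close> is \<open>2 Im z\<close>.
\<close>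
lemma LBINT_kernel_space:
  assumes t: "t \<in> {0..1}"
  shows "(LBINT w. kernel t w) =
    D t * integral {-R..R} (\<lambda>y. Ln (1 * \<gamma> t + R + \<i> * of_real (-1 * y)))
    - D t * integral {-R..R} (\<lambda>y. Ln (-1 * \<gamma> t + R + \<i> * of_real (1 * y)))
    - 2 * pi * \<i> * (Im (\<gamma> t) *\<^sub>R D t)"
proof -
  define z where "z = \<gamma> t"
  have z: "\<bar>Re z\<bar> < R" "\<bar>Im z\<bar> < R" using bound[OF t] by (auto simp: z_def)
  define L where "L y = Ln (1 * z + R + \<i> * of_real (-1 * y)) - Ln (-1 * z + R + \<i> * of_real (1 * y)) - \<i> * pi * sgn (Im z - y)" for y
  have row: "(LBINT x. kernel t (y, x)) = indicator {-R..R} y *\<^sub>R (D t * L y)" if y: "y \<noteq> Im z" for y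
  proof -
    have ne: "Complex x y \<noteq> z" for x using y by auto
    have e: "Complex x y = of_real x + \<i> * of_real y" for x by (simp add: complex_eq_iff)
    have c: "continuous_on {-R..R} (\<lambda>x. 1 / (z - Complex x y))"
      unfolding e by (intro continuous_intros) (use ne in \<open>auto simp: e[symmetric]\<close>)
    have "(LBINT x. kernel t (y, x)) = (indicator {-R..R} y *\<^sub>R D t) * (LBINT x:{-R..R}. 1 / (z - Complex x y))"
      unfolding set_lebesgue_integral_def integral_mult_right_zero[symmetric]
      by (intro Bochner_Integration.integral_cong refl) (use t in \<open>auto simp: kernel_def z_def indicator_def\<close>)
    also have "(LBINT x:{-R..R}. 1 / (z - Complex x y)) = integral {-R..R} (\<lambda>x. 1 / (z - Complex x y))"
      by (rule set_borel_integral_eq_integral borel_integrable_atLeastAtMost' c)+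
    also have "\<dots> = L y"
      using has_integral_Cauchy_kernel_horizontal[of z R y] z y
      unfolding L_def by (intro integral_unique) (simp add: algebra_simps)
    finally show ?thesis by simp
  qed
  have AE_row: "AE y in lborel. (LBINT x. kernel t (y, x)) = indicator {-R..R} y *\<^sub>R (D t * L y)"
    by (rule AE_mp[OF AE_lborel_singleton[of "Im z"]]) (simp add: row)
  have int: "integrable lborel (\<lambda>y. LBINT x. kernel t (y, x))"
    using lborel_pair.integrable_fst'[OF kernel_integrable_section[of t]] by simp
  have Lm[measurable]: "L \<in> borel_measurable borel"
    unfolding L_def by measurable
  have "(LBINT w. kernel t w) = (LBINT y. LBINT x. kernel t (y, x))"
    using lborel_pair.integral_fst'[OF kernel_integrable_section[of t]] by (simp add: lborel_prod)
  also have "\<dots> = (LBINT y:{-R..R}. D t * L y)"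
    unfolding set_lebesgue_integral_def
    by (rule integral_cong_AE) (use int AE_row in auto)
  also have "\<dots> = integral {-R..R} (\<lambda>y. D t * L y)"
  proof (rule set_borel_integral_eq_integral)
    show "set_integrable lborel {-R..R} (\<lambda>y. D t * L y)"
      unfolding set_integrable_def
      by (rule integrable_cong_AE_imp[OF int]) (use AE_row in auto)
  qed
  also have "\<dots> = D t * integral {-R..R} L" by simp
  also have "integral {-R..R} L = integral {-R..R} (\<lambda>y. Ln (1 * z + R + \<i> * of_real (-1 * y)))
     - integral {-R..R} (\<lambda>y. Ln (-1 * z + R + \<i> * of_real (1 * y))) - \<i> * pi * of_real (2 * Im z)"
    unfolding L_def
  proof (intro integral_unique has_integral_diff integrable_integral integrable_continuous_interval)
    show "continuous_on {- R..R} (\<lambda>y. Ln (1 * z + R + \<i> * of_real (-1 * y)))"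
      by (intro continuous_intros continuous_on_Ln) (use z in \<open>auto simp: complex_nonpos_Reals_iff\<close>)
    show "continuous_on {- R..R} (\<lambda>y. Ln (-1 * z + R + \<i> * of_real (1 * y)))"
      by (intro continuous_intros continuous_on_Ln) (use z in \<open>auto simp: complex_nonpos_Reals_iff\<close>)
    show "((\<lambda>x. \<i> * pi * of_real (sgn (Im z - x))) has_integral \<i> * pi * of_real (2 * Im z)) {-R..R}"
      by (intro has_integral_mult_right has_integral_of_real integral_sgn_diff z)
  qed
  finally show ?thesis
    by (simp add: z_def algebra_simps scaleR_conv_of_real)
qed

text \<open>
  Both sides are iterated integrals of the Cauchy kernel: integrated over the parameter of the curve first
  it gives the winding number, over the plane first it gives \<open>-Im \<gamma>\<close> up to holomorphic terms that vanish
  on a closed curve. The function \<open>N\<close> stands for the winding number off the null set formed by the curve.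
\<close>
theorem winding_number_integral_box:
  assumes N [measurable]: "N \<in> borel_measurable lborel"
    and AE_N: "AE w in lborel. N w =
      (indicator {-R..R} (fst w) * indicator {-R..R} (snd w)) *\<^sub>R winding_number \<gamma> (Complex (snd w) (fst w))"
  shows "(LBINT w. N w) = - integral {0..1} (\<lambda>t. Im (\<gamma> t) *\<^sub>R D t)"
proof -
  let ?c = "2 * pi * \<i>"
  let ?A = "\<lambda>t. D t * integral {-R..R} (\<lambda>y. Ln (1 * \<gamma> t + R + \<i> * of_real (-1 * y)))
    - D t * integral {-R..R} (\<lambda>y. Ln (-1 * \<gamma> t + R + \<i> * of_real (1 * y)))
    - ?c * (Im (\<gamma> t) *\<^sub>R D t)"
  have kernel_A: "(\<lambda>t. LBINT w. kernel t w) = (\<lambda>t. indicator {0..1} t *\<^sub>R ?A t)"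
  proof
    fix t show "(LBINT w. kernel t w) = indicator {0..1} t *\<^sub>R ?A t"
      by (cases "t \<in> {0..1}") (simp only: LBINT_kernel_space indicator_simps scaleR_one, simp add: kernel_def)
  qed
  have int: "integrable lborel (\<lambda>w. LBINT t. kernel t w)"
    using lborel_pair.integrable_snd[OF kernel_integrable] by simp
  then have m[measurable]: "(\<lambda>w. LBINT t. kernel t w) \<in> borel_measurable lborel" by auto
  have "AE w in lborel. N w = (LBINT t. kernel t w) / ?c"
    using null_path AE_N
  proof eventually_elim
    case (elim w)
    then show ?case using LBINT_kernel_time[of "snd w" "fst w"] by (auto simp: indicator_def)
  qed
  then have "(LBINT w. N w) = (LBINT w. (LBINT t. kernel t w) / ?c)"
    by (intro integral_cong_AE) auto
  also have "\<dots> = (LBINT w. LBINT t. kernel t w) / ?c" by simp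
  also have "(LBINT w. LBINT t. kernel t w) = (LBINT t. LBINT w. kernel t w)"
    by (rule lborel_pair.Fubini_integral[OF kernel_integrable])
  also have "\<dots> = (LBINT t:{0..1}. ?A t)"
    unfolding set_lebesgue_integral_def kernel_A ..
  also have "\<dots> = integral {0..1} ?A"
  proof (rule set_borel_integral_eq_integral)
    have "integrable lborel (\<lambda>t. LBINT w. kernel t w)"
      using lborel_pair.integrable_fst[OF kernel_integrable] by simp
    then show "set_integrable lborel {0..1} ?A"
      unfolding set_integrable_def kernel_A .
  qed
  also have "\<dots> = 0 - 0 - ?c * integral {0..1} (\<lambda>t. Im (\<gamma> t) *\<^sub>R D t)"
  proof (intro integral_unique has_integral_diff has_integral_mult_right integrable_integral)
    show "((\<lambda>t. D t * integral {-R..R} (\<lambda>y. Ln (1 * \<gamma> t + R + \<i> * of_real (-1 * y)))) has_integral 0) {0..1}"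
      by (rule contour_integral_Ln_family_zero) (use bound in force)
    show "((\<lambda>t. D t * integral {-R..R} (\<lambda>y. Ln (-1 * \<gamma> t + R + \<i> * of_real (1 * y)))) has_integral 0) {0..1}"
      by (rule contour_integral_Ln_family_zero) (use bound in force)
    show "(\<lambda>t. Im (\<gamma> t) *\<^sub>R D t) integrable_on {0..1}"
      by (intro integrable_continuous_interval continuous_intros cont continuous_on_subset[OF cont_D]) auto
  qed
  finally show "(LBINT w. N w) = - integral {0..1} (\<lambda>t. Im (\<gamma> t) *\<^sub>R D t)" by simp
qed

end

lemma integral_parts: "integral {0..1} (\<lambda>t. Re (\<gamma> t) * Im (D t)) = - integral {0..1} (\<lambda>t. Im (\<gamma> t) * Re (D t))"
proof -
  have d: "((\<lambda>t. Re (\<gamma> t) * Im (\<gamma> t)) has_vector_derivative (Re (\<gamma> t) * Im (D t) + Im (\<gamma> t) * Re (D t))) (at t within {0..1})" for t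
    using has_vector_derivative_mult[OF
        bounded_linear.has_vector_derivative[OF bounded_linear_Re deriv[THEN has_vector_derivative_at_within]]
        bounded_linear.has_vector_derivative[OF bounded_linear_Im deriv[THEN has_vector_derivative_at_within]]]
    by (simp add: mult.commute)
  have "((\<lambda>t. Re (\<gamma> t) * Im (D t) + Im (\<gamma> t) * Re (D t)) has_integral 0) {0..1}"
    using fundamental_theorem_of_calculus[OF _ d] loop by simp
  then have "integral {0..1} (\<lambda>t. Re (\<gamma> t) * Im (D t) + Im (\<gamma> t) * Re (D t)) = 0"
    by (rule integral_unique)
  moreover have i: "(\<lambda>t. Re (\<gamma> t) * Im (D t)) integrable_on {0..1}" "(\<lambda>t. Im (\<gamma> t) * Re (D t)) integrable_on {0..1}"
    by (intro integrable_continuous_interval continuous_intros cont continuous_on_subset[OF cont_D]; simp)+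
  ultimately show ?thesis
    using Henstock_Kurzweil_Integration.integral_add[OF i] by linarith
qed

text \<open>
  By the Jordan curve theorem the winding number is \<open>\<sigma>\<close> inside and zero outside, so its integral over the
  plane is the signed enclosed area.
\<close>
theorem area_inside:
  assumes simple: "simple_path \<gamma>"
  shows "\<exists>\<sigma>\<in>{1,-1}. (\<forall>z\<in>inside (path_image \<gamma>). winding_number \<gamma> z = of_real \<sigma>) \<and>
     integral {0..1} (\<lambda>t. Re (\<gamma> t) * Im (D t)) = \<sigma> * measure lborel (inside (path_image \<gamma>))"
proof -
  let ?I = "inside (path_image \<gamma>)"
  note J = Jordan_inside_outside[OF simple finish_start]
  obtain \<sigma> :: real where \<sigma>: "\<sigma> \<in> {1,-1}" and wn: "\<And>z. z \<in> ?I \<Longrightarrow> winding_number \<gamma> z = of_real \<sigma>"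
    using simple_closed_path_winding_number_inside[OF simple] by (metis insertCI of_real_1 of_real_minus)
  have wn0: "winding_number \<gamma> z = 0" if "z \<in> outside (path_image \<gamma>)" for z
    using winding_number_zero_in_outside[OF _ finish_start that] valid valid_path_imp_path by blast
  have "bounded (\<gamma> ` {0..1} \<union> ?I)" using J compact_continuous_image[OF cont] compact_imp_bounded by auto
  then obtain R where R: "\<And>z. z \<in> \<gamma> ` {0..1} \<union> ?I \<Longrightarrow> norm z < R"
    by (meson bounded_pos_less)
  have box: "\<bar>Re z\<bar> < R \<and> \<bar>Im z\<bar> < R" if "z \<in> \<gamma> ` {0..1} \<union> ?I" for z
    using R[OF that] abs_Re_le_cmod[of z] abs_Im_le_cmod[of z] by linarith
  let ?C = "\<lambda>w::real\<times>real. Complex (snd w) (fst w)"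
  have C_cont: "continuous_on UNIV ?C"
    by (simp add: Complex_eq) (intro continuous_intros)
  have [measurable]: "?C \<in> borel_measurable borel" using C_cont by (rule borel_measurable_continuous_onI)
  have [measurable]: "?I \<in> sets borel" using J by auto
  define N :: "real \<times> real \<Rightarrow> complex" where "N w = indicator ?I (?C w) *\<^sub>R of_real \<sigma>" for w
  have "(LBINT w. N w) = - integral {0..1} (\<lambda>t. Im (\<gamma> t) *\<^sub>R D t)"
  proof (rule winding_number_integral_box)
    show "\<bar>Re (\<gamma> t)\<bar> < R \<and> \<bar>Im (\<gamma> t)\<bar> < R" if "t \<in> {0..1}" for t using that box by blast
    show "N \<in> borel_measurable lborel" unfolding N_def by measurable
    show "AE w in lborel. N w =
      (indicator {-R..R} (fst w) * indicator {-R..R} (snd w)) *\<^sub>R winding_number \<gamma> (?C w)"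
      using null_path
    proof eventually_elim
      case (elim w)
      then consider "?C w \<in> ?I" | "?C w \<in> outside (path_image \<gamma>)" using J by blast
      then show ?case
      proof cases
        case 1
        then show ?thesis using box[of "?C w"] by (simp add: N_def wn indicator_def abs_less_iff)
      next
        case 2
        then have "?C w \<notin> ?I" using J by blast
        then show ?thesis using wn0[OF 2] by (simp add: N_def)
      qed
    qed
  qed
  also have "(LBINT w. N w) = of_real (\<sigma> * measure lborel (?C -` ?I))"
  proof -
    have "(LBINT w. N w) = (LBINT w. complex_of_real (\<sigma> * indicator (?C -` ?I) w))"
      by (intro Bochner_Integration.integral_cong) (auto simp: N_def indicator_def)
    also have "\<dots> = of_real (LBINT w. \<sigma> * indicator (?C -` ?I) w)" by (rule integral_complex_of_real)
    finally show ?thesis by simp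
  qed
  also have "measure lborel (?C -` ?I) = measure (distr lborel borel ?C) ?I"
    by (subst measure_distr) auto
  also have "\<dots> = measure lborel ?I" unfolding lborel_complex ..
  finally have *: "complex_of_real (\<sigma> * measure lborel ?I) = - integral {0..1} (\<lambda>t. Im (\<gamma> t) *\<^sub>R D t)" .
  have "(\<lambda>t. Im (\<gamma> t) *\<^sub>R D t) integrable_on {0..1}"
    by (intro integrable_continuous_interval continuous_intros cont continuous_on_subset[OF cont_D]) auto
  then have "Re (integral {0..1} (\<lambda>t. Im (\<gamma> t) *\<^sub>R D t)) = integral {0..1} (\<lambda>t. Im (\<gamma> t) * Re (D t))"
    using integral_linear[OF _ bounded_linear_Re] by (force simp: o_def)
  then have "\<sigma> * measure lborel ?I = integral {0..1} (\<lambda>t. Re (\<gamma> t) * Im (D t))"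
    using arg_cong[OF *, of Re] integral_parts by simp
  then show ?thesis using \<sigma> wn by auto
qed

end

section \<open>Ordinary differential equations with a Lipschitz field\<close>

lemma integral_has_vector_derivative_half_line:
  fixes f :: "real \<Rightarrow> 'a::banach"
  assumes "continuous_on {0..} f" "t \<ge> 0"
  shows "((\<lambda>t. integral {0..t} f) has_vector_derivative f t) (at t within {0..})"
proof -
  have "((\<lambda>t. integral {0..t} f) has_vector_derivative f t) (at t within {0..t+1})"
    by (intro integral_has_vector_derivative continuous_on_subset[OF assms(1)]) (use assms in auto)
  moreover have "at t within {0..t+1} = at t within {0..}"
    by (rule at_within_nhd[of _ "{..<t+1}"]) auto
  ultimately show ?thesis by simp
qed

text \<open>
  Picard iteration in the variable \<open>u t = exp (- K t) (x t - z\<^sub>0)\<close>. With the weight \<open>K = 2 L + 1\<close> the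
  integral operator is a contraction of the bounded continuous functions on the whole line, so one
  application of Banach's theorem yields the solution for all positive times.
\<close>
lemma global_solution:
  fixes Y :: "'a::euclidean_space \<Rightarrow> 'a"
  assumes lip: "\<And>x y. norm (Y x - Y y) \<le> L * norm (x - y)" and bd: "\<And>x. norm (Y x) \<le> B"
    and L: "L \<ge> 0"
  shows "\<exists>x. x 0 = z0 \<and> (\<forall>t\<ge>0. (x has_vector_derivative Y (x t)) (at t within {0..}))"
proof -
  define K where "K = 2 * L + 1"
  have K: "K > 0" using L by (simp add: K_def)
  have B: "B \<ge> 0" using norm_ge_zero bd order_trans by blast
  have contY: "continuous_on S Y" for S
    by (rule lipschitz_on_continuous_on[of L]) (use lip L in \<open>auto simp: lipschitz_on_def dist_norm\<close>)
  define F where "F u s = Y (z0 + exp (K * s) *\<^sub>R apply_bcontfun u s)" for u :: "real \<Rightarrow>\<^sub>C 'a" and s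
  \<comment> \<open>The truncation at time zero makes the operator act on functions on the whole line.\<close>
  define P where "P u t = exp (- K * max 0 t) *\<^sub>R integral {0..max 0 t} (F u)" for u t
  have contu: "continuous_on S (apply_bcontfun u)" for S and u :: "real \<Rightarrow>\<^sub>C 'a"
    using apply_bcontfun[of u] by (auto simp: bcontfun_def intro: continuous_on_subset)
  have contF: "continuous_on S (F u)" for S u
    unfolding F_def by (intro continuous_intros continuous_on_compose2[OF contY[of UNIV]] contu) auto
  have intF: "F u integrable_on {0..t}" for u t
    by (intro integrable_continuous_interval contF)
  have contI: "continuous_on {0..} (\<lambda>t. integral {0..t} (F u))" for u
    by (rule continuous_on_vector_derivative[OF integral_has_vector_derivative_half_line]) (auto simp: contF)
  have P_bcont: "P u \<in> bcontfun" for u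
  proof -
    have "continuous_on UNIV (P u)"
      unfolding P_def by (intro continuous_intros continuous_on_compose2[OF contI]) auto
    moreover have "norm (P u t) \<le> B / K" for t
    proof -
      let ?s = "max 0 t"
      have "norm (integral {0..?s} (F u)) \<le> B * (?s - 0)"
        by (rule integral_bound) (simp, rule contF, simp add: F_def bd)
      then have "norm (P u t) \<le> exp (- K * ?s) * (B * ?s)"
        unfolding P_def by (simp add: mult_left_mono)
      also have "\<dots> \<le> exp (- K * ?s) * (B * (exp (K * ?s) / K))"
      proof -
        have "K * ?s \<le> exp (K * ?s)" using exp_ge_add_one_self[of "K * ?s"] by linarith
        then have "?s \<le> exp (K * ?s) / K" by (simp only: pos_le_divide_eq[OF K] mult.commute)
        then show ?thesis using B by (intro mult_left_mono) auto
      qed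
      also have "\<dots> = B / K" by (simp add: exp_minus field_simps)
      finally show ?thesis .
    qed
    ultimately show ?thesis unfolding bcontfun_def bounded_iff by blast
  qed
  define T where "T u = Bcontfun (P u)" for u
  have T: "apply_bcontfun (T u) = P u" for u
    unfolding T_def using P_bcont by (simp add: Bcontfun_inverse)
  have "\<forall>u v. dist (T u) (T v) \<le> 1/2 * dist u v"
  proof (intro allI dist_bound)
    fix u v and t :: real
    let ?s = "max 0 t"
    have ex: "((\<lambda>s. exp (K * s)) has_integral (exp (K * ?s) / K - exp (K * 0) / K)) {0..?s}"
      by (rule fundamental_theorem_of_calculus)
        (use K in \<open>auto intro!: derivative_eq_intros simp: has_real_derivative_iff_has_vector_derivative[symmetric]\<close>)
    have "norm (integral {0..?s} (F u) - integral {0..?s} (F v)) = norm (integral {0..?s} (\<lambda>s. F u s - F v s))"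
      by (simp add: Henstock_Kurzweil_Integration.integral_diff[OF intF intF])
    also have "\<dots> \<le> integral {0..?s} (\<lambda>s. (L * dist u v) * exp (K * s))"
    proof (rule integral_norm_bound_integral)
      show "(\<lambda>s. F u s - F v s) integrable_on {0..?s}"
        by (intro integrable_continuous_interval continuous_intros contF)
      show "(\<lambda>s. (L * dist u v) * exp (K * s)) integrable_on {0..?s}"
        by (intro integrable_continuous_interval continuous_intros)
      fix s
      have "norm (F u s - F v s) \<le> L * norm (exp (K * s) *\<^sub>R apply_bcontfun u s - exp (K * s) *\<^sub>R apply_bcontfun v s)"
        unfolding F_def using lip by (metis add_diff_cancel_left)
      also have "\<dots> = L * (exp (K * s) * dist (apply_bcontfun u s) (apply_bcontfun v s))"
        by (simp add: dist_norm scaleR_diff_right[symmetric])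
      also have "\<dots> \<le> L * (exp (K * s) * dist u v)"
        using L by (intro mult_left_mono dist_bounded) auto
      finally show "norm (F u s - F v s) \<le> (L * dist u v) * exp (K * s)" by (simp add: mult_ac)
    qed
    also have "\<dots> = (L * dist u v) * (exp (K * ?s) / K - 1 / K)"
      using integral_unique[OF ex] by simp
    also have "\<dots> \<le> (L * dist u v) * (exp (K * ?s) / K)"
      using L K by (intro mult_left_mono) auto
    finally have n: "norm (integral {0..?s} (F u) - integral {0..?s} (F v)) \<le> (L * dist u v) * (exp (K * ?s) / K)" .
    have "dist (P u t) (P v t) = exp (- K * ?s) * norm (integral {0..?s} (F u) - integral {0..?s} (F v))"
      unfolding P_def dist_norm scaleR_diff_right[symmetric] by simp
    also have "\<dots> \<le> exp (- K * ?s) * ((L * dist u v) * (exp (K * ?s) / K))"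
      using n by (rule mult_left_mono) simp
    also have "\<dots> = L / K * dist u v" by (simp add: exp_minus field_simps)
    also have "\<dots> \<le> 1/2 * dist u v"
      using L K by (intro mult_right_mono) (auto simp: K_def field_simps)
    finally show "dist (apply_bcontfun (T u) t) (apply_bcontfun (T v) t) \<le> 1/2 * dist u v" unfolding T .
  qed
  then obtain u where u: "T u = u" using banach_fix_type[of "1/2" T] by auto
  define x where "x t = z0 + exp (K * t) *\<^sub>R apply_bcontfun u t" for t
  have x_eq: "x t = z0 + integral {0..t} (F u)" if "t \<ge> 0" for t
  proof -
    have "apply_bcontfun u t = P u t" using T[of u] u by simp
    then show ?thesis using that unfolding x_def P_def by (simp add: exp_minus)
  qed
  have Fx: "F u s = Y (x s)" for s unfolding F_def x_def ..
  have "(x has_vector_derivative Y (x t)) (at t within {0..})" if t: "t \<ge> 0" for t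
  proof -
    have "((\<lambda>t. z0 + integral {0..t} (F u)) has_vector_derivative 0 + F u t) (at t within {0..})"
      by (intro has_vector_derivative_add has_vector_derivative_const
          integral_has_vector_derivative_half_line contF t)
    then have "((\<lambda>t. z0 + integral {0..t} (F u)) has_vector_derivative Y (x t)) (at t within {0..})"
      by (simp add: Fx)
    then show ?thesis
      by (rule has_vector_derivative_transform[rotated -1]) (use t x_eq in auto)
  qed
  moreover have "x 0 = z0" using x_eq[of 0] by simp
  ultimately show ?thesis by blast
qed

text \<open>
  Gronwall's argument: \<open>\<bar>u - v\<bar>\<^sup>2 exp (- 2 M L t)\<close> is nonincreasing and vanishes at zero. The factor \<open>c\<close>
  allows curves that follow the field with variable speed, as closed characteristics do.
\<close>
lemma ode_solution_unique:
  fixes u v :: "real \<Rightarrow> 'a::real_inner"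
  assumes u: "\<And>t. t \<in> {0..b} \<Longrightarrow> (u has_vector_derivative c t *\<^sub>R Y (u t)) (at t within {0..b})"
    and v: "\<And>t. t \<in> {0..b} \<Longrightarrow> (v has_vector_derivative c t *\<^sub>R Y (v t)) (at t within {0..b})"
    and c: "\<And>t. t \<in> {0..b} \<Longrightarrow> 0 \<le> c t \<and> c t \<le> M"
    and S: "\<And>t. t \<in> {0..b} \<Longrightarrow> u t \<in> S \<and> v t \<in> S"
    and lip: "\<And>x y. x \<in> S \<Longrightarrow> y \<in> S \<Longrightarrow> norm (Y x - Y y) \<le> L * norm (x - y)" and L: "L \<ge> 0"
    and init: "u 0 = v 0" and t: "t \<in> {0..b}"
  shows "u t = v t"
proof -
  define g where "g t = ((u t - v t) \<bullet> (u t - v t)) * exp (- (2 * M * L * t))" for t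
  let ?d = "\<lambda>t. c t *\<^sub>R (Y (u t) - Y (v t))"
  have g': "(g has_vector_derivative (2 * ((u s - v s) \<bullet> ?d s) - 2 * M * L * ((u s - v s) \<bullet> (u s - v s))) * exp (- (2 * M * L * s))) (at s within {0..b})"
    if "s \<in> {0..b}" for s
  proof -
    have w: "((\<lambda>t. u t - v t) has_vector_derivative ?d s) (at s within {0..b})"
      using has_vector_derivative_diff[OF u v, OF that that] by (simp add: scaleR_diff_right)
    have e: "((\<lambda>t. exp (- (2 * M * L * t))) has_vector_derivative (- (2 * M * L)) * exp (- (2 * M * L * s))) (at s within {0..b})"
      unfolding has_real_derivative_iff_has_vector_derivative[symmetric]
      by (auto intro!: derivative_eq_intros)
    show ?thesis
      unfolding g_def
      using has_vector_derivative_mult[OF bounded_bilinear.has_vector_derivative[OF bounded_bilinear_inner w w] e]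
      by (simp add: inner_commute algebra_simps)
  qed
  have neg: "2 * ((u s - v s) \<bullet> ?d s) - 2 * M * L * ((u s - v s) \<bullet> (u s - v s)) \<le> 0" if s: "s \<in> {0..b}" for s
  proof -
    have "(u s - v s) \<bullet> ?d s \<le> norm (u s - v s) * norm (?d s)" by (rule norm_cauchy_schwarz)
    also have "norm (?d s) \<le> M * (L * norm (u s - v s))"
      using c[OF s] lip[of "u s" "v s"] S[OF s] by (auto intro!: mult_mono)
    finally have "(u s - v s) \<bullet> ?d s \<le> norm (u s - v s) * (M * (L * norm (u s - v s)))"
      by (simp add: mult_left_mono)
    then show ?thesis by (simp add: power2_norm_eq_inner[symmetric] power2_eq_square mult_ac)
  qed
  have "g t \<le> g 0"
  proof (rule DERIV_nonpos_imp_decreasing_open[where f = g and a = 0 and b = t])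
    show "0 \<le> t" using t by simp
    show "continuous_on {0..t} g"
      by (rule continuous_on_subset[OF continuous_on_vector_derivative[OF g']]) (use t in auto)
    fix s assume "0 < s" "s < t"
    then have s: "s \<in> {0..b}" "s \<in> interior {0..b}" using t by auto
    show "\<exists>y. (g has_real_derivative y) (at s) \<and> y \<le> 0"
      using g'[OF s(1)] neg[OF s(1)] at_within_interior[OF s(2)]
      by (auto simp: has_real_derivative_iff_has_vector_derivative mult_le_0_iff)
  qed
  then have "((u t - v t) \<bullet> (u t - v t)) * exp (- (2 * M * L * t)) \<le> 0" by (simp add: g_def init)
  then have "(u t - v t) \<bullet> (u t - v t) \<le> 0" by (simp add: mult_le_0_iff)
  then show ?thesis by (metis inner_ge_zero inner_eq_zero_iff antisym eq_iff_diff_eq_0)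
qed

section \<open>Hamiltonians on the plane with a single critical point\<close>

text \<open>
  \<open>G\<close> is the gradient of \<open>k\<close> and \<open>G'\<close> its derivative. The Hamiltonian field is \<open>\<i> * G\<close>; it is the gradient
  turned by a right angle, so \<open>k\<close> is constant along it.
\<close>
locale planar_hamiltonian =
  fixes k :: "complex \<Rightarrow> real" and G :: "complex \<Rightarrow> complex"
    and G' :: "complex \<Rightarrow> complex \<Rightarrow> complex" and zm :: complex
  assumes k_deriv: "(k has_derivative (\<lambda>v. G z \<bullet> v)) (at z)"
    and G_deriv: "(G has_derivative G' z) (at z)"
    and G'_cont: "continuous_on UNIV (\<lambda>z. G' z v)"
    and proper: "filterlim k at_top at_infinity"
    and crit: "G z = 0 \<Longrightarrow> z = zm"
    and min: "k zm \<le> k z"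
begin

lemma k_cont: "continuous_on S k"
  using k_deriv by (meson continuous_at_imp_continuous_on has_derivative_continuous)

lemma G_cont: "continuous_on S G"
  using G_deriv by (meson continuous_at_imp_continuous_on has_derivative_continuous)

text \<open>
  This is how the absence of other critical points is used: local extrema over open sets can only
  occur at \<open>zm\<close>.
\<close>
lemma grad_zero_at_extremum:
  assumes "open S" "z \<in> S" "(\<forall>w\<in>S. k z \<le> k w) \<or> (\<forall>w\<in>S. k w \<le> k z)"
  shows "z = zm"
proof -
  have "(\<lambda>v. G z \<bullet> v) = (\<lambda>v. 0)"
    using differential_zero_maxmin[OF assms(2,1) k_deriv] assms(3) by blast
  then have "G z \<bullet> G z = 0" by metis
  then show ?thesis using crit by simp
qed

lemma k_eq_min_iff: "k z = k zm \<longleftrightarrow> z = zm"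
  using grad_zero_at_extremum[of UNIV z] min by fastforce

lemma G_nz: "k z > k zm \<Longrightarrow> G z \<noteq> 0"
  using crit by force

lemma G_zm: "G zm = 0"
proof -
  have "(\<lambda>v. G zm \<bullet> v) = (\<lambda>v. 0)"
    using differential_zero_maxmin[OF _ open_UNIV k_deriv[of zm]] min by blast
  then have "G zm \<bullet> G zm = 0" by metis
  then show ?thesis by simp
qed

lemma sublevel_bounded: obtains R where "R > 0" "\<And>z. k z \<le> e \<Longrightarrow> norm z < R"
proof -
  have "eventually (\<lambda>z. e < k z) at_infinity"
    using proper by (simp add: filterlim_at_top_dense)
  then obtain b where b: "\<And>z. b \<le> norm z \<Longrightarrow> e < k z"
    unfolding eventually_at_infinity by blast
  show thesis
    by (rule that[of "max b 1"]) (use b in \<open>force simp: not_le[symmetric]\<close>)+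
qed

lemma closed_sublevel: "closed {z. k z \<le> e}"
  by (intro closed_Collect_le k_cont continuous_on_const)

lemma compact_sublevel: "compact {z. k z \<le> e}"
proof -
  obtain R where "\<And>z. k z \<le> e \<Longrightarrow> norm z < R" using sublevel_bounded[of e] by metis
  then have "bounded {z. k z \<le> e}" unfolding bounded_iff using less_imp_le by blast
  then show ?thesis using closed_sublevel compact_eq_bounded_closed by blast
qed

lemma compact_level: "compact {z. k z = e}"
proof -
  have "{z. k z = e} = {z. k z \<le> e} \<inter> {z. k z = e}" by auto
  moreover have "closed {z. k z = e}" by (intro closed_Collect_eq k_cont continuous_on_const)
  ultimately show ?thesis using compact_sublevel compact_Int_closed by metis
qed

lemma G_lipschitz:
  obtains L where "L > 0" "\<And>x y. x \<in> cball 0 R \<Longrightarrow> y \<in> cball 0 R \<Longrightarrow> norm (G x - G y) \<le> L * norm (x - y)"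
proof -
  have bd: "\<exists>M. \<forall>z\<in>cball 0 R. norm (G' z v) \<le> M" for v
  proof -
    have "compact ((\<lambda>z. G' z v) ` cball 0 R)"
      by (intro compact_continuous_image continuous_on_subset[OF G'_cont]) auto
    then show ?thesis using compact_imp_bounded bounded_iff by (metis image_eqI)
  qed
  obtain A B where A: "\<And>z. z \<in> cball 0 R \<Longrightarrow> norm (G' z 1) \<le> A" and B: "\<And>z. z \<in> cball 0 R \<Longrightarrow> norm (G' z \<i>) \<le> B"
    using bd[of 1] bd[of \<i>] by blast
  define L where "L = \<bar>A\<bar> + \<bar>B\<bar> + 1"
  have "norm (G x - G y) \<le> L * norm (x - y)" if "x \<in> cball 0 R" "y \<in> cball 0 R" for x y
  proof (rule differentiable_bound[of "cball 0 R"])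
    show "(G has_derivative G' z) (at z within cball 0 R)" for z
      using G_deriv by (rule has_derivative_at_withinI)
    fix z assume z: "z \<in> cball (0::complex) R"
    show "onorm (G' z) \<le> L"
    proof (rule onorm_le)
      fix v
      interpret bounded_linear "G' z" using G_deriv by (rule has_derivative_bounded_linear)
      have "v = Re v *\<^sub>R 1 + Im v *\<^sub>R \<i>" by (simp add: complex_eq_iff)
      then have "G' z v = Re v *\<^sub>R G' z 1 + Im v *\<^sub>R G' z \<i>" by (metis add scaleR)
      then have "norm (G' z v) \<le> \<bar>Re v\<bar> * norm (G' z 1) + \<bar>Im v\<bar> * norm (G' z \<i>)"
        by (metis norm_scaleR norm_triangle_ineq)
      also have "\<dots> \<le> norm v * \<bar>A\<bar> + norm v * \<bar>B\<bar>"
        using A[OF z] B[OF z] by (intro add_mono mult_mono abs_Re_le_cmod abs_Im_le_cmod) auto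
      also have "\<dots> \<le> L * norm v" by (simp add: L_def algebra_simps)
      finally show "norm (G' z v) \<le> L * norm v" .
    qed
  qed (use that in auto)
  moreover have "L > 0" unfolding L_def by linarith
  ultimately show thesis using that by blast
qed

lemma level_taylor:
  assumes lip: "\<And>x y. x \<in> cball 0 R \<Longrightarrow> y \<in> cball 0 R \<Longrightarrow> norm (G x - G y) \<le> L * norm (x - y)"
    and z: "z \<in> cball 0 R" and w: "w \<in> cball 0 R" and L: "L > 0"
  shows "\<bar>k w - k z - G z \<bullet> (w - z)\<bar> \<le> L * (norm (w - z))\<^sup>2"
proof -
  define g where "g u = k u - G z \<bullet> u" for u
  have "norm (g w - g z) \<le> (L * norm (w - z)) * norm (w - z)"
  proof (rule differentiable_bound[of "closed_segment z w"])
    fix u assume u: "u \<in> closed_segment z w"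
    show "(g has_derivative (\<lambda>v. (G u - G z) \<bullet> v)) (at u within closed_segment z w)"
      unfolding g_def
      by (auto intro!: derivative_eq_intros has_derivative_at_withinI[OF k_deriv] simp: inner_diff_left)
    have "u \<in> cball 0 R" using u z w closed_segment_subset[OF z w convex_cball] by blast
    then have "norm (G u - G z) \<le> L * norm (u - z)" using lip z by blast
    also have "\<dots> \<le> L * norm (w - z)"
      using segment_bound(1)[OF u] L by (intro mult_left_mono) (auto simp: norm_minus_commute)
    finally have "norm (G u - G z) \<le> L * norm (w - z)" .
    then show "onorm (\<lambda>v. (G u - G z) \<bullet> v) \<le> L * norm (w - z)"
      by (intro onorm_le order_trans[OF Cauchy_Schwarz_ineq2[unfolded real_norm_def[symmetric]]] mult_right_mono) auto
  qed auto
  then show ?thesis by (simp add: g_def inner_diff_right power2_eq_square algebra_simps)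
qed

lemma k_along_curve:
  assumes "(x has_vector_derivative v) (at t within S)"
  shows "((\<lambda>t. k (x t)) has_vector_derivative G (x t) \<bullet> v) (at t within S)"
  using has_derivative_compose[OF assms[unfolded has_vector_derivative_def] k_deriv]
  by (simp add: has_vector_derivative_def)

lemma inner_ii_self: "z \<bullet> (\<i> * z) = 0"
  by (simp add: inner_complex_def)

text \<open>
  The field is made bounded and globally Lipschitz by composing it with the projection onto a ball whose
  complement lies above the level of \<open>z0\<close>. As long as the solution stays in the open ball, \<open>k\<close> is constant
  along it; at a first exit time the level would have to be higher, hence it never leaves.
\<close>
lemma forward_orbit:
  obtains x where "x 0 = z0" "\<And>t. t \<ge> 0 \<Longrightarrow> (x has_vector_derivative \<i> * G (x t)) (at t within {0..})"
    "\<And>t. t \<ge> 0 \<Longrightarrow> k (x t) = k z0"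
proof -
  obtain R where R: "R > 0" "\<And>z. k z \<le> k z0 \<Longrightarrow> norm z < R" using sublevel_bounded[of "k z0"] by metis
  obtain L where L: "L > 0" and lip: "\<And>x y. x \<in> cball 0 R \<Longrightarrow> y \<in> cball 0 R \<Longrightarrow> norm (G x - G y) \<le> L * norm (x - y)"
    using G_lipschitz by blast
  define pr :: "complex \<Rightarrow> complex" where "pr = closest_point (cball 0 R)"
  have pr_in: "pr z \<in> cball 0 R" for z
    unfolding pr_def by (rule closest_point_in_set) (use R in auto)
  have pr_lip: "norm (pr x - pr y) \<le> norm (x - y)" for x y
    using closest_point_lipschitz[of "cball 0 R" x y] R unfolding pr_def dist_norm by auto
  have pr_id: "pr z = z" if "norm z < R" for z
    unfolding pr_def using that by (intro closest_point_self) auto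
  define Y where "Y z = \<i> * G (pr z)" for z
  have "norm (Y x - Y y) \<le> L * norm (x - y)" for x y
  proof -
    have "norm (Y x - Y y) = norm (G (pr x) - G (pr y))"
      unfolding Y_def by (metis mult_1 norm_ii norm_mult right_diff_distrib)
    also have "\<dots> \<le> L * norm (pr x - pr y)" using lip pr_in by blast
    also have "\<dots> \<le> L * norm (x - y)" using pr_lip L by simp
    finally show ?thesis .
  qed
  moreover obtain B where "\<And>z. z \<in> cball 0 R \<Longrightarrow> norm (G z) \<le> B"
    using compact_imp_bounded[OF compact_continuous_image[OF G_cont compact_cball]] unfolding bounded_iff by blast
  then have "norm (Y z) \<le> B" for z using pr_in by (simp add: Y_def norm_mult)
  ultimately obtain x where x0: "x 0 = z0" and x': "\<And>t. t \<ge> 0 \<Longrightarrow> (x has_vector_derivative Y (x t)) (at t within {0..})"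
    using global_solution[of Y L B z0] L by (metis less_imp_le)
  have xc: "continuous_on {0..} x" using x' by (intro continuous_on_vector_derivative) auto
  have xat: "(x has_vector_derivative Y (x t)) (at t)" if "t > 0" for t
    using x'[of t] that at_within_interior[of t "{0..}"] by simp
  have kconst: "k (x t) = k z0" if t: "t > 0" and in_R: "\<And>s. 0 < s \<Longrightarrow> s < t \<Longrightarrow> norm (x s) < R" for t
  proof -
    have "k (x t) = k (x 0)"
    proof (rule DERIV_isconst_end[OF t])
      show "continuous_on {0..t} (\<lambda>t. k (x t))"
        by (rule continuous_on_compose2[OF k_cont[of UNIV] continuous_on_subset[OF xc]]) auto
      fix s assume s: "0 < s" "s < t"
      show "((\<lambda>t. k (x t)) has_real_derivative 0) (at s)"
        using k_along_curve[OF xat[OF s(1)]] pr_id[OF in_R[OF s]]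
        by (simp add: has_real_derivative_iff_has_vector_derivative Y_def inner_ii_self)
    qed
    then show ?thesis by (simp add: x0)
  qed
  have inside: "norm (x t) < R" if t: "t \<ge> 0" for t
  proof (rule ccontr)
    assume "\<not> norm (x t) < R"
    define S where "S = {s\<in>{0..t}. norm (x s) \<ge> R}"
    have "closed S" unfolding S_def
      by (intro continuous_on_closed_Collect_le continuous_intros continuous_on_subset[OF xc]) auto
    moreover have "S \<noteq> {}" "bdd_below S" using t \<open>\<not> norm (x t) < R\<close> by (auto simp: S_def intro!: bdd_belowI[of _ 0])
    ultimately have I: "Inf S \<in> S" using closed_contains_Inf by blast
    have "norm (x 0) < R" using R x0 by auto
    then have "Inf S > 0" using I unfolding S_def by (metis (mono_tags, lifting) atLeastAtMost_iff le_less mem_Collect_eq not_le)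
    moreover have "norm (x s) < R" if "0 < s" "s < Inf S" for s
    proof (rule ccontr)
      assume "\<not> norm (x s) < R"
      then have "s \<in> S" using that I by (auto simp: S_def)
      then show False using cInf_lower[OF _ \<open>bdd_below S\<close>] that by fastforce
    qed
    ultimately have "k (x (Inf S)) = k z0" by (rule kconst)
    then have "norm (x (Inf S)) < R" using R by simp
    then show False using I by (simp add: S_def)
  qed
  show thesis
  proof (rule that[of x])
    fix t :: real assume t: "t \<ge> 0"
    show "(x has_vector_derivative \<i> * G (x t)) (at t within {0..})"
      using x'[OF t] pr_id[OF inside[OF t]] by (simp add: Y_def)
    show "k (x t) = k z0"
      using kconst[of t] inside t x0 by (cases "t = 0") auto
  qed (rule x0)
qed

lemma orbit_unique:
  assumes x: "\<And>t. t \<ge> 0 \<Longrightarrow> (x has_vector_derivative \<i> * G (x t)) (at t within {0..})"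
    and y: "\<And>t. t \<ge> 0 \<Longrightarrow> (y has_vector_derivative \<i> * G (y t)) (at t within {0..})"
    and kx: "\<And>t. t \<ge> 0 \<Longrightarrow> k (x t) \<le> e" and ky: "\<And>t. t \<ge> 0 \<Longrightarrow> k (y t) \<le> e"
    and init: "x 0 = y 0" and t: "t \<ge> 0"
  shows "x t = y t"
proof -
  obtain R where R: "R > 0" "\<And>z. k z \<le> e \<Longrightarrow> norm z < R" using sublevel_bounded[of e] by metis
  obtain L where L: "L > 0" and lip: "\<And>x y. x \<in> cball 0 R \<Longrightarrow> y \<in> cball 0 R \<Longrightarrow> norm (G x - G y) \<le> L * norm (x - y)"
    using G_lipschitz by blast
  show ?thesis
  proof (rule ode_solution_unique[where b = t and c = "\<lambda>_. 1" and M = 1 and S = "cball 0 R" and L = L and Y = "\<lambda>z. \<i> * G z"])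
    show "norm (\<i> * G x - \<i> * G y) \<le> L * norm (x - y)" if "x \<in> cball 0 R" "y \<in> cball 0 R" for x y
      using lip[OF that] by (metis mult_1 norm_ii norm_mult right_diff_distrib)
    show "x s \<in> cball 0 R \<and> y s \<in> cball 0 R" if "s \<in> {0..t}" for s
      using R(2)[OF kx[of s]] R(2)[OF ky[of s]] that by auto
    show "(x has_vector_derivative 1 *\<^sub>R (\<i> * G (x s))) (at s within {0..t})" if "s \<in> {0..t}" for s
      using has_vector_derivative_within_subset[OF x[of s]] that by auto
    show "(y has_vector_derivative 1 *\<^sub>R (\<i> * G (y s))) (at s within {0..t})" if "s \<in> {0..t}" for s
      using has_vector_derivative_within_subset[OF y[of s]] that by auto
  qed (use init t L in auto)
qed

end

section \<open>Periodic orbits\<close>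

context planar_hamiltonian
begin

definition solution :: "(real \<Rightarrow> complex) \<Rightarrow> bool" where
  "solution x \<longleftrightarrow> (\<forall>t. (x has_vector_derivative \<i> * G (x t)) (at t))"

text \<open>
  The last clause makes \<open>T\<close> the minimal period, so that one period is traversed without self-intersection.
\<close>
definition periodic_orbit :: "real \<Rightarrow> (real \<Rightarrow> complex) \<Rightarrow> real \<Rightarrow> bool" where
  "periodic_orbit e x T \<longleftrightarrow> 0 < T \<and> solution x \<and> (\<forall>t. k (x t) = e) \<and> (\<forall>t. x (t + T) = x t) \<and>
     (\<forall>s t. 0 \<le> s \<longrightarrow> s < t \<longrightarrow> t < T \<longrightarrow> x s \<noteq> x t)"

lemma plane_orthogonal:
  fixes v z :: complex
  assumes "z \<bullet> (\<i> * v) = 0" "v \<noteq> 0"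
  shows "z = ((z \<bullet> v) / (v \<bullet> v)) *\<^sub>R v"
proof -
  have o: "Im z * Re v = Re z * Im v" using assms(1) by (simp add: inner_complex_def)
  have n: "v \<bullet> v \<noteq> 0" using assms(2) by simp
  have "(v \<bullet> v) *\<^sub>R z = (z \<bullet> v) *\<^sub>R v"
  proof (rule complex_eqI)
    have "Im v * (Im v * Re z) = Im v * (Im z * Re v)" using o by (simp add: mult_ac)
    then show "Re ((v \<bullet> v) *\<^sub>R z) = Re ((z \<bullet> v) *\<^sub>R v)"
      by (simp add: inner_complex_def algebra_simps)
    have "Re v * (Im z * Re v) = Re v * (Re z * Im v)" using o by (simp add: mult_ac)
    then show "Im ((v \<bullet> v) *\<^sub>R z) = Im ((z \<bullet> v) *\<^sub>R v)"
      by (simp add: inner_complex_def algebra_simps)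
  qed
  then have "(1 / (v \<bullet> v)) *\<^sub>R ((v \<bullet> v) *\<^sub>R z) = (1 / (v \<bullet> v)) *\<^sub>R ((z \<bullet> v) *\<^sub>R v)" by simp
  then show ?thesis using n by simp
qed

text \<open>
  A flow box at a regular point \<open>w\<close>. The section through \<open>w\<close> orthogonal to the flow meets the level of \<open>w\<close>
  only in \<open>w\<close>, because \<open>k\<close> is strictly monotone along it near \<open>w\<close>; and an orbit on this level that comes
  close to \<open>w\<close> crosses the section within short time, because the component of its velocity along
  the flow at \<open>w\<close> is bounded below. So it passes through \<open>w\<close> itself.
\<close>
lemma level_crossing:
  assumes x': "\<And>t. t \<ge> 0 \<Longrightarrow> (x has_vector_derivative \<i> * G (x t)) (at t within {0..})"
    and kx: "\<And>t. t \<ge> 0 \<Longrightarrow> k (x t) = e"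
    and w: "k w = e" and e: "e > k zm"
  obtains \<delta> where "\<delta> > 0" "\<And>t0. t0 \<ge> 1 \<Longrightarrow> norm (x t0 - w) < \<delta> \<Longrightarrow> \<exists>t. \<bar>t - t0\<bar> \<le> 1/2 \<and> x t = w"
proof -
  define v where "v = G w"
  have v: "v \<noteq> 0" unfolding v_def using G_nz w e by simp
  define V where "V = v \<bullet> v"
  have V: "V > 0" using v by (simp add: V_def)
  have "isCont (\<lambda>z. G z \<bullet> v) w"
    using G_cont[of UNIV] by (intro continuous_intros) (simp add: continuous_on_eq_continuous_at)
  then have "\<forall>\<^sub>F z in at w. G z \<bullet> v > V / 2"
    unfolding isCont_def by (rule order_tendstoD(1)) (use V in \<open>simp add: v_def[symmetric] V_def\<close>)
  then obtain \<rho> where \<rho>: "\<rho> > 0" and \<rho>0: "\<And>z. z \<noteq> w \<Longrightarrow> dist z w < \<rho> \<Longrightarrow> G z \<bullet> v > V / 2"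
    unfolding eventually_at by auto
  have Gv: "G z \<bullet> v > V / 2" if "norm (z - w) < \<rho>" for z
    using \<rho>0[of z] that V by (cases "z = w") (auto simp: dist_norm v_def[symmetric] V_def)
  have section_unique: "z = w" if z: "norm (z - w) < \<rho>" "k z = e" "(z - w) \<bullet> (\<i> * v) = 0" for z
  proof (rule ccontr)
    assume "z \<noteq> w"
    define s where "s = ((z - w) \<bullet> v) / (v \<bullet> v)"
    have zs: "z - w = s *\<^sub>R v" unfolding s_def by (rule plane_orthogonal[OF z(3) v])
    then have s: "s \<noteq> 0" using \<open>z \<noteq> w\<close> by auto
    have d: "((\<lambda>\<tau>. k (w + \<tau> *\<^sub>R (z - w))) has_vector_derivative G (w + \<tau> *\<^sub>R (z - w)) \<bullet> (z - w)) (at \<tau>)" for \<tau>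
      by (rule k_along_curve) (auto intro!: derivative_eq_intros)
    have "\<exists>\<tau>. 0 < \<tau> \<and> \<tau> < 1 \<and> k (w + 1 *\<^sub>R (z - w)) - k (w + 0 *\<^sub>R (z - w)) = (1 - 0) * (G (w + \<tau> *\<^sub>R (z - w)) \<bullet> (z - w))"
      by (rule MVT2) (use d in \<open>auto simp: has_real_derivative_iff_has_vector_derivative\<close>)
    then obtain \<tau> where \<tau>: "0 < \<tau>" "\<tau> < 1" "G (w + \<tau> *\<^sub>R (z - w)) \<bullet> (z - w) = 0"
      using z(2) w by auto
    have "norm (\<tau> *\<^sub>R (z - w)) < \<rho>" using \<tau> z(1)
      by (simp add: order_le_less_trans[OF mult_left_le_one_le])
    then have "G (w + \<tau> *\<^sub>R (z - w)) \<bullet> v > 0" using Gv[of "w + \<tau> *\<^sub>R (z - w)"] V by simp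
    then show False using \<tau>(3) s unfolding zs by simp
  qed
  obtain M0 where M0: "\<And>z. k z = e \<Longrightarrow> norm (G z) \<le> M0"
    using compact_imp_bounded[OF compact_continuous_image[OF G_cont compact_level[of e]]] unfolding bounded_iff by blast
  define M where "M = \<bar>M0\<bar> + 1"
  have M: "M > 0" "\<And>z. k z = e \<Longrightarrow> norm (\<i> * G z) \<le> M"
    using M0 by (force simp: M_def norm_mult)+
  \<comment> \<open>In time \<open>\<eta>\<close> the orbit moves by at most \<open>\<rho>/4\<close>, and starting within \<open>\<delta>\<close> of \<open>w\<close> it has crossed the section.\<close>
  define \<eta> where "\<eta> = min (1/2) (\<rho> / (4 * M))"
  have \<eta>: "\<eta> > 0" "\<eta> \<le> 1/2" "M * \<eta> \<le> \<rho> / 4"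
    using \<rho> M by (auto simp: \<eta>_def min_def field_simps)
  define \<delta> where "\<delta> = min (\<rho> / 2) (\<eta> * V / (4 * norm v))"
  have \<delta>: "\<delta> > 0" "\<delta> \<le> \<rho> / 2" "norm v * \<delta> \<le> \<eta> * V / 4"
    using \<rho> \<eta> V v by (auto simp: \<delta>_def min_def field_simps)
  show thesis
  proof (rule that[OF \<delta>(1)])
    fix t0 :: real assume t0: "t0 \<ge> 1" and near: "norm (x t0 - w) < \<delta>"
    have xat: "(x has_vector_derivative \<i> * G (x t)) (at t)" if "t > 0" for t
      using x'[of t] that at_within_interior[of t "{0..}"] by simp
    have close: "norm (x t - w) < \<rho>" if t: "\<bar>t - t0\<bar> \<le> \<eta>" for t
    proof -
      have "norm (x t - x t0) \<le> M * norm (t - t0)"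
      proof (rule differentiable_bound[of "{1/2..}"])
        fix s :: real assume s: "s \<in> {1/2..}"
        show "(x has_derivative (\<lambda>h. h *\<^sub>R (\<i> * G (x s)))) (at s within {1/2..})"
          using xat[of s] s by (auto simp: has_vector_derivative_def intro: has_derivative_at_withinI)
        show "onorm (\<lambda>h. h *\<^sub>R (\<i> * G (x s))) \<le> M"
          using M(2)[OF kx[of s]] s by (intro onorm_le) (simp add: mult.commute[of M] mult_left_mono)
      qed (use t t0 \<eta> in auto)
      also have "\<dots> \<le> M * \<eta>" using t M by simp
      finally have "norm (x t - x t0) \<le> \<rho> / 4" using \<eta> by simp
      then show ?thesis using near \<delta> norm_triangle_ineq[of "x t - x t0" "x t0 - w"] \<rho> by simp
    qed
    define l where "l t = (x t - w) \<bullet> (\<i> * v)" for t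
    have l': "(l has_real_derivative (G (x t) \<bullet> v)) (at t)" if "t > 0" for t
    proof -
      have "(\<i> * G (x t)) \<bullet> (\<i> * v) = G (x t) \<bullet> v" by (simp add: inner_complex_def)
      then show ?thesis
      unfolding has_real_derivative_iff_has_vector_derivative l_def
      using bounded_linear.has_vector_derivative[OF bounded_linear_inner_left has_vector_derivative_diff[OF xat[OF that] has_vector_derivative_const[of w]], of "\<i> * v"]
      by simp
    qed
    have l0: "\<bar>l t0\<bar> \<le> \<eta> * V / 4"
    proof -
      have "\<bar>l t0\<bar> \<le> norm (x t0 - w) * norm (\<i> * v)" unfolding l_def by (rule Cauchy_Schwarz_ineq2)
      also have "\<dots> \<le> \<delta> * norm v" using near by (simp add: norm_mult mult_right_mono)
      finally show ?thesis using \<delta>(3) by (simp add: mult.commute)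
    qed
    have "\<exists>s. t0 < s \<and> s < t0 + \<eta> \<and> l (t0 + \<eta>) - l t0 = (t0 + \<eta> - t0) * (G (x s) \<bullet> v)"
      by (rule MVT2) (use \<eta> t0 l' in auto)
    then obtain s where s: "t0 < s" "s < t0 + \<eta>" "l (t0 + \<eta>) - l t0 = \<eta> * (G (x s) \<bullet> v)" by auto
    have up: "l (t0 + \<eta>) \<ge> 0"
    proof -
      have "\<eta> * (G (x s) \<bullet> v) \<ge> \<eta> * (V / 2)" using Gv[OF close[of s]] s \<eta> by (intro mult_left_mono) auto
      moreover have "\<eta> * V > 0" using \<eta> V by simp
      ultimately show ?thesis using s(3) l0 by simp
    qed
    have "\<exists>s. t0 - \<eta> < s \<and> s < t0 \<and> l t0 - l (t0 - \<eta>) = (t0 - (t0 - \<eta>)) * (G (x s) \<bullet> v)"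
      by (rule MVT2) (use \<eta> t0 l' in auto)
    then obtain s' where s': "t0 - \<eta> < s'" "s' < t0" "l t0 - l (t0 - \<eta>) = \<eta> * (G (x s') \<bullet> v)" by auto
    have down: "l (t0 - \<eta>) \<le> 0"
    proof -
      have "\<eta> * (G (x s') \<bullet> v) \<ge> \<eta> * (V / 2)" using Gv[OF close[of s']] s' \<eta> by (intro mult_left_mono) auto
      moreover have "\<eta> * V > 0" using \<eta> V by simp
      ultimately show ?thesis using s'(3) l0 by simp
    qed
    obtain t where t: "t0 - \<eta> \<le> t" "t \<le> t0 + \<eta>" "l t = 0"
      using IVT[of l "t0 - \<eta>" 0 "t0 + \<eta>"] up down \<eta> t0 l'[THEN DERIV_isCont] by force
    have "x t = w"
      by (rule section_unique[OF close kx]) (use t t0 \<eta> in \<open>auto simp: l_def\<close>)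
    then show "\<exists>t. \<bar>t - t0\<bar> \<le> 1/2 \<and> x t = w" 
    proof (intro exI conjI)
      show "\<bar>t - t0\<bar> \<le> 1/2" using t \<eta> by linarith
    qed
  qed
qed

lemma shift_deriv:
  assumes "(x has_vector_derivative v) (at (c + t :: real))"
  shows "((\<lambda>s. x (c + s)) has_vector_derivative v) (at t)"
proof -
  have "((\<lambda>s. c + s) has_vector_derivative 1) (at t)"
    by (auto intro!: derivative_eq_intros)
  then show ?thesis
    using vector_diff_chain_at[of "\<lambda>s. c + s" 1 t x] assms by (simp add: o_def)
qed

text \<open>
  A forward orbit on a compact level accumulates at some \<open>w\<close>, and by \<open>level_crossing\<close> it passes through
  \<open>w\<close> at two different times. From then on it is periodic by uniqueness, and the periodic part
  extends to all times.
\<close>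
lemma recurrent_solution:
  assumes e: "e > k zm" and z0: "k z0 = e"
  obtains x P where "P > 0" "solution x" "\<And>t. k (x t) = e" "\<And>t. x (t + P) = x t"
proof -
  obtain x where x0: "x 0 = z0" and x': "\<And>t. t \<ge> 0 \<Longrightarrow> (x has_vector_derivative \<i> * G (x t)) (at t within {0..})"
    and kx: "\<And>t. t \<ge> 0 \<Longrightarrow> k (x t) = e"
    using forward_orbit[of z0] z0 by metis
  have "seq_compact {z. k z = e}" using compact_level compact_eq_seq_compact_metric by blast
  then obtain w r where w: "k w = e" and r: "strict_mono r" and lim: "((\<lambda>n. x (real n)) \<circ> r) \<longlonglongrightarrow> w"
    using kx unfolding seq_compact_def by (metis (mono_tags, lifting) mem_Collect_eq of_nat_0_le_iff)
  obtain \<delta> where \<delta>: "\<delta> > 0" "\<And>t0. t0 \<ge> 1 \<Longrightarrow> norm (x t0 - w) < \<delta> \<Longrightarrow> \<exists>t. \<bar>t - t0\<bar> \<le> 1/2 \<and> x t = w"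
    using level_crossing[OF x' kx w e] by metis
  from lim \<delta>(1) obtain N where N: "\<And>n. n \<ge> N \<Longrightarrow> norm (x (real (r n)) - w) < \<delta>"
    unfolding lim_sequentially dist_norm by auto
  have mono: "r n \<ge> n" for n using r by (rule seq_suble)
  have "r (Suc N) < r (Suc (Suc N))" "r (Suc (Suc N)) < r (Suc (Suc (Suc N)))"
    using r by (auto simp: strict_mono_def)
  then have big: "real (r (N + 3)) \<ge> real (r (N + 1)) + 2" by (simp add: numeral_3_eq_3)
  have ge1: "real (r (N + 1)) \<ge> 1" using mono[of "N + 1"] by linarith
  obtain t1 where t1: "\<bar>t1 - real (r (N + 1))\<bar> \<le> 1/2" "x t1 = w" using \<delta>(2)[OF ge1 N] by auto
  have "real (r (N + 3)) \<ge> 1" using ge1 big by linarith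
  then obtain t2 where t2: "\<bar>t2 - real (r (N + 3))\<bar> \<le> 1/2" "x t2 = w" using \<delta>(2)[OF _ N] by (metis le_add1)
  define P where "P = t2 - t1"
  have P: "P > 0" "t1 > 0" using t1(1) t2(1) big ge1 unfolding P_def by linarith+
  have shift': "((\<lambda>s. x (c + s)) has_vector_derivative \<i> * G (x (c + t))) (at t within {0..})" if "c \<ge> 0" "t \<ge> 0" for c t
  proof -
    have "(x has_vector_derivative \<i> * G (x (c + t))) (at (c + t) within (\<lambda>s. c + s) ` {0..})"
      by (rule has_vector_derivative_within_subset[OF x']) (use that in auto)
    moreover have "((\<lambda>s. c + s) has_vector_derivative 1) (at t within {0..})"
      by (auto intro!: derivative_eq_intros)
    ultimately show ?thesis
      using vector_diff_chain_within[of "\<lambda>s. c + s" 1 t "{0..}" x] by (simp add: o_def)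
  qed
  have per: "x (t1 + (t + P)) = x (t1 + t)" if "t \<ge> 0" for t
  proof -
    have "x (t2 + t) = x (t1 + t)"
      by (rule orbit_unique[of "\<lambda>s. x (t2 + s)" "\<lambda>s. x (t1 + s)" e])
        (use that P t1 t2 kx shift' in \<open>auto simp: P_def\<close>)
    then show ?thesis by (simp add: P_def algebra_simps)
  qed
  have pern: "x (t1 + (t + real n * P)) = x (t1 + t)" if "t \<ge> 0" for t n
  proof (induction n)
    case (Suc n)
    have "x (t1 + (t + real (Suc n) * P)) = x (t1 + ((t + real n * P) + P))" by (simp add: algebra_simps)
    also have "\<dots> = x (t1 + (t + real n * P))" by (rule per) (use that P in auto)
    finally show ?case using Suc by simp
  qed simp
  \<comment> \<open>Shift \<open>t\<close> by enough periods to reach the times at which the forward orbit is defined.\<close>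
  define X where "X t = x (t1 + (t + real (nat \<lceil>\<bar>t\<bar> / P\<rceil>) * P))" for t
  have X: "X t = x (t1 + (t + real n * P))" if "t + real n * P \<ge> 0" for t n
  proof -
    define m where "m = nat \<lceil>\<bar>t\<bar> / P\<rceil>"
    have "\<bar>t\<bar> / P \<le> real m" unfolding m_def by linarith
    then have m: "t + real m * P \<ge> 0" using P by (simp add: field_simps abs_if split: if_splits)
    have "x (t1 + (t + real m * P)) = x (t1 + ((t + real m * P) + real n * P))" using pern[OF m] by simp
    also have "\<dots> = x (t1 + ((t + real n * P) + real m * P))" by (simp add: algebra_simps)
    also have "\<dots> = x (t1 + (t + real n * P))" using pern[OF that] by simp
    finally show ?thesis by (simp add: X_def m_def)
  qed
  have ex_n: "\<exists>n. t + real n * P > 0" for t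
  proof -
    obtain n where "real n > - t / P" using reals_Archimedean2 by blast
    then show ?thesis using P by (intro exI[of _ n]) (simp add: field_simps)
  qed
  show thesis
  proof (rule that[of P X])
    show "solution X" unfolding solution_def
    proof
      fix t
      obtain n where n: "t + real n * P > 0" using ex_n by blast
      let ?c = "t1 + real n * P"
      have c: "?c + t > 0" using n P by simp
      have "((\<lambda>s. x (?c + s)) has_vector_derivative \<i> * G (x (?c + t))) (at t)"
        by (rule shift_deriv) (use x'[of "?c + t"] c at_within_interior[of "?c + t" "{0..}"] in simp)
      then show "(X has_vector_derivative \<i> * G (X t)) (at t)"
      proof (rule has_vector_derivative_transform_within_open[where S = "{- real n * P <..}", THEN has_vector_derivative_eq_rhs])
        show "x (?c + s) = X s" if "s \<in> {- real n * P <..}" for s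
          using X[of s n] that by (simp add: algebra_simps)
      qed (use n X[of t n] in \<open>auto simp: algebra_simps\<close>)
    qed
    show "k (X t) = e" for t
    proof -
      obtain n where n: "t + real n * P > 0" using ex_n by blast
      show ?thesis using X[of t n] n P kx by simp
    qed
    show "X (t + P) = X t" for t
    proof -
      obtain n where n: "t + real n * P > 0" using ex_n by blast
      then have "X (t + P) = x (t1 + ((t + real n * P) + P))" using X[of "t + P" n] P by (simp add: algebra_simps)
      also have "\<dots> = X t" using per[of "t + real n * P"] X[of t n] n by simp
      finally show ?thesis .
    qed
  qed (rule P)
qed


lemma solution_repeats:
  assumes x: "solution x" "\<And>t. k (x t) = e" and eq: "x a = x b" and u: "u \<ge> 0"
  shows "x (a + u) = x (b + u)"
proof -
  have d: "((\<lambda>s. x (c + s)) has_vector_derivative \<i> * G (x (c + t))) (at t within S)" for c t S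
    by (rule has_vector_derivative_at_within, rule shift_deriv) (use x(1) in \<open>simp add: solution_def\<close>)
  show ?thesis
    by (rule orbit_unique[of "\<lambda>s. x (a + s)" "\<lambda>s. x (b + s)" e]) (use assms in \<open>auto intro: d\<close>)
qed

lemma periodic_add_nat:
  fixes x :: "real \<Rightarrow> 'b"
  assumes "\<And>t. x (t + P) = x t"
  shows "x (t + real n * P) = x t"
proof (induction n)
  case (Suc n)
  have "x (t + real (Suc n) * P) = x ((t + real n * P) + P)" by (simp add: algebra_simps)
  then show ?case using assms Suc by simp
qed simp

text \<open>
  Uniqueness only propagates forward in time; periodicity carries it to negative times.
\<close>
lemma solution_repeats_all:
  assumes x: "solution x" "\<And>t. k (x t) = e" and eq: "x a = x b"
    and P: "P > 0" "\<And>t. x (t + P) = x t"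
  shows "x (a + u) = x (b + u)"
proof -
  obtain n where n: "real n > - u / P" using reals_Archimedean2 by blast
  then have "u + real n * P \<ge> 0" using P by (simp add: field_simps)
  from solution_repeats[OF x eq this] show ?thesis
    using periodic_add_nat[of x P, OF P(2)] by (metis add.assoc)
qed

text \<open>
  The velocity is nonzero, so the orbit does not return to its starting point at small positive times;
  the infimum of the return times is therefore positive, and it is the minimal period.
\<close>
theorem periodic_orbit_exists:
  assumes e: "e > k zm" and z0: "k z0 = e"
  obtains x T where "periodic_orbit e x T"
proof -
  obtain x P where P: "P > 0" "\<And>t. x (t + P) = x t" and x: "solution x" "\<And>t. k (x t) = e"
    using recurrent_solution[OF e z0] by metis
  have x0': "(x has_vector_derivative \<i> * G (x 0)) (at 0)" using x by (simp add: solution_def)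
  have nz: "\<i> * G (x 0) \<noteq> 0" using G_nz[of "x 0"] x(2) e by simp
  have "\<forall>\<^sub>F t in at 0. x t \<noteq> x 0"
  proof -
    have "((\<lambda>h. norm (x (0 + h) - x 0 - h *\<^sub>R (\<i> * G (x 0))) / norm h) \<longlongrightarrow> 0) (at 0)"
      using x0' unfolding has_vector_derivative_def has_derivative_at by blast
    then have "\<forall>\<^sub>F h in at 0. norm (x (0 + h) - x 0 - h *\<^sub>R (\<i> * G (x 0))) / norm h < norm (\<i> * G (x 0))"
      by (rule order_tendstoD) (use nz in simp)
    moreover have "\<forall>\<^sub>F h :: real in at 0. h \<noteq> 0" by (rule eventually_neq_at_within)
    ultimately show ?thesis by eventually_elim auto
  qed
  then obtain d where d: "d > 0" "\<And>t. t \<noteq> 0 \<Longrightarrow> \<bar>t\<bar> < d \<Longrightarrow> x t \<noteq> x 0"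
    unfolding eventually_at by (auto simp: dist_norm)
  have xc: "continuous_on S x" for S
    by (rule continuous_on_vector_derivative) (use x in \<open>auto simp: solution_def intro: has_vector_derivative_at_within\<close>)
  define A where "A = {t\<in>{d..}. x t = x 0}"
  have "closed A" unfolding A_def
    by (intro continuous_closed_preimage_constant xc closed_atLeast)
  moreover have PA: "P \<in> A"
    using d(2)[of P] P(1) P(2)[of 0] by (force simp: A_def not_le)
  moreover have bA: "bdd_below A" by (auto simp: A_def intro!: bdd_belowI[of _ d])
  ultimately have T: "Inf A \<in> A" using closed_contains_Inf by blast
  define T where "T = Inf A"
  have T0: "T > 0" "x T = x 0" using T d by (auto simp: T_def A_def)
  have minT: "x t \<noteq> x 0" if "0 < t" "t < T" for t
  proof
    assume "x t = x 0"
    then have "t \<in> A" using d(2)[of t] that by (force simp: A_def not_le)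
    then show False using cInf_lower[OF _ bA] that unfolding T_def by fastforce
  qed
  have "periodic_orbit e x T" unfolding periodic_orbit_def
  proof (intro conjI allI impI)
    show "x (t + T) = x t" for t
      using solution_repeats_all[OF x T0(2) P, of t] by (simp add: add.commute)
    fix s t :: real assume st: "0 \<le> s" "s < t" "t < T"
    show "x s \<noteq> x t"
    proof
      assume "x s = x t"
      from solution_repeats_all[OF x this P, of "- s"] show False
        using minT[of "t - s"] st by simp
    qed
  qed (use T0 x in auto)
  then show thesis by (rule that)
qed

definition orbit_loop :: "(real \<Rightarrow> complex) \<Rightarrow> real \<Rightarrow> real \<Rightarrow> complex" where
  "orbit_loop x T t = x (T * t)"

lemma orbit_loop:
  assumes "periodic_orbit e x T"
  shows "C1_loop (orbit_loop x T) (\<lambda>t. T *\<^sub>R (\<i> * G (x (T * t))))" "simple_path (orbit_loop x T)"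
    "\<And>t. orbit_loop x T (t + 1) = orbit_loop x T t"
    "path_image (orbit_loop x T) \<subseteq> {z. k z = e}"
proof -
  note o = assms[unfolded periodic_orbit_def]
  have xc: "continuous_on S x" for S
    by (rule continuous_on_vector_derivative) (use o in \<open>auto simp: solution_def intro: has_vector_derivative_at_within\<close>)
  show per: "orbit_loop x T (t + 1) = orbit_loop x T t" for t
  proof -
    have "T * (t + 1) = T * t + T" by (simp add: algebra_simps)
    then show ?thesis using o by (simp add: orbit_loop_def)
  qed
  show "path_image (orbit_loop x T) \<subseteq> {z. k z = e}"
    using o by (auto simp: path_image_def orbit_loop_def)
  show C: "C1_loop (orbit_loop x T) (\<lambda>t. T *\<^sub>R (\<i> * G (x (T * t))))"
  proof
    fix t
    have "((\<lambda>s. T * s) has_vector_derivative T) (at t)" by (auto intro!: derivative_eq_intros)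
    then show "(orbit_loop x T has_vector_derivative T *\<^sub>R (\<i> * G (x (T * t)))) (at t)"
      using vector_diff_chain_at[of "\<lambda>s. T * s" T t x] o
      by (simp add: o_def orbit_loop_def[abs_def] solution_def)
    show "continuous_on UNIV (\<lambda>t. T *\<^sub>R (\<i> * G (x (T * t))))"
      by (intro continuous_intros continuous_on_compose2[OF G_cont[of UNIV]] continuous_on_compose2[OF xc[of UNIV]]) auto
    show "orbit_loop x T 1 = orbit_loop x T 0" using per[of 0] by simp
  qed
  show "simple_path (orbit_loop x T)"
    unfolding simple_path_def loop_free_def
  proof (intro conjI ballI impI)
    show "path (orbit_loop x T)" using C1_loop.valid[OF C] valid_path_imp_path by blast
    fix s t :: real assume st: "s \<in> {0..1}" "t \<in> {0..1}" and eq: "orbit_loop x T s = orbit_loop x T t"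
    have *: "s = 0 \<and> t = 1" if "s \<in> {0..1}" "t \<in> {0..1}" "orbit_loop x T s = orbit_loop x T t" "s < t" for s t :: real
    proof -
      have Ts: "0 \<le> T * s" "T * s < T * t" using that o by auto
      then have "T * t \<ge> T" using that(3) o unfolding orbit_loop_def by (meson not_le)
      then have t: "t = 1" using that(2) o by auto
      have "s = 0"
      proof (rule ccontr)
        assume "s \<noteq> 0"
        then have "0 < T * s" "T * s < T" using that t o by auto
        moreover have "x (T * s) = x 0" using that(3) t o unfolding orbit_loop_def by (metis add.left_neutral mult.right_neutral)
        ultimately show False using o by (metis order_refl)
      qed
      then show ?thesis using t by simp
    qed
    show "s = t \<or> s = 0 \<and> t = 1 \<or> s = 1 \<and> t = 0"
      using *[OF st eq] *[OF st(2,1) eq[symmetric]] by linarith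
  qed
qed

end

section \<open>Levels as Jordan curves and their perturbations\<close>

text \<open>
  On a compact interval the derivative is uniformly continuous and bounded away from zero, so a short
  chord is close to the parameter difference times the derivative at one end.
\<close>
lemma local_expansion:
  fixes \<gamma> D :: "real \<Rightarrow> 'a::euclidean_space"
  assumes d: "\<And>t. (\<gamma> has_vector_derivative D t) (at t)" and cD: "continuous_on UNIV D" and nz: "\<And>t. D t \<noteq> 0"
  obtains \<eta> c :: real where "\<eta> > 0" "c > 0"
    "\<And>s t. s \<in> {a..b} \<Longrightarrow> t \<in> {a..b} \<Longrightarrow> \<bar>s - t\<bar> \<le> \<eta> \<Longrightarrow> c * \<bar>s - t\<bar> \<le> norm (\<gamma> s - \<gamma> t)"
proof (cases "a \<le> b")
  case False
  then show ?thesis using that[of 1 1] by simp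
next
  case True
  have cn: "continuous_on {a..b} (\<lambda>t. norm (D t))"
    by (intro continuous_on_norm continuous_on_subset[OF cD]) auto
  obtain t0 where min: "\<And>t. t \<in> {a..b} \<Longrightarrow> norm (D t0) \<le> norm (D t)"
    using continuous_attains_inf[OF compact_Icc _ cn] True by (metis atLeastatMost_empty_iff2 not_le)
  define m where "m = norm (D t0)"
  have m: "m > 0" using nz by (simp add: m_def)
  have "uniformly_continuous_on {a..b} D"
    by (intro compact_uniformly_continuous continuous_on_subset[OF cD]) auto
  then obtain \<eta> where \<eta>: "\<eta> > 0" and uc: "\<And>s t. s \<in> {a..b} \<Longrightarrow> t \<in> {a..b} \<Longrightarrow> dist s t < \<eta> \<Longrightarrow> dist (D s) (D t) < m / 2"
    unfolding uniformly_continuous_on_def using m by (metis half_gt_zero)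
  show ?thesis
  proof (rule that[of "\<eta> / 2" "m / 2"])
    fix s t assume st: "s \<in> {a..b}" "t \<in> {a..b}" "\<bar>s - t\<bar> \<le> \<eta> / 2"
    define g where "g u = \<gamma> u - u *\<^sub>R D t" for u
    have "norm (g s - g t) \<le> (m / 2) * norm (s - t)"
    proof (rule differentiable_bound[of "closed_segment s t"])
      fix u assume u: "u \<in> closed_segment s t"
      show "(g has_derivative (\<lambda>h. h *\<^sub>R (D u - D t))) (at u within closed_segment s t)"
      proof -
        have "((\<lambda>u. u *\<^sub>R D t) has_vector_derivative D t) (at u within closed_segment s t)"
          unfolding has_vector_derivative_def
          by (rule has_derivative_scaleR_left[OF has_derivative_ident])
        from has_vector_derivative_diff[OF has_vector_derivative_at_within[OF d] this]
        show ?thesis unfolding g_def has_vector_derivative_def .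
      qed
      have "u \<in> {a..b}" using u st by (auto simp: closed_segment_eq_real_ivl split: if_splits)
      moreover have "dist u t < \<eta>" using u st \<eta> by (auto simp: closed_segment_eq_real_ivl dist_real_def split: if_splits)
      ultimately have "norm (D u - D t) \<le> m / 2" using uc st by (force simp: dist_norm)
      from mult_left_mono[OF this, of "\<bar>h\<bar>" for h]
      show "onorm (\<lambda>h. h *\<^sub>R (D u - D t)) \<le> m / 2"
        by (intro onorm_le) (simp add: mult_ac)
    qed auto
    moreover have "norm ((s - t) *\<^sub>R D t) \<le> norm (\<gamma> s - \<gamma> t) + norm (g s - g t)"
    proof -
      have "(s - t) *\<^sub>R D t = (\<gamma> s - \<gamma> t) - (g s - g t)" by (simp add: g_def algebra_simps)
      then show ?thesis by (metis norm_triangle_ineq4)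
    qed
    moreover have "m * \<bar>s - t\<bar> \<le> norm ((s - t) *\<^sub>R D t)"
      using mult_right_mono[OF min[OF st(2)], of "\<bar>s - t\<bar>"] by (simp add: m_def mult.commute)
    ultimately show "m / 2 * \<bar>s - t\<bar> \<le> norm (\<gamma> s - \<gamma> t)" by simp
  qed (use \<eta> m in auto)
qed

text \<open>
  For parameters that are close, also across the end points, \<open>\<gamma>\<close> separates them linearly, faster than
  \<open>r N\<close> can compensate. For the remaining pairs the distance of the points of \<open>\<gamma>\<close> is bounded below by compactness.
\<close>
lemma perturbed_loop_simple:
  fixes \<gamma> D N N' :: "real \<Rightarrow> complex"
  assumes d: "\<And>t. (\<gamma> has_vector_derivative D t) (at t)" and cD: "continuous_on UNIV D" and nz: "\<And>t. D t \<noteq> 0"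
    and dN: "\<And>t. (N has_vector_derivative N' t) (at t)" and cN': "continuous_on UNIV N'"
    and per: "\<And>t. \<gamma> (t + 1) = \<gamma> t" "\<And>t. N (t + 1) = N t"
    and simple: "simple_path \<gamma>"
  obtains r0 :: real where "r0 > 0" "\<And>r. \<bar>r\<bar> \<le> r0 \<Longrightarrow> simple_path (\<lambda>t. \<gamma> t + r *\<^sub>R N t)"
proof -
  have c\<gamma>: "continuous_on S \<gamma>" for S
    by (rule continuous_on_vector_derivative) (rule has_vector_derivative_at_within[OF d])
  have cN: "continuous_on S N" for S
    by (rule continuous_on_vector_derivative) (rule has_vector_derivative_at_within[OF dN])
  obtain \<eta> c :: real where \<eta>: "\<eta> > 0" and c: "c > 0" and loc:
    "\<And>s t. s \<in> {0..2} \<Longrightarrow> t \<in> {0..2} \<Longrightarrow> \<bar>s - t\<bar> \<le> \<eta> \<Longrightarrow> c * \<bar>s - t\<bar> \<le> norm (\<gamma> s - \<gamma> t)"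
    using local_expansion[OF d cD nz] by metis
  obtain K where K: "\<And>t. t \<in> {0..2} \<Longrightarrow> norm (N' t) \<le> K"
    using compact_imp_bounded[OF compact_continuous_image[OF continuous_on_subset[OF cN'] compact_Icc]]
    unfolding bounded_iff by blast
  have Nlip: "norm (N s - N t) \<le> \<bar>K\<bar> * \<bar>s - t\<bar>" if "s \<in> {0..2}" "t \<in> {0..2}" for s t
  proof -
    have "norm (N s - N t) \<le> \<bar>K\<bar> * norm (s - t)"
    proof (rule differentiable_bound[of "{0..2}"])
      fix u :: real assume u: "u \<in> {0..2}"
      show "(N has_derivative (\<lambda>h. h *\<^sub>R N' u)) (at u within {0..2})"
        using dN[of u] unfolding has_vector_derivative_def by (rule has_derivative_at_withinI)
      show "onorm (\<lambda>h. h *\<^sub>R N' u) \<le> \<bar>K\<bar>"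
        using K[OF u] by (intro onorm_le) (simp add: mult.commute[of "\<bar>K\<bar>"] mult_left_mono)
    qed (use that in auto)
    then show ?thesis by simp
  qed
  obtain B where B: "\<And>t. t \<in> {0..1} \<Longrightarrow> norm (N t) \<le> B"
    using compact_imp_bounded[OF compact_continuous_image[OF cN compact_Icc]]
    unfolding bounded_iff by blast
  define Q where "Q = {p \<in> {0..1} \<times> {0..1::real}. \<eta> \<le> \<bar>fst p - snd p\<bar> \<and> \<bar>fst p - snd p\<bar> \<le> 1 - \<eta>}"
  have inj: "s = t \<or> \<bar>s - t\<bar> = 1" if "s \<in> {0..1}" "t \<in> {0..1}" "\<gamma> s = \<gamma> t" for s t
    using simple that unfolding simple_path_def loop_free_def by fastforce
  obtain \<mu> :: real where \<mu>: "\<mu> > 0" "\<And>s t. (s, t) \<in> Q \<Longrightarrow> \<mu> \<le> norm (\<gamma> s - \<gamma> t)"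
  proof (cases "Q = {}")
    case True
    then show ?thesis using that[of 1] by simp
  next
    case False
    have "compact Q"
    proof -
      have "closed {p::real\<times>real. \<eta> \<le> \<bar>fst p - snd p\<bar> \<and> \<bar>fst p - snd p\<bar> \<le> 1 - \<eta>}"
        by (intro closed_Collect_conj closed_Collect_le continuous_intros)
      moreover have "Q = ({0..1} \<times> {0..1}) \<inter> {p. \<eta> \<le> \<bar>fst p - snd p\<bar> \<and> \<bar>fst p - snd p\<bar> \<le> 1 - \<eta>}"
        by (auto simp: Q_def)
      ultimately show ?thesis using compact_Int_closed[OF compact_Times[OF compact_Icc compact_Icc]] by simp
    qed
    moreover have "continuous_on Q (\<lambda>p. norm (\<gamma> (fst p) - \<gamma> (snd p)))"
      by (intro continuous_intros continuous_on_compose2[OF c\<gamma>[of UNIV]]) auto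
    ultimately obtain p where p: "p \<in> Q" "\<And>q. q \<in> Q \<Longrightarrow> norm (\<gamma> (fst p) - \<gamma> (snd p)) \<le> norm (\<gamma> (fst q) - \<gamma> (snd q))"
      using continuous_attains_inf[OF _ False] by blast
    have "\<gamma> (fst p) \<noteq> \<gamma> (snd p)"
      using inj[of "fst p" "snd p"] p(1) \<eta> by (auto simp: Q_def)
    then show ?thesis using p(2) by (intro that[of "norm (\<gamma> (fst p) - \<gamma> (snd p))"]) auto
  qed
  define r0 where "r0 = min (c / (2 * (\<bar>K\<bar> + 1))) (\<mu> / (4 * (\<bar>B\<bar> + 1)))"
  have r0: "r0 > 0" using c \<mu> by (simp add: r0_def)
  show thesis
  proof (rule that[OF r0])
    fix r :: real assume r: "\<bar>r\<bar> \<le> r0"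
    let ?g = "\<lambda>t. \<gamma> t + r *\<^sub>R N t"
    have rK: "\<bar>r\<bar> * \<bar>K\<bar> < c"
    proof -
      have "\<bar>r\<bar> * \<bar>K\<bar> \<le> c / (2 * (\<bar>K\<bar> + 1)) * (\<bar>K\<bar> + 1)"
        using r c by (intro mult_mono) (auto simp: r0_def)
      also have "\<dots> = c / 2" by (simp add: field_simps)
      finally show ?thesis using c by simp
    qed
    have rB: "\<bar>r\<bar> * (2 * \<bar>B\<bar>) < \<mu>"
    proof -
      have "\<bar>r\<bar> * (2 * \<bar>B\<bar>) \<le> \<mu> / (4 * (\<bar>B\<bar> + 1)) * (2 * (\<bar>B\<bar> + 1))"
        using r \<mu> by (intro mult_mono) (auto simp: r0_def)
      also have "\<dots> = \<mu> / 2" by (simp add: field_simps)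
      finally show ?thesis using \<mu> by simp
    qed
    have diff: "norm (\<gamma> s - \<gamma> t) = \<bar>r\<bar> * norm (N s - N t)" if "?g s = ?g t" for s t
    proof -
      have "\<gamma> s - \<gamma> t = - (r *\<^sub>R (N s - N t))" using that by (simp add: algebra_simps)
      then show ?thesis by simp
    qed
    have near: "s = t" if st: "s \<in> {0..2}" "t \<in> {0..2}" "\<bar>s - t\<bar> \<le> \<eta>" "?g s = ?g t" for s t
    proof (rule ccontr)
      assume "s \<noteq> t"
      have "c * \<bar>s - t\<bar> \<le> \<bar>r\<bar> * norm (N s - N t)" using loc[OF st(1-3)] diff[OF st(4)] by simp
      also have "\<dots> \<le> \<bar>r\<bar> * (\<bar>K\<bar> * \<bar>s - t\<bar>)" using Nlip[OF st(1,2)] by (intro mult_left_mono) auto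
      also have "\<dots> = (\<bar>r\<bar> * \<bar>K\<bar>) * \<bar>s - t\<bar>" by simp
      also have "\<dots> < c * \<bar>s - t\<bar>" using rK \<open>s \<noteq> t\<close> by (intro mult_strict_right_mono) auto
      finally show False by simp
    qed
    have main: "s = t \<or> s = 0 \<and> t = 1" if st: "s \<in> {0..1}" "t \<in> {0..1}" "s \<le> t" "?g s = ?g t" for s t
    proof -
      consider "t - s \<le> \<eta>" | "1 - \<eta> \<le> t - s" | "\<eta> \<le> t - s" "t - s \<le> 1 - \<eta>" by linarith
      then show ?thesis
      proof cases
        case 1
        then show ?thesis using near[of s t] st by auto
      next
        case 2
        \<comment> \<open>The end points of the unit interval are neighbours on the loop.\<close>
        have "?g (s + 1) = ?g t" using st per by simp
        then have "s + 1 = t" using near[of "s + 1" t] 2 st by auto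
        then show ?thesis using st by auto
      next
        case 3
        then have "(s, t) \<in> Q" using st by (auto simp: Q_def)
        then have "\<mu> \<le> norm (\<gamma> s - \<gamma> t)" by (rule \<mu>(2))
        also have "\<dots> = \<bar>r\<bar> * norm (N s - N t)" by (rule diff[OF st(4)])
        also have "\<dots> \<le> \<bar>r\<bar> * (2 * \<bar>B\<bar>)"
          using norm_triangle_ineq4[of "N s" "N t"] B[OF st(1)] B[OF st(2)]
          by (intro mult_left_mono) auto
        finally show ?thesis using rB by simp
      qed
    qed
    show "simple_path ?g"
      unfolding simple_path_def loop_free_def
    proof (intro conjI ballI impI)
      show "path ?g" unfolding path_def by (intro continuous_intros c\<gamma> cN)
      fix s t :: real assume st: "s \<in> {0..1}" "t \<in> {0..1}" and eq: "?g s = ?g t"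
      show "s = t \<or> s = 0 \<and> t = 1 \<or> s = 1 \<and> t = 0"
        using main[OF st _ eq] main[OF st(2,1) _ eq[symmetric]] by linarith
    qed
  qed
qed

context planar_hamiltonian
begin

lemma maximum_principle:
  assumes "open S" "bounded S" "frontier S \<subseteq> {z. k z \<le> c}" "z \<in> S"
  shows "k z \<le> c"
proof (rule ccontr)
  assume "\<not> k z \<le> c"
  have "compact (closure S)" using assms by simp
  then obtain y where y: "y \<in> closure S" "\<And>w. w \<in> closure S \<Longrightarrow> k w \<le> k y"
    using continuous_attains_sup[OF _ _ k_cont, of "closure S"] assms(4) by (metis closure_eq_empty empty_iff)
  have "k y > c" using y(2)[of z] assms(4) \<open>\<not> k z \<le> c\<close> closure_subset by force
  then have "y \<in> S" using y(1) assms(1,3) by (auto simp: frontier_def interior_open)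
  then have "y = zm" using grad_zero_at_extremum[OF assms(1)] y(2) closure_subset by blast
  have "S \<noteq> UNIV" using assms(2) by auto
  then obtain f where "f \<in> frontier S" using frontier_eq_empty[of S] assms(4) by blast
  then show False using assms(3) min[of f] \<open>k y > c\<close> \<open>y = zm\<close> by force
qed

text \<open>
  The upper inclusion is the maximum principle. For the lower one, a point below level \<open>a\<close> in the
  outside would give an absolute minimum over the outside, since \<open>k\<close> is proper; this would be
  a second critical point besides the one inside.
\<close>
lemma loop_encloses_sublevel:
  assumes simple: "simple_path \<gamma>" and loop: "pathfinish \<gamma> = pathstart \<gamma>"
    and img: "path_image \<gamma> \<subseteq> {z. a \<le> k z \<and> k z \<le> b}" and zm: "zm \<in> inside (path_image \<gamma>)"
  shows "{z. k z < a} \<subseteq> inside (path_image \<gamma>)" "inside (path_image \<gamma>) \<subseteq> {z. k z \<le> b}"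
proof -
  let ?I = "inside (path_image \<gamma>)" and ?O = "outside (path_image \<gamma>)"
  note J = Jordan_inside_outside[OF simple loop]
  show "?I \<subseteq> {z. k z \<le> b}"
    using maximum_principle[of ?I b] J img by auto
  show "{z. k z < a} \<subseteq> ?I"
  proof (rule ccontr)
    assume "\<not> {z. k z < a} \<subseteq> ?I"
    then obtain z where z: "k z < a" "z \<notin> ?I" by auto
    then have "z \<notin> path_image \<gamma>" using img by force
    then have zO: "z \<in> ?O" using J z(2) by blast
    have "compact ({w. k w \<le> k z} \<inter> closure ?O)" by (intro compact_Int_closed compact_sublevel closed_closure)
    moreover have "{w. k w \<le> k z} \<inter> closure ?O \<noteq> {}" using zO closure_subset[of ?O] by blast
    ultimately obtain y where "y \<in> {w. k w \<le> k z} \<inter> closure ?O" "\<forall>w\<in>{w. k w \<le> k z} \<inter> closure ?O. k y \<le> k w"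
      using continuous_attains_inf[OF _ _ k_cont] by metis
    then have y: "y \<in> closure ?O" "k y \<le> k z" "\<And>w. w \<in> closure ?O \<Longrightarrow> k w \<le> k z \<Longrightarrow> k y \<le> k w"
      by auto
    have "y \<notin> frontier ?O" using J y(2) z(1) img by force
    then have "y \<in> ?O" using y(1) J by (auto simp: frontier_def interior_open)
    moreover have "\<forall>w\<in>?O. k y \<le> k w" using y(2,3) closure_subset by (meson in_mono le_cases order.trans)
    ultimately have "y = zm" using grad_zero_at_extremum[of ?O y] J by blast
    then show False using zm \<open>y \<in> ?O\<close> J by blast
  qed
qed

text \<open>
  The minimum over the closed inside is attained inside, where it has to be \<open>zm\<close>, or on the curve; in
  the latter case \<open>k\<close> is constant inside, so that every inside point is critical.
\<close>
lemma level_loop_encloses_minimum: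
  assumes simple: "simple_path \<gamma>" and loop: "pathfinish \<gamma> = pathstart \<gamma>"
    and img: "path_image \<gamma> \<subseteq> {z. k z = e}"
  shows "zm \<in> inside (path_image \<gamma>)"
proof -
  let ?I = "inside (path_image \<gamma>)"
  note J = Jordan_inside_outside[OF simple loop]
  have le: "k z \<le> e" if "z \<in> ?I" for z
    using maximum_principle[of ?I e z] J img that by auto
  have "compact (closure ?I)" using J by simp
  then obtain y where y: "y \<in> closure ?I" "\<And>w. w \<in> closure ?I \<Longrightarrow> k y \<le> k w"
    using continuous_attains_inf[OF _ _ k_cont, of "closure ?I"] J by (metis closure_eq_empty)
  show ?thesis
  proof (cases "y \<in> ?I")
    case True
    then have "y = zm" using grad_zero_at_extremum[of ?I y] J y(2) closure_subset by blast
    then show ?thesis using True by simp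
  next
    case False
    then have "y \<in> frontier ?I" using y(1) J by (auto simp: frontier_def interior_open)
    then have ye: "k y = e" using J img by auto
    obtain u where u: "u \<in> ?I" using J by blast
    have "\<forall>w\<in>?I. k w \<le> k u"
      using le y(2) ye u closure_subset by (metis in_mono order_trans)
    then have "u = zm" using grad_zero_at_extremum[of ?I u] J u by blast
    then show ?thesis using u by simp
  qed
qed

text \<open>
  Consequently levels above the minimum are connected: another point of the level would be an extremum over the
  inside or over the outside.
\<close>
lemma level_eq_loop:
  assumes simple: "simple_path \<gamma>" and loop: "pathfinish \<gamma> = pathstart \<gamma>"
    and img: "path_image \<gamma> \<subseteq> {z. k z = e}" and e: "e > k zm"
  shows "path_image \<gamma> = {z. k z = e}"
proof (rule antisym[OF img], rule subsetI)
  fix z assume "z \<in> {z. k z = e}"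
  then have z: "k z = e" by simp
  note J = Jordan_inside_outside[OF simple loop]
  have "path_image \<gamma> \<subseteq> {z. e \<le> k z \<and> k z \<le> e}" using img by auto
  note S = loop_encloses_sublevel[OF simple loop this level_loop_encloses_minimum[OF simple loop img]]
  show "z \<in> path_image \<gamma>"
  proof (rule ccontr)
    assume "z \<notin> path_image \<gamma>"
    then consider "z \<in> inside (path_image \<gamma>)" | "z \<in> outside (path_image \<gamma>)" using J by blast
    then have "z = zm"
    proof cases
      case 1
      moreover have "\<forall>w\<in>inside (path_image \<gamma>). k w \<le> k z" using S(2) z by auto
      ultimately show ?thesis using grad_zero_at_extremum[of "inside (path_image \<gamma>)" z] J by blast
    next
      case 2
      moreover have "\<forall>w\<in>outside (path_image \<gamma>). k z \<le> k w"
      proof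
        fix w assume "w \<in> outside (path_image \<gamma>)"
        then have "w \<notin> inside (path_image \<gamma>)" using J by blast
        then have "\<not> k w < e" using S(1) by blast
        then show "k z \<le> k w" using z by simp
      qed
      ultimately show ?thesis using grad_zero_at_extremum[of "outside (path_image \<gamma>)" z] J by blast
    qed
    then show False using z e by simp
  qed
qed

end

section \<open>Action and period as enclosed area and its derivative\<close>

text \<open>
  To compare \<open>f (e + d)\<close> with the polynomial one takes \<open>r = d \<plusminus> 2 C d\<^sup>2\<close>; for small \<open>d\<close> the correction beats
  the error \<open>C r\<^sup>2\<close>. The sign is forced by monotonicity: with \<open>\<sigma> = -1\<close> the middle term
  would decrease in \<open>r\<close> near zero.
\<close>
lemma squeeze_quadratic_derivative:
  fixes f :: "real \<Rightarrow> real"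
  assumes mono: "mono f" and T: "T > 0" and C: "C > 0" and r0: "r0 > 0" and \<sigma>: "\<sigma> = 1 \<or> \<sigma> = -1"
    and sq: "\<And>r. r \<noteq> 0 \<Longrightarrow> \<bar>r\<bar> \<le> r0 \<Longrightarrow>
       f (e + r - C * r\<^sup>2) \<le> \<sigma> * (A + r * T + B * r\<^sup>2) \<and> \<sigma> * (A + r * T + B * r\<^sup>2) \<le> f (e + r + C * r\<^sup>2)"
  shows "\<sigma> = 1" "f e = A" "(f has_real_derivative T) (at e)"
proof -
  show \<sigma>1: "\<sigma> = 1"
  proof -
    define r where "r = min r0 (1 / C)"
    have r: "r > 0" "r \<le> r0" "C * r \<le> 1" using r0 C by (auto simp: r_def min_def field_simps)
    have "C * r\<^sup>2 \<le> r" using mult_right_mono[OF r(3), of r] r by (simp add: power2_eq_square)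
    then have "f (e + - r + C * (- r)\<^sup>2) \<le> f (e + r - C * r\<^sup>2)" by (intro monoD[OF mono]) simp
    then have "\<sigma> * (A + - r * T + B * (- r)\<^sup>2) \<le> \<sigma> * (A + r * T + B * r\<^sup>2)"
      using sq[of r] sq[of "- r"] r by fastforce
    then have "\<sigma> * (r * T) \<ge> 0" by (simp add: algebra_simps)
    moreover have "r * T > 0" using r T by simp
    ultimately show ?thesis using \<sigma> by auto
  qed
  define Q where "Q = 2 * C * T + 2 * \<bar>B\<bar>"
  have Q: "Q \<ge> 0" using C T by (simp add: Q_def)
  define d0 where "d0 = min (r0 / 2) (1 / (8 * C))"
  have d0: "d0 > 0" using r0 C by (simp add: d0_def)
  have bound: "f (e + d) \<le> A + T * d + Q * d\<^sup>2" "A + T * d - Q * d\<^sup>2 \<le> f (e + d)" if d: "d \<noteq> 0" "\<bar>d\<bar> \<le> d0" for d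
  proof -
    have dd: "\<bar>d\<bar> \<le> r0 / 2" "\<bar>d\<bar> * C \<le> 1/8" 
    proof -
      have "\<bar>d\<bar> \<le> r0 / 2" "\<bar>d\<bar> \<le> 1 / (8 * C)" using d by (simp_all add: d0_def)
      then show "\<bar>d\<bar> \<le> r0 / 2" "\<bar>d\<bar> * C \<le> 1/8" using C by (simp_all add: pos_le_divide_eq)
    qed
    have key: "r \<noteq> 0" "\<bar>r\<bar> \<le> r0" "r\<^sup>2 \<le> 2 * d\<^sup>2" if r: "r = d + s * (2 * C * d\<^sup>2)" and s: "s = 1 \<or> s = -1" for r s
    proof -
      have r': "r = d * (1 + s * (2 * C * d))" using r by (simp add: power2_eq_square algebra_simps)
      have "\<bar>s * (2 * C * d)\<bar> \<le> 1/4" using dd(2) C s by (auto simp: abs_mult mult_ac)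
      then have b: "3/4 \<le> 1 + s * (2 * C * d)" "1 + s * (2 * C * d) \<le> 5/4" by linarith+
      show "r \<noteq> 0" using r' d(1) b by auto
      have "\<bar>r\<bar> \<le> \<bar>d\<bar> * (5/4)" unfolding r' abs_mult using b by (intro mult_left_mono) auto
      then show "\<bar>r\<bar> \<le> r0" using dd(1) r0 by linarith
      have "(1 + s * (2 * C * d))\<^sup>2 \<le> (5/4)\<^sup>2" using b by (intro power_mono) auto
      then have "(1 + s * (2 * C * d))\<^sup>2 \<le> 2" by (simp add: power2_eq_square)
      then show "r\<^sup>2 \<le> 2 * d\<^sup>2" unfolding r' power_mult_distrib
        using mult_left_mono[of "(1 + s * (2 * C * d))\<^sup>2" 2 "d\<^sup>2"] by simp
    qed
    have Br: "\<bar>B * r\<^sup>2\<bar> \<le> 2 * \<bar>B\<bar> * d\<^sup>2" if "r\<^sup>2 \<le> 2 * d\<^sup>2" for r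
      using mult_left_mono[OF that, of "\<bar>B\<bar>"] by (simp add: abs_mult)
    show "f (e + d) \<le> A + T * d + Q * d\<^sup>2"
    proof -
      define r where "r = d + 1 * (2 * C * d\<^sup>2)"
      note kr = key[OF r_def]
      have "C * r\<^sup>2 \<le> 2 * C * d\<^sup>2" using mult_left_mono[OF kr(3), of C] C by simp
      then have "f (e + d) \<le> f (e + r - C * r\<^sup>2)" by (intro monoD[OF mono]) (simp add: r_def)
      also have "\<dots> \<le> A + r * T + B * r\<^sup>2" using sq[of r] kr \<sigma>1 by simp
      also have "\<dots> \<le> A + r * T + 2 * \<bar>B\<bar> * d\<^sup>2" using Br[OF kr(3)] by simp
      also have "\<dots> = A + T * d + Q * d\<^sup>2" by (simp add: r_def Q_def algebra_simps)
      finally show ?thesis .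
    qed
    show "A + T * d - Q * d\<^sup>2 \<le> f (e + d)"
    proof -
      define r where "r = d + (-1) * (2 * C * d\<^sup>2)"
      note kr = key[OF r_def]
      have "A + T * d - Q * d\<^sup>2 = A + r * T - 2 * \<bar>B\<bar> * d\<^sup>2" by (simp add: r_def Q_def algebra_simps)
      also have "\<dots> \<le> A + r * T + B * r\<^sup>2" using Br[OF kr(3)] by simp
      also have "\<dots> \<le> f (e + r + C * r\<^sup>2)" using sq[of r] kr \<sigma>1 by simp
      also have "\<dots> \<le> f (e + d)"
      proof (intro monoD[OF mono])
        have "C * r\<^sup>2 \<le> 2 * C * d\<^sup>2" using mult_left_mono[OF kr(3), of C] C by simp
        then show "e + r + C * r\<^sup>2 \<le> e + d" by (simp add: r_def)
      qed
      finally show ?thesis .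
    qed
  qed
  have lim: "((\<lambda>d. A + T * d + Q * d\<^sup>2) \<longlongrightarrow> A) (at_right 0)" "((\<lambda>d. A + T * (- d) - Q * (- d)\<^sup>2) \<longlongrightarrow> A) (at_right 0)"
    by (auto intro!: tendsto_eq_intros)
  have ev: "\<forall>\<^sub>F d in at_right 0. d \<noteq> 0 \<and> \<bar>d\<bar> \<le> d0 \<and> 0 < (d::real)"
    unfolding eventually_at_right_field using d0 by (intro exI[of _ d0]) auto
  have "f e \<le> A"
  proof (rule tendsto_lowerbound[OF lim(1)])
    show "\<forall>\<^sub>F d in at_right 0. f e \<le> A + T * d + Q * d\<^sup>2"
      using ev
    proof eventually_elim
      case (elim d)
      have "f e \<le> f (e + d)" using elim by (intro monoD[OF mono]) simp
      then show ?case using bound(1)[of d] elim by linarith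
    qed
  qed simp
  moreover have "f e \<ge> A"
  proof (rule tendsto_upperbound[OF lim(2)])
    show "\<forall>\<^sub>F d in at_right 0. A + T * (- d) - Q * (- d)\<^sup>2 \<le> f e"
      using ev
    proof eventually_elim
      case (elim d)
      have "f (e + - d) \<le> f e" using elim by (intro monoD[OF mono]) simp
      moreover have "- d \<noteq> 0" "\<bar>- d\<bar> \<le> d0" using elim by auto
      ultimately show ?case using bound(2)[of "- d"] by linarith
    qed
  qed simp
  ultimately show fe: "f e = A" by simp
  show "(f has_real_derivative T) (at e)"
    unfolding DERIV_def
  proof (rule LIM_I)
    fix \<epsilon> :: real assume \<epsilon>: "\<epsilon> > 0"
    show "\<exists>s>0. \<forall>h. h \<noteq> 0 \<and> norm (h - 0) < s \<longrightarrow> norm ((f (e + h) - f e) / h - T) < \<epsilon>"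
    proof (intro exI[of _ "min d0 (\<epsilon> / (Q + 1))"] conjI allI impI)
      show "min d0 (\<epsilon> / (Q + 1)) > 0" using d0 \<epsilon> Q by simp
      fix h :: real assume h: "h \<noteq> 0 \<and> norm (h - 0) < min d0 (\<epsilon> / (Q + 1))"
      then have "h \<noteq> 0" "\<bar>h\<bar> \<le> d0" by auto
      from bound[OF this] have "\<bar>f (e + h) - f e - T * h\<bar> \<le> Q * h\<^sup>2" unfolding fe by linarith
      then have "\<bar>f (e + h) - f e - T * h\<bar> / \<bar>h\<bar> \<le> Q * \<bar>h\<bar>"
        using h by (simp add: divide_le_eq power2_eq_square abs_mult[symmetric] mult.assoc)
      also have "\<bar>f (e + h) - f e - T * h\<bar> / \<bar>h\<bar> = norm ((f (e + h) - f e) / h - T)"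
        using h by (simp add: abs_divide[symmetric] diff_divide_distrib)
      also have "Q * \<bar>h\<bar> \<le> (Q + 1) * \<bar>h\<bar>" by (simp add: mult_right_mono)
      also have "\<dots> < \<epsilon>" using h Q by (simp add: field_simps)
      finally show "norm ((f (e + h) - f e) / h - T) < \<epsilon>" .
    qed
  qed
qed

context planar_hamiltonian
begin

definition area :: "real \<Rightarrow> real" where
  "area e = measure lborel {z. k z \<le> e}"

lemma sublevel_fmeasurable: "{z. k z \<le> e} \<in> fmeasurable lborel"
  by (rule fmeasurable_compact[OF compact_sublevel])

lemma area_mono: "mono area"
proof (rule monoI)
  fix a b :: real assume "a \<le> b"
  then have "{z. k z \<le> a} \<subseteq> {z. k z \<le> b}" by auto
  then show "area a \<le> area b" unfolding area_def
    by (rule measure_mono_fmeasurable) (simp_all add: closed_sublevel sublevel_fmeasurable)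
qed

text \<open>
  The field \<open>1 / cnj G = G / \<bar>G\<bar>\<^sup>2\<close> is normal to the levels, and \<open>k\<close> grows along it at unit rate.
\<close>
lemma normal_field_deriv:
  assumes "(\<gamma> has_vector_derivative d) (at t)" "G (\<gamma> t) \<noteq> 0"
  shows "((\<lambda>t. inverse (cnj (G (\<gamma> t)))) has_vector_derivative
     - (cnj (G' (\<gamma> t) d)) / (cnj (G (\<gamma> t)))\<^sup>2) (at t)"
proof -
  have "((\<lambda>t. G (\<gamma> t)) has_vector_derivative G' (\<gamma> t) d) (at t)"
    using has_derivative_compose[OF assms(1)[unfolded has_vector_derivative_def] G_deriv[of "\<gamma> t"]]
      linear_scale[OF bounded_linear.linear[OF has_derivative_bounded_linear[OF G_deriv]]]
    by (simp add: has_vector_derivative_def)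
  then have c: "((\<lambda>t. cnj (G (\<gamma> t))) has_vector_derivative cnj (G' (\<gamma> t) d)) (at t)"
    by (rule bounded_linear.has_vector_derivative[OF bounded_linear_cnj])
  have "(inverse has_field_derivative - (inverse (cnj (G (\<gamma> t))) ^ Suc (Suc 0))) (at (cnj (G (\<gamma> t))))"
    using DERIV_inverse[of "cnj (G (\<gamma> t))" UNIV] assms(2) by simp
  from field_vector_diff_chain_at[OF c this]
  show ?thesis by (simp add: o_def power2_eq_square divide_inverse mult_ac)
qed

lemma normal_field_deriv_cont:
  assumes "continuous_on S \<gamma>" "continuous_on S D" "\<And>t. t \<in> S \<Longrightarrow> G (\<gamma> t) \<noteq> 0"
  shows "continuous_on S (\<lambda>t. - (cnj (G' (\<gamma> t) (D t))) / (cnj (G (\<gamma> t)))\<^sup>2)"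
proof -
  have G'_eq: "G' z v = Re v *\<^sub>R G' z 1 + Im v *\<^sub>R G' z \<i>" for z v
  proof -
    interpret bounded_linear "G' z" using G_deriv by (rule has_derivative_bounded_linear)
    have "v = Re v *\<^sub>R 1 + Im v *\<^sub>R \<i>" by (simp add: complex_eq_iff)
    then have "G' z v = G' z (Re v *\<^sub>R 1 + Im v *\<^sub>R \<i>)" by simp
    then show ?thesis by (simp only: add scaleR)
  qed
  have "continuous_on S (\<lambda>t. Re (D t) *\<^sub>R G' (\<gamma> t) 1 + Im (D t) *\<^sub>R G' (\<gamma> t) \<i>)"
    by (intro continuous_intros assms(2) continuous_on_compose2[OF G'_cont assms(1)]) auto
  then have "continuous_on S (\<lambda>t. G' (\<gamma> t) (D t))" by (simp only: G'_eq[symmetric])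
  then show ?thesis
    using assms(3) by (intro continuous_intros continuous_on_compose2[OF G_cont assms(1)]) auto
qed

text \<open>
  Push the orbit \<open>\<gamma>\<close> to \<open>\<gamma> + r N\<close>, where \<open>N\<close> is the normal field along which \<open>k\<close> grows at unit rate. For
  small \<open>r\<close> this is a simple closed curve between the levels \<open>e + r \<plusminus> (C - 1) r\<^sup>2\<close>; it winds around the minimum
  in the same sense \<open>\<sigma>\<close> as \<open>\<gamma>\<close>, because the two are close. Its signed area is \<open>A + r T + B r\<^sup>2\<close>, where
  \<open>A\<close> is the action of \<open>\<gamma>\<close>; the linear coefficient is the integral of \<open>Im (cnj N * D)\<close>, and the integrand is
  identically the period \<open>T\<close>. The areas of the sublevels squeeze it.
\<close>
theorem area_derivative:
  assumes o: "periodic_orbit e x T" and e: "e > k zm"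
  shows "area e = integral {0..1} (\<lambda>t. Re (x (T * t)) * Im (T *\<^sub>R (\<i> * G (x (T * t)))))"
    "(area has_real_derivative T) (at e)"
proof -
  define \<gamma> where "\<gamma> = orbit_loop x T"
  define D where "D t = T *\<^sub>R (\<i> * G (\<gamma> t))" for t
  note ol = orbit_loop[OF o, folded \<gamma>_def]
  have D_eq: "D = (\<lambda>t. T *\<^sub>R (\<i> * G (x (T * t))))" by (simp add: D_def[abs_def] \<gamma>_def orbit_loop_def)
  interpret \<gamma>: C1_loop \<gamma> D using ol(1) unfolding D_eq .
  have T: "T > 0" using o by (simp add: periodic_orbit_def)
  have k\<gamma>: "k (\<gamma> t) = e" for t using o by (simp add: \<gamma>_def orbit_loop_def periodic_orbit_def)
  have Gnz: "G (\<gamma> t) \<noteq> 0" for t using G_nz[of "\<gamma> t"] k\<gamma> e by simp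
  define N where "N t = inverse (cnj (G (\<gamma> t)))" for t
  define N' where "N' t = - (cnj (G' (\<gamma> t) (D t))) / (cnj (G (\<gamma> t)))\<^sup>2" for t
  have dN: "(N has_vector_derivative N' t) (at t)" for t
    unfolding N_def N'_def by (rule normal_field_deriv[OF \<gamma>.deriv Gnz])
  have cN': "continuous_on UNIV N'"
    unfolding N'_def by (rule normal_field_deriv_cont[OF \<gamma>.cont \<gamma>.cont_D Gnz])
  have cN: "continuous_on S N" for S
    by (rule continuous_on_vector_derivative) (rule has_vector_derivative_at_within[OF dN])
  have perN: "N (t + 1) = N t" for t by (simp add: N_def ol(3))
  have Dnz: "D t \<noteq> 0" for t using Gnz T by (simp add: D_def)
  obtain r1 :: real where r1: "r1 > 0" and simple: "\<And>r. \<bar>r\<bar> \<le> r1 \<Longrightarrow> simple_path (\<lambda>t. \<gamma> t + r *\<^sub>R N t)"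
    using perturbed_loop_simple[OF \<gamma>.deriv \<gamma>.cont_D Dnz dN cN' ol(3) perN ol(2)] by metis
  have loop_r: "C1_loop (\<lambda>t. \<gamma> t + r *\<^sub>R N t) (\<lambda>t. D t + r *\<^sub>R N' t)" for r
  proof
    show "((\<lambda>t. \<gamma> t + r *\<^sub>R N t) has_vector_derivative D t + r *\<^sub>R N' t) (at t)" for t
      by (rule has_vector_derivative_add[OF \<gamma>.deriv bounded_linear.has_vector_derivative[OF bounded_linear_scaleR_right dN]])
    show "continuous_on UNIV (\<lambda>t. D t + r *\<^sub>R N' t)" by (intro continuous_intros \<gamma>.cont_D cN')
    show "\<gamma> 1 + r *\<^sub>R N 1 = \<gamma> 0 + r *\<^sub>R N 0" using \<gamma>.loop perN[of 0] by simp
  qed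
  define A where "A = integral {0..1} (\<lambda>t. Re (\<gamma> t) * Im (D t))"
  define B where "B = integral {0..1} (\<lambda>t. Re (N t) * Im (N' t))"
  have expand: "integral {0..1} (\<lambda>t. Re (\<gamma> t + r *\<^sub>R N t) * Im (D t + r *\<^sub>R N' t)) = A + r * T + B * r\<^sup>2" for r
  proof (rule integral_unique)
    have cts: "continuous_on {0..1} (\<lambda>t. Re (\<gamma> t) * Im (D t))" "continuous_on {0..1} (\<lambda>t. Re (N t) * Im (N' t))"
      by (intro continuous_intros \<gamma>.cont cN continuous_on_subset[OF \<gamma>.cont_D] continuous_on_subset[OF cN']; simp)+
    \<comment> \<open>Integration by parts moves the derivative from \<open>N\<close> to \<open>\<gamma>\<close> in the linear term.\<close>
    have "((\<lambda>t. Re (\<gamma> t) * Im (N t)) has_vector_derivative (Re (\<gamma> t) * Im (N' t) + Re (D t) * Im (N t))) (at t within {0..1})" for t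
      by (rule has_vector_derivative_mult[OF
          bounded_linear.has_vector_derivative[OF bounded_linear_Re has_vector_derivative_at_within[OF \<gamma>.deriv]]
          bounded_linear.has_vector_derivative[OF bounded_linear_Im has_vector_derivative_at_within[OF dN]]])
    from fundamental_theorem_of_calculus[OF _ this]
    have "((\<lambda>t. Re (\<gamma> t) * Im (N' t) + Re (D t) * Im (N t)) has_integral 0) {0..1}"
      using \<gamma>.loop perN[of 0] by simp
    from has_integral_add[OF this has_integral_const_real[of T 0 1]]
    have "((\<lambda>t. (Re (\<gamma> t) * Im (N' t) + Re (D t) * Im (N t)) + T) has_integral T) {0..1}" by simp
    moreover have "(Re (\<gamma> t) * Im (N' t) + Re (D t) * Im (N t)) + T = Re (\<gamma> t) * Im (N' t) + Re (N t) * Im (D t)" for t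
    proof -
      have "Re (N t) * Im (D t) - Re (D t) * Im (N t) = Im (cnj (N t) * D t)" by (simp add: algebra_simps)
      also have "cnj (N t) * D t = of_real T * \<i>" using Gnz[of t] by (simp add: N_def D_def scaleR_conv_of_real)
      finally show ?thesis by simp
    qed
    ultimately have lin: "((\<lambda>t. Re (\<gamma> t) * Im (N' t) + Re (N t) * Im (D t)) has_integral T) {0..1}" by simp
    have "((\<lambda>t. Re (\<gamma> t) * Im (D t) + r * (Re (\<gamma> t) * Im (N' t) + Re (N t) * Im (D t)) + r\<^sup>2 * (Re (N t) * Im (N' t)))
       has_integral A + r * T + r\<^sup>2 * B) {0..1}"
      unfolding A_def B_def
      by (intro has_integral_add has_integral_mult_right lin integrable_integral integrable_continuous_interval cts)
    then show "((\<lambda>t. Re (\<gamma> t + r *\<^sub>R N t) * Im (D t + r *\<^sub>R N' t)) has_integral A + r * T + B * r\<^sup>2) {0..1}"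
      by (rule has_integral_eq_rhs[OF has_integral_eq[rotated]]) (auto simp: algebra_simps power2_eq_square)
  qed
  obtain b where b: "\<And>t. t \<in> {0..1} \<Longrightarrow> norm (N t) \<le> b"
    using compact_imp_bounded[OF compact_continuous_image[OF cN compact_Icc]] unfolding bounded_iff by blast
  define b' where "b' = \<bar>b\<bar> + 1"
  have b': "b' > 0" "norm (N t) \<le> b'" if "t \<in> {0..1}" for t using b[OF that] by (auto simp: b'_def)
  have b'0: "b' > 0" by (simp add: b'_def add_pos_nonneg)
  obtain R where R: "\<And>z. k z \<le> e \<Longrightarrow> norm z < R" using sublevel_bounded[of e] by metis
  obtain L where L: "L > 0" and lip: "\<And>x y. x \<in> cball 0 (R + b') \<Longrightarrow> y \<in> cball 0 (R + b') \<Longrightarrow> norm (G x - G y) \<le> L * norm (x - y)"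
    using G_lipschitz by blast
  \<comment> \<open>The summand one leaves room to pass from strict to non-strict sublevels.\<close>
  define C where "C = L * b'\<^sup>2 + 1"
  have C: "C > 0" using L by (simp add: C_def add_nonneg_pos)
  have k_r: "\<bar>k (\<gamma> t + r *\<^sub>R N t) - (e + r)\<bar> \<le> (C - 1) * r\<^sup>2" if r: "\<bar>r\<bar> \<le> 1" and t: "t \<in> {0..1}" for r t
  proof -
    have n\<gamma>: "norm (\<gamma> t) < R" using R[of "\<gamma> t"] k\<gamma> by simp
    have nrN: "norm (r *\<^sub>R N t) \<le> \<bar>r\<bar> * b'" using b'(2)[OF t] by (simp add: mult_left_mono)
    also have "\<dots> \<le> 1 * b'" using r b'0 by (intro mult_right_mono) auto
    finally have n1: "norm (r *\<^sub>R N t) \<le> b'" by simp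
    have "\<bar>k (\<gamma> t + r *\<^sub>R N t) - k (\<gamma> t) - G (\<gamma> t) \<bullet> (\<gamma> t + r *\<^sub>R N t - \<gamma> t)\<bar> \<le> L * (norm (\<gamma> t + r *\<^sub>R N t - \<gamma> t))\<^sup>2"
    proof (rule level_taylor[OF lip])
      show "\<gamma> t \<in> cball 0 (R + b')" using n\<gamma> b'0 by simp
      show "\<gamma> t + r *\<^sub>R N t \<in> cball 0 (R + b')"
        using norm_triangle_ineq[of "\<gamma> t" "r *\<^sub>R N t"] n\<gamma> n1 by simp
    qed (use L in auto)
    moreover have "G (\<gamma> t) \<bullet> N t = 1"
    proof -
      have "G (\<gamma> t) \<bullet> N t = Re (cnj (G (\<gamma> t)) * N t)" by (simp add: inner_complex_def)
      then show ?thesis using Gnz[of t] by (simp add: N_def)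
    qed
    ultimately have "\<bar>k (\<gamma> t + r *\<^sub>R N t) - (e + r)\<bar> \<le> L * (norm (r *\<^sub>R N t))\<^sup>2"
      using k\<gamma>[of t] by (simp add: algebra_simps)
    also have "\<dots> \<le> L * (\<bar>r\<bar> * b')\<^sup>2" using nrN L by (intro mult_left_mono power_mono) auto
    finally show ?thesis by (simp add: C_def power_mult_distrib mult_ac)
  qed
  have zm_in: "zm \<in> inside (path_image \<gamma>)"
    by (rule level_loop_encloses_minimum[OF ol(2) \<gamma>.finish_start ol(4)])
  obtain \<sigma> :: real where \<sigma>: "\<sigma> \<in> {1,-1}" "winding_number \<gamma> zm = of_real \<sigma>"
    using \<gamma>.area_inside[OF ol(2)] zm_in by blast
  obtain \<mu> where \<mu>: "\<mu> > 0" "\<And>t. t \<in> {0..1} \<Longrightarrow> \<mu> \<le> norm (\<gamma> t - zm)"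
  proof -
    have "continuous_on {0..1} (\<lambda>t. norm (\<gamma> t - zm))" by (intro continuous_intros \<gamma>.cont)
    then obtain t0 where "\<forall>t\<in>{0..1}. norm (\<gamma> t0 - zm) \<le> norm (\<gamma> t - zm)"
      using continuous_attains_inf[of "{0..1}" "\<lambda>t. norm (\<gamma> t - zm)"] by auto
    moreover have "\<gamma> t0 \<noteq> zm" using k\<gamma>[of t0] e by auto
    ultimately show thesis using that[of "norm (\<gamma> t0 - zm)"] by auto
  qed
  define r0 where "r0 = min (min r1 1) (\<mu> / (2 * b'))"
  have r0: "r0 > 0" using r1 \<mu> b'0 by (simp add: r0_def)
  have sq: "area (e + r - C * r\<^sup>2) \<le> \<sigma> * (A + r * T + B * r\<^sup>2) \<and> \<sigma> * (A + r * T + B * r\<^sup>2) \<le> area (e + r + C * r\<^sup>2)"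
    if r: "r \<noteq> 0" "\<bar>r\<bar> \<le> r0" for r
  proof -
    define g where "g t = \<gamma> t + r *\<^sub>R N t" for t
    interpret g: C1_loop g "\<lambda>t. D t + r *\<^sub>R N' t" using loop_r[of r] by (simp add: g_def[abs_def])
    let ?I = "inside (path_image g)"
    have sg: "simple_path g" using simple[of r] r by (simp add: g_def[abs_def] r0_def)
    have kg: "\<bar>k (g t) - (e + r)\<bar> \<le> (C - 1) * r\<^sup>2" if "t \<in> {0..1}" for t
      unfolding g_def by (rule k_r) (use r that in \<open>auto simp: r0_def\<close>)
    have wn: "winding_number g zm = winding_number \<gamma> zm"
    proof (rule winding_number_nearby_loops_eq)
      fix t :: real assume t: "t \<in> {0..1}"
      have "cmod (g t - \<gamma> t) = \<bar>r\<bar> * norm (N t)" by (simp add: g_def)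
      also have "\<dots> \<le> (\<mu> / (2 * b')) * b'" using r b'(2)[OF t] b'0 \<mu> by (intro mult_mono) (auto simp: r0_def)
      also have "\<dots> < \<mu>" using b'0 \<mu> by simp
      finally show "cmod (g t - \<gamma> t) < cmod (\<gamma> t - zm)" using \<mu>(2)[OF t] by simp
    qed (use \<gamma>.finish_start g.finish_start \<gamma>.valid g.valid valid_path_imp_path in auto)
    have zg: "zm \<in> ?I"
    proof -
      have "winding_number g zm \<noteq> 0" using wn \<sigma> by auto
      then have "zm \<notin> outside (path_image g)"
        using winding_number_zero_in_outside[of g zm] g.finish_start g.valid valid_path_imp_path by blast
      moreover have "zm \<notin> path_image g"
      proof
        assume "zm \<in> path_image g"
        then obtain t where t: "t \<in> {0..1}" "g t = zm" by (auto simp: path_image_def)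
        have "norm (\<gamma> t - zm) = \<bar>r\<bar> * norm (N t)" using t(2)[symmetric] by (simp add: g_def)
        also have "\<dots> \<le> (\<mu> / (2 * b')) * b'" using r b'(2)[OF t(1)] b'0 \<mu> by (intro mult_mono) (auto simp: r0_def)
        also have "\<dots> < \<mu>" using b'0 \<mu> by simp
        finally show False using \<mu>(2)[OF t(1)] by simp
      qed
      ultimately show ?thesis using Jordan_inside_outside[OF sg g.finish_start] by blast
    qed
    obtain \<sigma>' :: real where "\<sigma>' \<in> {1,-1}" "\<forall>z\<in>?I. winding_number g z = of_real \<sigma>'"
      and ar: "integral {0..1} (\<lambda>t. Re (g t) * Im (D t + r *\<^sub>R N' t)) = \<sigma>' * measure lborel ?I"
      using g.area_inside[OF sg] by blast
    then have "\<sigma>' = \<sigma>" using zg wn \<sigma>(2) by simp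
    then have meas: "\<sigma> * (A + r * T + B * r\<^sup>2) = measure lborel ?I"
      using ar expand[of r] \<sigma>(1) by (auto simp: g_def)
    have img: "path_image g \<subseteq> {z. e + r - (C - 1) * r\<^sup>2 \<le> k z \<and> k z \<le> e + r + (C - 1) * r\<^sup>2}"
      using kg by (fastforce simp: path_image_def abs_le_iff)
    note S = loop_encloses_sublevel[OF sg g.finish_start img zg]
    have r2: "r\<^sup>2 > 0" using r by simp
    have sub1: "{z. k z \<le> e + r - C * r\<^sup>2} \<subseteq> ?I"
    proof (rule order_trans[OF _ S(1)], rule subsetI)
      fix z assume "z \<in> {z. k z \<le> e + r - C * r\<^sup>2}"
      then have "k z \<le> e + r - C * r\<^sup>2" by simp
      then have "k z < e + r - (C * r\<^sup>2 - 1 * r\<^sup>2)" using r2 by linarith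
      then show "z \<in> {z. k z < e + r - (C - 1) * r\<^sup>2}" by (simp only: left_diff_distrib mem_Collect_eq)
    qed
    have sub2: "?I \<subseteq> {z. k z \<le> e + r + C * r\<^sup>2}"
    proof (rule order_trans[OF S(2)], rule subsetI)
      fix z assume "z \<in> {z. k z \<le> e + r + (C - 1) * r\<^sup>2}"
      then have "k z \<le> e + r + (C * r\<^sup>2 - 1 * r\<^sup>2)" by (simp only: left_diff_distrib mem_Collect_eq)
      then show "z \<in> {z. k z \<le> e + r + C * r\<^sup>2}" using r2 unfolding mem_Collect_eq by linarith
    qed
    have Im: "?I \<in> sets lborel" using Jordan_inside_outside[OF sg g.finish_start] by simp
    have If: "?I \<in> fmeasurable lborel"
      by (rule fmeasurableI2[OF sublevel_fmeasurable sub2]) (use Im in simp)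
    show ?thesis unfolding meas area_def
      using measure_mono_fmeasurable[OF sub1 _ If] measure_mono_fmeasurable[OF sub2 Im sublevel_fmeasurable]
      by (simp add: closed_sublevel)
  qed
  note res = squeeze_quadratic_derivative[OF area_mono T C r0 _ sq]
  have "A = integral {0..1} (\<lambda>t. Re (x (T * t)) * Im (T *\<^sub>R (\<i> * G (x (T * t)))))"
    by (simp add: A_def D_def \<gamma>_def orbit_loop_def)
  then show "area e = integral {0..1} (\<lambda>t. Re (x (T * t)) * Im (T *\<^sub>R (\<i> * G (x (T * t)))))"
    using res(2) \<sigma>(1) by auto
  show "(area has_real_derivative T) (at e)" using res(3) \<sigma>(1) by auto
qed

end

section \<open>The area coordinate and actions of reparametrized orbits\<close>

context planar_hamiltonian
begin

lemma unbounded_above: "\<exists>z. k z > c"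
proof -
  have "eventually (\<lambda>z. c < k z) at_infinity"
    using proper by (simp add: filterlim_at_top_dense)
  then obtain b where "\<And>z. b \<le> norm z \<Longrightarrow> c < k z"
    unfolding eventually_at_infinity by blast
  then have "c < k (of_real \<bar>b\<bar>)" by simp
  then show ?thesis by blast
qed

lemma level_nonempty:
  assumes "e \<ge> k zm"
  obtains z where "k z = e"
proof -
  obtain z1 where z1: "k z1 > e" using unbounded_above by blast
  have "connected (range k)" by (intro connected_continuous_image k_cont connected_UNIV)
  then have "e \<in> range k"
    using connected_iff_interval assms z1 by (metis less_imp_le rangeI)
  then show thesis using that by blast
qed

lemma level_orbit:
  assumes "e > k zm"
  obtains x T where "periodic_orbit e x T"
proof -
  obtain z where "k z = e" using level_nonempty[of e] assms by auto
  from periodic_orbit_exists[OF assms this] show thesis using that by blast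
qed

lemma level_orbit_covers:
  assumes o: "periodic_orbit e x T" and e: "e > k zm" and z: "k z = e"
  obtains \<tau> where "\<tau> \<ge> 0" "x \<tau> = z"
proof -
  have "path_image (orbit_loop x T) = {z. k z = e}"
    using level_eq_loop[OF orbit_loop(2)[OF o] C1_loop.finish_start[OF orbit_loop(1)[OF o]] orbit_loop(4)[OF o] e] .
  then have "z \<in> orbit_loop x T ` {0..1}" using z by (simp add: path_image_def)
  then obtain t where "t \<in> {0..1}" "orbit_loop x T t = z" by blast
  then show thesis using o by (intro that[of "T * t"]) (auto simp: orbit_loop_def periodic_orbit_def)
qed

lemma area_nonneg: "area e \<ge> 0"
  by (simp add: area_def)

lemma area_min: "area (k zm) = 0"
proof -
  have "{z. k z \<le> k zm} = {zm}" using min k_eq_min_iff by (auto intro: antisym)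
  then show ?thesis by (simp add: area_def)
qed

lemma area_pos_deriv:
  assumes "e > k zm"
  shows "\<exists>T>0. (area has_real_derivative T) (at e)"
proof -
  obtain x T where o: "periodic_orbit e x T" using level_orbit[OF assms] .
  then have "T > 0" by (simp add: periodic_orbit_def)
  then show ?thesis using area_derivative(2)[OF o assms] by blast
qed

text \<open>
  Near the minimum continuity cannot be read off from a derivative, since the minimum may be degenerate.
  The sublevels shrink to a point, which has measure zero.
\<close>
lemma area_small_near_min:
  assumes "\<epsilon> > 0"
  obtains e where "e > k zm" "area e < \<epsilon>"
proof -
  define A where "A n = {z. k z \<le> k zm + 1 / real (Suc n)}" for n
  have "(\<lambda>n. measure lborel (A n)) \<longlonglongrightarrow> measure lborel (\<Inter>n. A n)"
  proof (rule Lim_measure_decseq)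
    show "range A \<subseteq> sets lborel" by (auto simp: A_def closed_sublevel)
    show "decseq A"
    proof (intro decseq_SucI subsetI)
      fix n z assume "z \<in> A (Suc n)"
      moreover have "1 / real (Suc (Suc n)) \<le> 1 / real (Suc n)" by (simp add: frac_le)
      ultimately show "z \<in> A n" unfolding A_def mem_Collect_eq by linarith
    qed
    show "emeasure lborel (A i) \<noteq> \<infinity>" for i
      using sublevel_fmeasurable[of "k zm + 1 / real (Suc i)"] unfolding A_def fmeasurable_def
      by (simp del: of_nat_Suc add: less_top)
  qed
  moreover have "(\<Inter>n. A n) = {zm}"
  proof -
    have "k z \<le> k zm" if "z \<in> (\<Inter>n. A n)" for z
    proof (rule field_le_epsilon)
      fix d :: real assume "d > 0"
      then obtain n where "1 / real (Suc n) < d" using nat_approx_posE by blast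
      moreover have "k z \<le> k zm + 1 / real (Suc n)" using that by (auto simp: A_def)
      ultimately show "k z \<le> k zm + d" by linarith
    qed
    then have "z = zm" if "z \<in> (\<Inter>n. A n)" for z using that min[of z] k_eq_min_iff by force
    moreover have "zm \<in> (\<Inter>n. A n)" by (simp add: A_def)
    ultimately show ?thesis by blast
  qed
  ultimately have "(\<lambda>n. measure lborel (A n)) \<longlonglongrightarrow> 0" by simp
  then have "\<forall>\<^sub>F n in sequentially. measure lborel (A n) < \<epsilon>"
    by (rule order_tendstoD(2)) (rule assms)
  then obtain n where "measure lborel (A n) < \<epsilon>" by (auto simp: eventually_sequentially)
  then show thesis by (intro that[of "k zm + 1 / real (Suc n)"]) (auto simp: area_def A_def)
qed

lemma area_cont: "continuous_on {k zm..} area"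
  unfolding continuous_on_eq_continuous_within
proof
  fix e assume "e \<in> {k zm..}"
  then consider "e > k zm" | "e = k zm" by fastforce
  then show "continuous (at e within {k zm..}) area"
  proof cases
    case 1
    then show ?thesis using area_pos_deriv[OF 1] DERIV_isCont continuous_at_imp_continuous_at_within by blast
  next
    case 2
    show ?thesis unfolding 2 continuous_within
    proof (rule tendstoI)
      fix \<epsilon> :: real assume "\<epsilon> > 0"
      then obtain e1 where e1: "e1 > k zm" "area e1 < \<epsilon>" by (rule area_small_near_min)
      show "\<forall>\<^sub>F u in at (k zm) within {k zm..}. dist (area u) (area (k zm)) < \<epsilon>"
        unfolding eventually_at
      proof (intro exI[of _ "e1 - k zm"] conjI ballI impI)
        fix u assume "u \<in> {k zm..}" "u \<noteq> k zm \<and> dist u (k zm) < e1 - k zm"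
        then have "u \<le> e1" by (auto simp: dist_real_def)
        then have "area u \<le> area e1" by (rule monoD[OF area_mono])
        then show "dist (area u) (area (k zm)) < \<epsilon>" using e1 area_nonneg[of u] by (simp add: area_min)
      qed (use e1 in simp)
    qed
  qed
qed

lemma area_strict_mono:
  assumes "k zm \<le> a" "a < b"
  shows "area a < area b"
proof (rule DERIV_pos_imp_increasing_open[OF assms(2)])
  show "\<exists>y. (area has_real_derivative y) (at u) \<and> y > 0" if "a < u" "u < b" for u
    using area_pos_deriv[of u] that assms by auto
  show "continuous_on {a..b} area"
    by (rule continuous_on_subset[OF area_cont]) (use assms in auto)
qed

lemma area_surj:
  assumes "a \<ge> 0"
  obtains e where "e \<ge> k zm" "area e = a"
proof -
  define s where "s = a + 1"
  define Q where "Q = cbox 0 (Complex s s)"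
  have s: "s \<ge> 1" using assms by (simp add: s_def)
  have "compact (k ` Q)" unfolding Q_def by (intro compact_continuous_image k_cont compact_cbox)
  then have "bdd_above (k ` Q)" by (intro bounded_imp_bdd_above compact_imp_bounded)
  then obtain e1 where e1: "\<And>z. z \<in> Q \<Longrightarrow> k z \<le> e1" by (auto simp: bdd_above_def)
  have "0 \<in> Q" using s by (simp add: Q_def in_cbox_complex_iff)
  then have e1m: "k zm \<le> e1" using min[of 0] e1[of 0] by simp
  have "measure lborel Q = s * s"
    using s unfolding Q_def by (simp add: measure_lborel_cbox_eq Basis_complex_def)
  moreover have "measure lborel Q \<le> area e1" unfolding area_def
    by (rule measure_mono_fmeasurable[OF _ _ sublevel_fmeasurable]) (use e1 in \<open>auto simp: Q_def\<close>)
  moreover have "a \<le> s * s"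
  proof -
    have "1 * s \<le> s * s" using s by (intro mult_right_mono) auto
    moreover have "a \<le> s" by (simp add: s_def)
    ultimately show ?thesis by linarith
  qed
  ultimately have "area (k zm) \<le> a" "a \<le> area e1" using area_min assms by auto
  then obtain e where "k zm \<le> e" "e \<le> e1" "area e = a"
    using IVT'[of area "k zm" a e1] e1m continuous_on_subset[OF area_cont, of "{k zm..e1}"] by auto
  then show thesis using that by blast
qed

lemma area_cont_UNIV: "continuous_on UNIV area"
proof -
  have eq: "area e = area (max (k zm) e)" for e
  proof (cases "k zm \<le> e")
    case False
    then have "\<not> k z \<le> e" for z using min[of z] by linarith
    then have "{z. k z \<le> e} = {}" by blast
    then show ?thesis using False area_min by (simp add: area_def max_def)
  qed (simp add: max_def)
  have "continuous_on UNIV (\<lambda>e. area (max (k zm) e))"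
    by (intro continuous_on_compose2[OF area_cont] continuous_intros) auto
  then show ?thesis by (rule continuous_on_cong[THEN iffD2, OF refl eq])
qed

text \<open>
  The area coordinate of a point is the area below its level, so the points with area coordinate at
  most \<open>a\<close> form a sublevel of area \<open>a\<close>. Half lines generate the Borel sets.
\<close>
theorem distr_area: "distr lborel borel (\<lambda>z. area (k z)) = density lborel (indicator {0..})"
proof (rule measure_eqI_generator_eq[where E = "range atMost" and A = "\<lambda>n. {..real n}" and \<Omega> = UNIV])
  have m[measurable]: "(\<lambda>z. area (k z)) \<in> borel_measurable borel"
    by (intro borel_measurable_continuous_onI continuous_on_compose2[OF area_cont_UNIV k_cont]) auto
  have low: "emeasure (distr lborel borel (\<lambda>z. area (k z))) {..a} = ennreal (max 0 a)" for a
  proof (cases "a \<ge> 0")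
    case True
    obtain e where e: "e \<ge> k zm" "area e = a" using area_surj[OF True] by blast
    have "area (k z) \<le> a \<longleftrightarrow> k z \<le> e" for z
      using e area_strict_mono[of e "k z"] monoD[OF area_mono, of "k z" e] by (meson not_le)
    then have "(\<lambda>z. area (k z)) -` {..a} = {z. k z \<le> e}" by auto
    then have "emeasure (distr lborel borel (\<lambda>z. area (k z))) {..a} = emeasure lborel {z. k z \<le> e}"
      by (subst emeasure_distr) auto
    also have "\<dots> = ennreal (area e)" unfolding area_def
      using emeasure_eq_measure2 sublevel_fmeasurable by blast
    finally show ?thesis using True e by simp
  next
    case False
    then have "\<not> area e \<le> a" for e using area_nonneg[of e] by linarith
    then have "(\<lambda>z. area (k z)) -` {..a} = {}" by blast
    then show ?thesis using False by (subst emeasure_distr) auto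
  qed
  have right: "emeasure (density lborel (indicator {0..})) {..a} = ennreal (max 0 a)" for a :: real
  proof -
    have "emeasure (density lborel (indicator {0..})) {..a} = emeasure lborel ({0..} \<inter> {..a})"
      by (subst emeasure_density) (auto simp: indicator_inter_arith[symmetric] nn_integral_indicator)
    also have "{0..} \<inter> {..a} = {0..a}" by auto
    finally show ?thesis by (simp add: max_def)
  qed
  show "Int_stable (range atMost :: real set set)"
    by (auto simp: Int_stable_def)
  show "emeasure (distr lborel borel (\<lambda>z. area (k z))) X = emeasure (density lborel (indicator {0..})) X"
    if "X \<in> range atMost" for X using that low right by auto
  show "sets (distr lborel borel (\<lambda>z. area (k z))) = sigma_sets UNIV (range atMost)"
    by (simp add: borel_eq_atMost sets_measure_of)
  show "sets (density lborel (indicator {0..})) = sigma_sets UNIV (range (atMost :: real \<Rightarrow> real set))"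
    by (simp add: borel_eq_atMost sets_measure_of)
  show "(\<Union>i. {..real i}) = UNIV" using real_arch_simple by auto
  show "emeasure (distr lborel borel (\<lambda>z. area (k z))) {..real i} \<noteq> \<infinity>" for i
    unfolding low by simp
qed auto

lemma period_multiple:
  assumes o: "periodic_orbit e x T" and eq: "x (\<tau> + s) = x \<tau>" and s: "s \<ge> 0"
  shows "\<exists>n. s = real n * T"
proof -
  note o' = o[unfolded periodic_orbit_def]
  define n where "n = nat \<lfloor>s / T\<rfloor>"
  define \<rho> where "\<rho> = s - real n * T"
  have T: "T > 0" using o' by blast
  have "real n = of_int \<lfloor>s / T\<rfloor>" using s T by (simp add: n_def)
  then have n: "real n \<le> s / T" "s / T < real n + 1" by linarith+
  then have \<rho>: "0 \<le> \<rho>" "\<rho> < T" using T by (auto simp: \<rho>_def field_simps)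
  have "x (\<tau> + s) = x ((\<tau> + \<rho>) + real n * T)" by (simp add: \<rho>_def)
  also have "\<dots> = x (\<tau> + \<rho>)" using o' by (intro periodic_add_nat) auto
  finally have "x (\<tau> + \<rho>) = x \<tau>" using eq by simp
  then have "x ((\<tau> + \<rho>) + - \<tau>) = x (\<tau> + - \<tau>)"
    by (rule solution_repeats_all[of x e _ _ T, rotated 2]) (use o' in auto)
  then have "x \<rho> = x 0" by simp
  then have "\<rho> = 0" using \<rho> o' by (metis le_less order_refl)
  then show ?thesis unfolding \<rho>_def by (intro exI[of _ n]) simp
qed

text \<open>
  After a change of time the curve follows the flow, and since it is closed it covers its
  periodic orbit a whole number \<open>n\<close> of times (or it rests at the minimum). Its action is then \<open>n\<close> times the
  enclosed area.
\<close>
lemma reparametrized_action_nonneg: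
  assumes \<zeta>: "\<And>t. t \<in> {0..1} \<Longrightarrow> (\<zeta> has_vector_derivative c t *\<^sub>R (\<i> * G (\<zeta> t))) (at t within {0..1})"
    and c: "continuous_on {0..1} c" "\<And>t. t \<in> {0..1} \<Longrightarrow> c t > 0" and loop: "\<zeta> 1 = \<zeta> 0"
  shows "integral {0..1} (\<lambda>t. Re (\<zeta> t) * Im (c t *\<^sub>R (\<i> * G (\<zeta> t)))) \<ge> 0"
proof -
  define e where "e = k (\<zeta> 0)"
  have k\<zeta>: "k (\<zeta> t) = e" if "t \<in> {0..1}" for t
  proof -
    have "((\<lambda>t. k (\<zeta> t)) has_derivative (\<lambda>h. 0)) (at s within {0..1})" if "s \<in> {0..1}" for s
      using k_along_curve[OF \<zeta>[OF that]] by (simp add: has_vector_derivative_def inner_ii_self)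
    from has_derivative_zero_unique[OF convex_real_interval(5) this, of t 0] that
    show ?thesis unfolding e_def by auto
  qed
  show ?thesis
  proof (cases "e = k zm")
    case True
    have "integral {0..1} (\<lambda>t. Re (\<zeta> t) * Im (c t *\<^sub>R (\<i> * G (\<zeta> t)))) = integral {0..1} (\<lambda>t::real. 0)"
    proof (rule integral_cong)
      fix t :: real assume "t \<in> {0..1}"
      then have "\<zeta> t = zm" using k\<zeta> True k_eq_min_iff by simp
      then show "Re (\<zeta> t) * Im (c t *\<^sub>R (\<i> * G (\<zeta> t))) = 0" by (simp add: G_zm)
    qed
    then show ?thesis by simp
  next
    case False
    then have e: "e > k zm" using min[of "\<zeta> 0"] by (simp add: e_def)
    obtain x T where o: "periodic_orbit e x T" using level_orbit[OF e] by blast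
    note o' = o[unfolded periodic_orbit_def]
    have T: "T > 0" using o' by blast
    have kx: "k (x t) = e" for t using o' by blast
    have dx: "(x has_vector_derivative \<i> * G (x t)) (at t)" for t using o' by (simp add: solution_def)
    obtain \<tau> where \<tau>: "\<tau> \<ge> 0" "x \<tau> = \<zeta> 0" using level_orbit_covers[OF o e, of "\<zeta> 0"] by (auto simp: e_def)
    define s where "s t = integral {0..t} c" for t
    have s': "(s has_vector_derivative c t) (at t within {0..1})" if "t \<in> {0..1}" for t
      unfolding s_def by (rule integral_has_vector_derivative[OF c(1) that])
    have s0: "s 0 = 0" by (simp add: s_def)
    have s_nonneg: "s t \<ge> 0" if "t \<in> {0..1}" for t
      unfolding s_def
      by (rule integral_nonneg[OF integrable_continuous_interval[OF continuous_on_subset[OF c(1)]]])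
        (use that c(2) in \<open>auto intro: less_imp_le\<close>)
    obtain M where M: "\<And>t. t \<in> {0..1} \<Longrightarrow> c t \<le> M"
      using bounded_imp_bdd_above[OF compact_imp_bounded[OF compact_continuous_image[OF c(1) compact_Icc]]]
      unfolding bdd_above_def by blast
    obtain R where R: "R > 0" "\<And>z. k z \<le> e \<Longrightarrow> norm z < R" using sublevel_bounded[of e] by metis
    obtain L where L: "L > 0" and lip: "\<And>x y. x \<in> cball 0 R \<Longrightarrow> y \<in> cball 0 R \<Longrightarrow> norm (G x - G y) \<le> L * norm (x - y)"
      using G_lipschitz by blast
    have dxs: "((\<lambda>t. x (\<tau> + s t)) has_vector_derivative c t *\<^sub>R (\<i> * G (x (\<tau> + s t)))) (at t within {0..1})" if "t \<in> {0..1}" for t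
    proof -
      have "((\<lambda>t. \<tau> + s t) has_vector_derivative 0 + c t) (at t within {0..1})"
        by (intro has_vector_derivative_add has_vector_derivative_const s' that)
      then show ?thesis
        using vector_diff_chain_within[OF _ has_vector_derivative_at_within[OF dx], of "\<lambda>t. \<tau> + s t" "c t" t "{0..1}"]
        by (simp add: o_def)
    qed
    have \<zeta>_eq: "\<zeta> t = x (\<tau> + s t)" if "t \<in> {0..1}" for t
    proof (rule ode_solution_unique[where b = 1 and c = c and M = M and S = "cball 0 R" and L = L and Y = "\<lambda>z. \<i> * G z", OF \<zeta> dxs])
      show "norm (\<i> * G x - \<i> * G y) \<le> L * norm (x - y)" if "x \<in> cball 0 R" "y \<in> cball 0 R" for x y
        using lip[OF that] by (metis mult_1 norm_ii norm_mult right_diff_distrib)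
      show "\<zeta> t \<in> cball 0 R \<and> x (\<tau> + s t) \<in> cball 0 R" if "t \<in> {0..1}" for t
        using R(2)[of "\<zeta> t"] R(2)[of "x (\<tau> + s t)"] k\<zeta>[OF that] kx by simp
      show "0 \<le> c t \<and> c t \<le> M" if "t \<in> {0..1}" for t using c(2)[OF that] M[OF that] by simp
    qed (use \<tau> s0 L that in auto)
    have "x (\<tau> + s 1) = x \<tau>" using \<zeta>_eq[of 1] loop \<tau> by simp
    then obtain n where n: "s 1 = real n * T" using period_multiple[OF o _ s_nonneg[of 1]] by auto
    define \<alpha> where "\<alpha> z = Re z * Im (\<i> * G z)" for z
    have xc: "continuous_on S x" for S
      by (rule continuous_on_vector_derivative) (rule has_vector_derivative_at_within[OF dx])
    have \<alpha>c: "continuous_on S (\<lambda>t. \<alpha> (x t))" for S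
      unfolding \<alpha>_def by (intro continuous_intros xc continuous_on_compose2[OF G_cont[of UNIV]]) auto
    \<comment> \<open>The action as a function of the flow time; one period adds the enclosed area.\<close>
    define P where "P u = integral {0..u} (\<lambda>t. \<alpha> (x t))" for u
    have P': "(P has_vector_derivative \<alpha> (x u)) (at u within {0..})" if "u \<ge> 0" for u
      unfolding P_def by (rule integral_has_vector_derivative_half_line[OF \<alpha>c that])
    have P_comp: "((\<lambda>t. P (g t)) has_vector_derivative g' * \<alpha> (x (g t))) (at t within S)"
      if "(g has_vector_derivative g') (at t within S)" "g ` S \<subseteq> {0..}" "t \<in> S" for g g' t S
    proof -
      have "(P has_vector_derivative \<alpha> (x (g t))) (at (g t) within g ` S)"
        using has_vector_derivative_within_subset[OF P'] that by auto
      from vector_diff_chain_within[OF that(1) this] show ?thesis by (simp add: o_def)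
    qed
    have P_T: "P T = area e"
    proof -
      have "((\<lambda>t. T * \<alpha> (x (T * t))) has_integral (P (T * 1) - P (T * 0))) {0..1}"
      proof (rule fundamental_theorem_of_calculus)
        fix t :: real assume t: "t \<in> {0..1}"
        have "((\<lambda>t. T * t) has_vector_derivative T) (at t within {0..1})"
          by (auto intro!: derivative_eq_intros)
        from P_comp[OF this _ t] show "((\<lambda>t. P (T * t)) has_vector_derivative T * \<alpha> (x (T * t))) (at t within {0..1})"
          using T by auto
      qed simp
      from integral_unique[OF this] have "integral {0..1} (\<lambda>t. T * \<alpha> (x (T * t))) = P T" by (simp add: P_def)
      moreover have "T * \<alpha> (x (T * t)) = Re (x (T * t)) * Im (T *\<^sub>R (\<i> * G (x (T * t))))" for t
        by (simp add: \<alpha>_def)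
      ultimately show ?thesis using area_derivative(1)[OF o e] by (simp del: scaleR_complex.simps)
    qed
    have P_shift: "P (u + T) - P u = area e" if u: "u \<ge> 0" for u
    proof -
      have "((\<lambda>u. P (u + T) - P u) has_derivative (\<lambda>h. 0)) (at v within {0..})" if v: "v \<in> {0..}" for v
      proof -
        have d: "((\<lambda>u. u + T) has_vector_derivative 1) (at v within {0..})"
          by (auto intro!: derivative_eq_intros)
        have sub: "(\<lambda>u. u + T) ` {0..} \<subseteq> {0..}" using T by auto
        show ?thesis
          using has_vector_derivative_diff[OF P_comp[OF d sub v] P'[of v]] v o' by (auto simp: has_vector_derivative_def)
      qed
      from has_derivative_zero_unique[OF convex_real_interval(1) this, of u 0] u
      show ?thesis using P_T by (auto simp: P_def)
    qed
    have P_n: "P (\<tau> + real n * T) - P \<tau> = real n * area e" for n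
    proof (induction n)
      case (Suc n)
      have "\<tau> + real n * T \<ge> 0" using \<tau> T by simp
      from P_shift[OF this] Suc show ?case by (simp add: algebra_simps)
    qed simp
    have "((\<lambda>t. c t * \<alpha> (x (\<tau> + s t))) has_integral (P (\<tau> + s 1) - P (\<tau> + s 0))) {0..1}"
    proof (rule fundamental_theorem_of_calculus)
      fix t :: real assume t: "t \<in> {0..1}"
      have "((\<lambda>t. \<tau> + s t) has_vector_derivative 0 + c t) (at t within {0..1})"
        by (intro has_vector_derivative_add has_vector_derivative_const s' t)
      moreover have "(\<lambda>t. \<tau> + s t) ` {0..1} \<subseteq> {0..}"
      proof
        fix y assume "y \<in> (\<lambda>t. \<tau> + s t) ` {0..1}"
        then obtain t where "t \<in> {0..1}" "y = \<tau> + s t" by blast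
        then show "y \<in> {0..}" using s_nonneg[of t] \<tau> by simp
      qed
      ultimately show "((\<lambda>t. P (\<tau> + s t)) has_vector_derivative c t * \<alpha> (x (\<tau> + s t))) (at t within {0..1})"
        using P_comp[of "\<lambda>t. \<tau> + s t" "0 + c t", OF _ _ t] by simp
    qed simp
    from integral_unique[OF this] have "integral {0..1} (\<lambda>t. c t * \<alpha> (x (\<tau> + s t))) = real n * area e"
      using P_n[of n] n s0 by simp
    moreover have "integral {0..1} (\<lambda>t. Re (\<zeta> t) * Im (c t *\<^sub>R (\<i> * G (\<zeta> t)))) = integral {0..1} (\<lambda>t. c t * \<alpha> (x (\<tau> + s t)))"
      by (rule integral_cong) (simp add: \<zeta>_eq \<alpha>_def)
    ultimately show ?thesis using area_nonneg by simp
  qed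
qed

end

section \<open>Volumes in phase space\<close>

text \<open>
  Each factor contributes like a half line with Lebesgue measure, so the volume is that of
  a simplex. The induction integrates over one factor at a time and never has to identify the
  image of the product measure.
\<close>
lemma emeasure_sum_sublevel:
  fixes g :: "'i \<Rightarrow> complex \<Rightarrow> real"
  assumes "finite I" and g_meas: "\<And>i. g i \<in> borel_measurable borel"
    and push: "\<And>i. distr lborel borel (g i) = density lborel (indicator {0..})"
    and g_nonneg: "\<And>i z. 0 \<le> g i z" and "c \<ge> 0"
  shows "emeasure (\<Pi>\<^sub>M i\<in>I. lborel) {f \<in> space (\<Pi>\<^sub>M i\<in>I. lborel). (\<Sum>i\<in>I. g i (f i)) \<le> c}
    = ennreal (c ^ card I / fact (card I))"
  using assms(1,5)
proof (induction I arbitrary: c rule: finite_induct)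
  case empty
  then show ?case by (simp add: PiM_empty emeasure_count_space_finite)
next
  case (insert j I)
  have g_m[measurable]: "g i \<in> borel_measurable lborel" for i using g_meas by simp
  interpret P: product_sigma_finite "\<lambda>i::'i. lborel :: complex measure"
    by standard
  let ?n = "card I"
  let ?S = "\<lambda>J c. {f \<in> space (\<Pi>\<^sub>M i\<in>J. (lborel::complex measure)). (\<Sum>i\<in>J. g i (f i)) \<le> c}"
  have S[measurable]: "?S J c \<in> sets (\<Pi>\<^sub>M i\<in>J. (lborel::complex measure))" for J c
    by measurable
  define F :: "real \<Rightarrow> ennreal" where "F a = ennreal ((c - a) ^ ?n / fact ?n) * indicator {..c} a" for a
  have [measurable]: "F \<in> borel_measurable borel" unfolding F_def by measurable
  have inner: "(\<integral>\<^sup>+f. indicator (?S (insert j I) c) (f(j := z)) \<partial>(\<Pi>\<^sub>M i\<in>I. lborel)) = F (g j z)" for z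
  proof -
    have "(\<integral>\<^sup>+f. indicator (?S (insert j I) c) (f(j := z)) \<partial>(\<Pi>\<^sub>M i\<in>I. (lborel::complex measure)))
       = (\<integral>\<^sup>+f. indicator (?S I (c - g j z)) f \<partial>(\<Pi>\<^sub>M i\<in>I. (lborel::complex measure)))"
    proof (rule nn_integral_cong)
      fix f assume f: "f \<in> space (\<Pi>\<^sub>M i\<in>I. (lborel::complex measure))"
      have "(\<Sum>i\<in>insert j I. g i ((f(j := z)) i)) = g j z + (\<Sum>i\<in>I. g i (f i))"
        using insert.hyps by (auto simp: sum.insert intro!: sum.cong)
      moreover have "f(j := z) \<in> space (\<Pi>\<^sub>M i\<in>insert j I. (lborel::complex measure))"
        using f by (auto simp: space_PiM PiE_iff extensional_def)
      ultimately have "f(j := z) \<in> ?S (insert j I) c \<longleftrightarrow> f \<in> ?S I (c - g j z)" using f by auto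
      then show "(indicator (?S (insert j I) c) (f(j := z)) :: ennreal) = indicator (?S I (c - g j z)) f"
        by (simp add: indicator_def)
    qed
    also have "\<dots> = emeasure (\<Pi>\<^sub>M i\<in>I. (lborel::complex measure)) (?S I (c - g j z))" by simp
    also have "\<dots> = F (g j z)"
    proof (cases "g j z \<le> c")
      case True
      then show ?thesis using insert.IH[of "c - g j z"] by (simp add: F_def)
    next
      case False
      then have "\<not> (\<Sum>i\<in>I. g i (f i)) \<le> c - g j z" for f
        using sum_nonneg[of I "\<lambda>i. g i (f i)"] g_nonneg by fastforce
      then have "?S I (c - g j z) = {}" by blast
      then show ?thesis using False by (simp only: emeasure_empty) (simp add: F_def)
    qed
    finally show ?thesis .
  qed
  have "emeasure (\<Pi>\<^sub>M i\<in>insert j I. lborel) (?S (insert j I) c)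
     = (\<integral>\<^sup>+f. indicator (?S (insert j I) c) f \<partial>(\<Pi>\<^sub>M i\<in>insert j I. lborel))"
    by (rule nn_integral_indicator[OF S, symmetric])
  also have "\<dots> = (\<integral>\<^sup>+z. \<integral>\<^sup>+f. indicator (?S (insert j I) c) (f(j := z)) \<partial>(\<Pi>\<^sub>M i\<in>I. lborel) \<partial>lborel)"
    using insert.hyps by (intro P.product_nn_integral_insert_rev) auto
  also have "\<dots> = (\<integral>\<^sup>+z. F (g j z) \<partial>lborel)" unfolding inner ..
  also have "\<dots> = (\<integral>\<^sup>+a. F a \<partial>distr lborel borel (g j))" by (subst nn_integral_distr) auto
  also have "\<dots> = (\<integral>\<^sup>+a. indicator {0..} a * F a \<partial>lborel)" unfolding push by (subst nn_integral_density) auto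
  also have "\<dots> = (\<integral>\<^sup>+a. ennreal ((c - a) ^ ?n / fact ?n) * indicator {0..c} a \<partial>lborel)"
    by (intro nn_integral_cong) (auto simp: F_def indicator_def)
  also have "\<dots> = ennreal (- ((c - c) ^ Suc ?n / fact (Suc ?n)) - - ((c - 0) ^ Suc ?n / fact (Suc ?n)))"
  proof (rule nn_integral_FTC_Icc)
    fix a :: real assume "a \<in> {0..c}"
    have "((\<lambda>a. - ((c - a) ^ Suc ?n / fact (Suc ?n))) has_real_derivative (real (Suc ?n) * (c - a) ^ ?n / fact (Suc ?n))) (at a)"
      by (rule derivative_eq_intros refl | simp)+
    moreover have "real (Suc ?n) * (c - a) ^ ?n / fact (Suc ?n) = (c - a) ^ ?n / fact ?n"
      by (simp add: fact_Suc del: of_nat_Suc)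
    ultimately show "((\<lambda>a. - ((c - a) ^ Suc ?n / fact (Suc ?n))) has_real_derivative (c - a) ^ ?n / fact ?n) (at a)"
      by simp
  qed (use insert.prems in auto)
  also have "\<dots> = ennreal (c ^ card (insert j I) / fact (card (insert j I)))"
    using insert.hyps by simp
  finally show ?case .
qed

lemma Basis_vec_eq_axis: "(Basis :: (real^'n) set) = range (\<lambda>i. axis i 1)"
  by (simp add: Basis_vec_def UNION_singleton_eq_range)

lemma phase_point_measurable:
  "(\<lambda>f. ((\<chi> i. Re (f i)) :: real^'n, (\<chi> i. Im (f i)) :: real^'n))
     \<in> borel_measurable (\<Pi>\<^sub>M i\<in>(UNIV::'n::finite set). (lborel :: complex measure))"
proof -
  let ?M = "\<Pi>\<^sub>M i\<in>(UNIV::'n::finite set). (lborel :: complex measure)"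
  have "(\<lambda>f. (\<chi> i. Re (f i)) :: real^'n) \<in> borel_measurable ?M" "(\<lambda>f. (\<chi> i. Im (f i)) :: real^'n) \<in> borel_measurable ?M"
    by (rule borel_measurable_euclidean_space[THEN iffD2], auto simp: Basis_vec_eq_axis inner_axis)+
  then show ?thesis by (rule borel_measurable_Pair)
qed

text \<open>
  This regroups the momenta and positions into \<open>n\<close> planes.
\<close>
lemma lborel_phase_space:
  "distr (\<Pi>\<^sub>M i\<in>(UNIV::'n::finite set). (lborel :: complex measure)) borel
     (\<lambda>f. ((\<chi> i. Re (f i)), (\<chi> i. Im (f i)))) = (lborel :: ((real^'n) \<times> (real^'n)) measure)"
proof (rule lborel_eqI[symmetric])
  interpret P: product_sigma_finite "\<lambda>i::'n. lborel :: complex measure"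
    by standard
  let ?M = "\<Pi>\<^sub>M i\<in>(UNIV::'n::finite set). (lborel :: complex measure)"
  let ?\<Phi> = "\<lambda>f::'n \<Rightarrow> complex. ((\<chi> i. Re (f i)) :: real^'n, (\<chi> i. Im (f i)) :: real^'n)"
  have m[measurable]: "?\<Phi> \<in> borel_measurable ?M"
    by (rule phase_point_measurable)
  fix l u :: "(real^'n) \<times> (real^'n)"
  assume lu: "\<And>b. b \<in> Basis \<Longrightarrow> l \<bullet> b \<le> u \<bullet> b"
  have le: "fst l $ i \<le> fst u $ i" "snd l $ i \<le> snd u $ i" for i
    using lu[of "(axis i 1, 0)"] lu[of "(0, axis i 1)"]
    by (auto simp: Basis_prod_def Basis_vec_def inner_prod_def inner_axis)
  let ?l = "\<lambda>i. Complex (fst l $ i) (snd l $ i)" and ?u = "\<lambda>i. Complex (fst u $ i) (snd u $ i)"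
  have "emeasure (distr ?M borel ?\<Phi>) (box l u) = emeasure ?M (?\<Phi> -` box l u \<inter> space ?M)"
    by (subst emeasure_distr) auto
  also have "?\<Phi> -` box l u \<inter> space ?M = (\<Pi>\<^sub>E i\<in>UNIV. box (?l i) (?u i))"
  proof -
    have "w \<in> box l u \<longleftrightarrow> (\<forall>i. fst l $ i < fst w $ i \<and> fst w $ i < fst u $ i) \<and>
       (\<forall>i. snd l $ i < snd w $ i \<and> snd w $ i < snd u $ i)" for w
      by (simp add: mem_box Basis_prod_def Basis_vec_eq_axis inner_axis ball_Un inner_prod_def)
    then show ?thesis by (auto simp: in_box_complex_iff space_PiM PiE_iff)
  qed
  also have "emeasure ?M \<dots> = (\<Prod>i\<in>UNIV. emeasure lborel (box (?l i) (?u i)))"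
    by (rule P.emeasure_PiM) auto
  also have "\<dots> = (\<Prod>i\<in>UNIV. ennreal ((fst u $ i - fst l $ i) * (snd u $ i - snd l $ i)))"
    using le by (intro prod.cong refl) (subst emeasure_lborel_box, auto simp: Basis_complex_def)
  also have "\<dots> = ennreal (\<Prod>i\<in>UNIV. (fst u $ i - fst l $ i) * (snd u $ i - snd l $ i))"
    using le by (intro prod_ennreal) auto
  also have "\<dots> = ennreal (prod ((\<bullet>) (u - l)) Basis)"
  proof -
    have "prod ((\<bullet>) (u - l)) Basis
       = prod ((\<bullet>) (u - l)) ((\<lambda>u. (u, 0)) ` Basis) * prod ((\<bullet>) (u - l)) (Pair 0 ` Basis)"
      unfolding Basis_prod_def by (intro prod.union_disjoint) auto
    also have "\<dots> = (\<Prod>b\<in>Basis. fst (u - l) \<bullet> b) * (\<Prod>b\<in>Basis. snd (u - l) \<bullet> b)"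
      by (simp add: prod.reindex inj_on_def inner_prod_def)
    also have "\<dots> = (\<Prod>i\<in>UNIV. fst (u - l) $ i) * (\<Prod>i\<in>UNIV. snd (u - l) $ i)"
      unfolding Basis_vec_eq_axis by (simp add: prod.reindex inj_on_def axis_eq_axis inner_axis)
    finally show ?thesis by (simp add: prod.distrib)
  qed
  finally show "emeasure (distr ?M borel ?\<Phi>) (box l u) = ennreal (prod ((\<bullet>) (u - l)) Basis)" .
qed simp

section \<open>Sums of planar Hamiltonians\<close>

definition plane_proj :: "'n \<Rightarrow> (real^'n) \<times> (real^'n) \<Rightarrow> complex" where
  "plane_proj i w = Complex (fst w $ i) (snd w $ i)"

definition phase_point :: "('n \<Rightarrow> complex) \<Rightarrow> (real^'n) \<times> (real^'n)" where
  "phase_point z = ((\<chi> i. Re (z i)), (\<chi> i. Im (z i)))"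

lemma plane_proj_phase_point [simp]: "plane_proj i (phase_point z) = z i"
  by (simp add: plane_proj_def phase_point_def)

lemma phase_point_scaleR: "phase_point (\<lambda>i. c *\<^sub>R z i) = c *\<^sub>R phase_point z"
  by (simp add: phase_point_def vec_eq_iff prod_eq_iff)

lemma bounded_linear_plane_proj: "bounded_linear (plane_proj i :: (real^'n::finite) \<times> (real^'n) \<Rightarrow> complex)"
proof -
  have "linear (plane_proj i :: (real^'n) \<times> (real^'n) \<Rightarrow> complex)"
    by (intro linearI) (auto simp: plane_proj_def complex_eq_iff)
  then show ?thesis by (simp add: linear_conv_bounded_linear)
qed

lemma phase_point_cont:
  assumes "\<And>i::'n::finite. continuous_on S (z i)"
  shows "continuous_on S (\<lambda>t. phase_point (\<lambda>i. z i t))"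
  unfolding phase_point_def
  by (intro continuous_on_Pair continuous_on_vec_lambda continuous_on_Re continuous_on_Im assms)

lemma phase_point_has_vector_derivative:
  assumes "\<And>i::'n::finite. (z i has_vector_derivative z' i) (at t)"
  shows "((\<lambda>t. phase_point (\<lambda>i. z i t)) has_vector_derivative phase_point z') (at t)"
proof -
  have vec: "((\<lambda>t. (\<chi> i. f i t) :: real^'n) has_vector_derivative (\<chi> i. f' i)) (at t)"
    if "\<And>i. (f i has_vector_derivative f' i) (at t)" for f f'
    unfolding has_vector_derivative_def
    by (rule has_derivative_componentwise_within[THEN iffD2])
      (use that in \<open>auto simp: Basis_vec_eq_axis inner_axis has_vector_derivative_def\<close>)
  show ?thesis unfolding phase_point_def
    by (intro has_vector_derivative_Pair vec bounded_linear.has_vector_derivative[OF bounded_linear_Re assms]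
        bounded_linear.has_vector_derivative[OF bounded_linear_Im assms])
qed

text \<open>
  The minimum of \<open>H\<close> is the sum of the planar minima, so the last assumption places \<open>E\<close> above it.
\<close>
locale uncoupled_hamiltonians =
  fixes k :: "'n::finite \<Rightarrow> complex \<Rightarrow> real" and G and G' and zm and H :: "(real^'n) \<times> (real^'n) \<Rightarrow> real" and E :: real
  assumes planar: "\<And>i. planar_hamiltonian (k i) (G i) (G' i) (zm i)"
    and H_eq: "H w = (\<Sum>i\<in>UNIV. k i (plane_proj i w))"
    and E_gt: "(\<Sum>i\<in>UNIV. k i (zm i)) < E"
begin

abbreviation ar :: "'n \<Rightarrow> real \<Rightarrow> real" where
  "ar i \<equiv> planar_hamiltonian.area (k i)"

abbreviation m :: "'n \<Rightarrow> real" where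
  "m i \<equiv> k i (zm i)"

definition vfield :: "(real^'n) \<times> (real^'n) \<Rightarrow> (real^'n) \<times> (real^'n)" where
  "vfield w = phase_point (\<lambda>i. \<i> * G i (plane_proj i w))"

lemma H_deriv: "(H has_derivative (\<lambda>v. \<Sum>i\<in>UNIV. G i (plane_proj i w) \<bullet> plane_proj i v)) (at w)"
proof -
  have "((\<lambda>w. k i (plane_proj i w)) has_derivative (\<lambda>v. G i (plane_proj i w) \<bullet> plane_proj i v)) (at w)" for i
    by (rule has_derivative_compose[OF bounded_linear_imp_has_derivative[OF bounded_linear_plane_proj] planar_hamiltonian.k_deriv[OF planar]])
  then have "((\<lambda>w. \<Sum>i\<in>UNIV. k i (plane_proj i w)) has_derivative (\<lambda>v. \<Sum>i\<in>UNIV. G i (plane_proj i w) \<bullet> plane_proj i v)) (at w)"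
    by (intro has_derivative_sum)
  then show ?thesis by (simp only: H_eq[symmetric])
qed

lemma H_frechet: "frechet_derivative H (at w) = (\<lambda>v. \<Sum>i\<in>UNIV. G i (plane_proj i w) \<bullet> plane_proj i v)"
  by (rule frechet_derivative_at[OF H_deriv, symmetric])

lemma hamiltonian_field_eq: "hamiltonian_field H w = vfield w"
proof -
  have "plane_proj j (axis i 1, 0) = (if j = i then 1 else 0)" "plane_proj j (0, axis i 1) = (if j = i then \<i> else 0)"
    for i j :: 'n by (auto simp: plane_proj_def axis_def complex_eq_iff)
  moreover have "(\<Sum>j\<in>UNIV. G j (plane_proj j w) \<bullet> (if j = i then a else 0)) = G i (plane_proj i w) \<bullet> a" for i a
    by (simp add: if_distrib[of "\<lambda>x. _ \<bullet> x"] cong: if_cong)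
  ultimately have "frechet_derivative H (at w) (axis i 1, 0) = Re (G i (plane_proj i w))"
    "frechet_derivative H (at w) (0, axis i 1) = Im (G i (plane_proj i w))" for i
    unfolding H_frechet by (simp_all only:) (simp_all add: inner_complex_def)
  then show ?thesis by (simp add: hamiltonian_field_def vfield_def phase_point_def)
qed

lemma symplectic_vfield: "symplectic_form (vfield w) v = - frechet_derivative H (at w) v"
  unfolding H_frechet symplectic_form_def vfield_def phase_point_def
  unfolding sum_negf[symmetric]
  by (intro sum.cong refl) (simp add: plane_proj_def inner_complex_def algebra_simps)

lemma vfield_tangent: "frechet_derivative H (at w) (vfield w) = 0"
  unfolding H_frechet vfield_def by (simp add: planar_hamiltonian.inner_ii_self[OF planar])

lemma symplectic_scaleR: "symplectic_form (c *\<^sub>R v) u = c * symplectic_form v u"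
  by (simp add: symplectic_form_def sum_distrib_left algebra_simps)

lemma characteristic_vfield: "c *\<^sub>R vfield w \<in> characteristic_line H w"
proof -
  have "linear (frechet_derivative H (at w))"
    using H_deriv[of w] by (simp add: H_frechet has_derivative_linear)
  then show ?thesis
    by (simp add: characteristic_line_def level_tangent_def linear_scale vfield_tangent symplectic_scaleR symplectic_vfield)
qed

lemma vfield_cont: "continuous_on S vfield"
  unfolding vfield_def
  by (intro phase_point_cont continuous_intros continuous_on_compose2[OF planar_hamiltonian.G_cont[OF planar, of UNIV]]
      linear_continuous_on bounded_linear_plane_proj) auto

text \<open>
  The velocity is a positive multiple \<open>c t\<close> of the Hamiltonian field with one continuous factor for all
  components, so each component is a reparametrized planar orbit.
\<close>
lemma action_nonneg:
  assumes "closed_characteristic H E \<gamma>"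
  shows "action \<gamma> \<ge> 0"
proof -
  note cc = assms[unfolded closed_characteristic_def C1_differentiable_on_eq]
  define D where "D t = vector_derivative \<gamma> (at t)" for t
  have d: "(\<gamma> has_vector_derivative D t) (at t)" if "t \<in> {0..1}" for t
    using cc that unfolding D_def by (simp add: vector_derivative_works)
  have cD: "continuous_on {0..1} D" using cc unfolding D_def by blast
  have c\<gamma>: "continuous_on {0..1} \<gamma>"
    by (rule continuous_on_vector_derivative) (rule has_vector_derivative_at_within[OF d])
  have Dc: "D t \<noteq> 0 \<and> (\<exists>c>0. D t = c *\<^sub>R vfield (\<gamma> t))" if "t \<in> {0..1}" for t
    using cc that unfolding D_def hamiltonian_field_eq by blast
  have nz: "vfield (\<gamma> t) \<noteq> 0" if "t \<in> {0..1}" for t using Dc[OF that] by force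
  define c where "c t = norm (D t) / norm (vfield (\<gamma> t))" for t
  have D_eq: "D t = c t *\<^sub>R vfield (\<gamma> t)" and c_pos: "c t > 0" if t: "t \<in> {0..1}" for t
    using Dc[OF t] nz[OF t] by (auto simp: c_def)
  have cc': "continuous_on {0..1} c" unfolding c_def
    by (intro continuous_intros cD continuous_on_compose2[OF vfield_cont[of UNIV] c\<gamma>]) (use nz in auto)
  define \<zeta> where "\<zeta> i t = plane_proj i (\<gamma> t)" for i t
  have D_comp: "plane_proj i (D t) = c t *\<^sub>R (\<i> * G i (\<zeta> i t))" if "t \<in> {0..1}" for i t
    unfolding D_eq[OF that] vfield_def \<zeta>_def phase_point_scaleR[symmetric] by simp
  have nn: "integral {0..1} (\<lambda>t. Re (\<zeta> i t) * Im (c t *\<^sub>R (\<i> * G i (\<zeta> i t)))) \<ge> 0" for i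
  proof (rule planar_hamiltonian.reparametrized_action_nonneg[OF planar _ cc' c_pos])
    fix t :: real assume t: "t \<in> {0..1}"
    show "(\<zeta> i has_vector_derivative c t *\<^sub>R (\<i> * G i (\<zeta> i t))) (at t within {0..1})"
      unfolding D_comp[OF t, symmetric] unfolding \<zeta>_def
      by (rule has_vector_derivative_at_within[OF bounded_linear.has_vector_derivative[OF bounded_linear_plane_proj d[OF t]]])
  next
    show "\<zeta> i 1 = \<zeta> i 0" using cc by (simp add: \<zeta>_def pathfinish_def pathstart_def)
  qed
  have "action \<gamma> = integral {0..1} (\<lambda>t. \<Sum>i\<in>UNIV. Re (\<zeta> i t) * Im (plane_proj i (D t)))"
    by (simp add: action_def D_def \<zeta>_def plane_proj_def)
  also have "\<dots> = (\<Sum>i\<in>UNIV. integral {0..1} (\<lambda>t. Re (\<zeta> i t) * Im (plane_proj i (D t))))"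
  proof (rule Henstock_Kurzweil_Integration.integral_sum)
    show "(\<lambda>t. Re (\<zeta> i t) * Im (plane_proj i (D t))) integrable_on {0..1}" for i
      unfolding \<zeta>_def
      by (intro integrable_continuous_interval continuous_on_mult continuous_on_Re continuous_on_Im
          bounded_linear.continuous_on[OF bounded_linear_plane_proj cD]
          bounded_linear.continuous_on[OF bounded_linear_plane_proj c\<gamma>])
  qed simp
  also have "\<dots> = (\<Sum>i\<in>UNIV. integral {0..1} (\<lambda>t. Re (\<zeta> i t) * Im (c t *\<^sub>R (\<i> * G i (\<zeta> i t)))))"
    by (intro sum.cong refl integral_cong) (simp only: D_comp)
  also have "\<dots> \<ge> 0" by (intro sum_nonneg nn)
  finally show ?thesis .
qed

definition energies :: "(real^'n) set" where
  "energies = {e. (\<forall>i. m i \<le> e $ i) \<and> (\<Sum>i\<in>UNIV. e $ i) = E}"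

lemma energies_compact: "compact energies"
proof -
  let ?d = "E - (\<Sum>i\<in>UNIV. m i)"
  have "energies = cbox (\<chi> i. m i) (\<chi> i. m i + ?d) \<inter> {e::real^'n. (\<Sum>i\<in>UNIV. e $ i) = E}"
  proof -
    have "e $ i \<le> m i + ?d" if "\<forall>i. m i \<le> e $ i" "(\<Sum>i\<in>UNIV. e $ i) = E" for e :: "real^'n" and i
    proof -
      have "e $ i - m i \<le> (\<Sum>i\<in>UNIV. e $ i - m i)"
        using that by (intro member_le_sum) auto
      then show ?thesis using that by (simp add: sum_subtractf)
    qed
    then show ?thesis by (auto simp: energies_def mem_box_cart)
  qed
  moreover have "closed {e::real^'n. (\<Sum>i\<in>UNIV. e $ i) = E}"
    by (intro closed_Collect_eq continuous_intros)
  ultimately show ?thesis by (simp add: compact_Int_closed)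
qed

lemma energies_nonempty: "energies \<noteq> {}"
proof -
  let ?d = "E - (\<Sum>i\<in>UNIV. m i)"
  have "(\<chi> i. m i + ?d / real CARD('n)) \<in> energies"
    using E_gt by (simp add: energies_def sum.distrib)
  then show ?thesis by blast
qed

lemma minimal_energies:
  obtains e where "e \<in> energies" "\<And>e'. e' \<in> energies \<Longrightarrow> (\<Sum>i\<in>UNIV. ar i (e $ i)) \<le> (\<Sum>i\<in>UNIV. ar i (e' $ i))"
proof -
  have "continuous_on energies (\<lambda>e::real^'n. \<Sum>i\<in>UNIV. ar i (e $ i))"
    by (intro continuous_on_sum continuous_on_compose2[OF planar_hamiltonian.area_cont_UNIV[OF planar]] continuous_intros) auto
  from continuous_attains_inf[OF energies_compact energies_nonempty this] show thesis using that by blast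
qed

text \<open>
  If \<open>H w > E\<close>, shrinking the energies of the components proportionally towards their minima reaches a
  distribution of \<open>E\<close>, and strictly decreases the sum of the areas below \<open>c\<close>.
\<close>
lemma sublevel_inclusion:
  assumes min: "\<And>e'. e' \<in> energies \<Longrightarrow> c \<le> (\<Sum>i\<in>UNIV. ar i (e' $ i))"
    and w: "(\<Sum>i\<in>UNIV. ar i (k i (plane_proj i w))) \<le> c"
  shows "H w \<le> E"
proof (rule ccontr)
  assume "\<not> H w \<le> E"
  define a where "a i = k i (plane_proj i w)" for i
  have am: "m i \<le> a i" for i unfolding a_def by (rule planar_hamiltonian.min[OF planar])
  have aE: "(\<Sum>i\<in>UNIV. a i) > E" using \<open>\<not> H w \<le> E\<close> by (simp add: H_eq a_def)
  define s where "s = (E - (\<Sum>i\<in>UNIV. m i)) / ((\<Sum>i\<in>UNIV. a i) - (\<Sum>i\<in>UNIV. m i))"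
  have s: "0 < s" "s < 1" using aE E_gt by (auto simp: s_def)
  define b where "b i = m i + s * (a i - m i)" for i
  have bm: "m i \<le> b i" for i using s am by (simp add: b_def)
  have ba: "b i \<le> a i" for i using s am[of i] mult_right_mono[of s 1 "a i - m i"] by (simp add: b_def)
  have "(\<Sum>i\<in>UNIV. b i) = (\<Sum>i\<in>UNIV. m i) + s * ((\<Sum>i\<in>UNIV. a i) - (\<Sum>i\<in>UNIV. m i))"
    by (simp add: b_def sum.distrib sum_distrib_left[symmetric] sum_subtractf)
  also have "\<dots> = E" using aE E_gt by (simp add: s_def)
  finally have "(\<chi> i. b i) \<in> energies" using bm by (simp add: energies_def)
  then have "c \<le> (\<Sum>i\<in>UNIV. ar i (b i))" using min[of "\<chi> i. b i"] by simp
  also have "\<dots> < (\<Sum>i\<in>UNIV. ar i (a i))"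
  proof (rule sum_strict_mono_ex1)
    show "\<forall>i\<in>UNIV. ar i (b i) \<le> ar i (a i)"
      using ba monoD[OF planar_hamiltonian.area_mono[OF planar]] by blast
    have "\<exists>i. a i > m i"
    proof (rule ccontr)
      assume "\<not> (\<exists>i. a i > m i)"
      then have "(\<Sum>i\<in>UNIV. a i) \<le> (\<Sum>i\<in>UNIV. m i)" by (intro sum_mono) (simp add: not_less)
      then show False using aE E_gt by simp
    qed
    then obtain i where i: "a i > m i" ..
    then have "s * (a i - m i) < 1 * (a i - m i)" using s by (intro mult_strict_right_mono) auto
    then have "b i < a i" by (simp add: b_def)
    then show "\<exists>i\<in>UNIV. ar i (b i) < ar i (a i)"
      using planar_hamiltonian.area_strict_mono[OF planar bm] by blast
  qed simp
  finally show False using w by (simp add: a_def)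
qed

text \<open>
  Lagrange's condition: moving energy from component \<open>j\<close> to component \<open>i\<close> is possible in both
  directions and cannot decrease the sum of the areas.
\<close>
lemma equal_periods:
  assumes e: "e \<in> energies" and min: "\<And>e'. e' \<in> energies \<Longrightarrow> (\<Sum>i\<in>UNIV. ar i (e $ i)) \<le> (\<Sum>i\<in>UNIV. ar i (e' $ i))"
    and i: "m i < e $ i" "(ar i has_real_derivative T) (at (e $ i))"
    and j: "m j < e $ j" "(ar j has_real_derivative T') (at (e $ j))"
  shows "T = T'"
proof (cases "i = j")
  case True
  then show ?thesis using i j DERIV_unique by blast
next
  case False
  define \<phi> where "\<phi> t = ar i (e $ i + t) + ar j (e $ j - t)" for t
  have "(\<phi> has_real_derivative T * 1 + T' * (-1)) (at 0)"
    unfolding \<phi>_def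
    by (intro DERIV_add DERIV_chain2[of "ar i"] DERIV_chain2[of "ar j"])
      (use i j in \<open>auto intro!: derivative_eq_intros\<close>)
  moreover define d where "d = min (e $ i - m i) (e $ j - m j)"
  have "d > 0" using i j by (simp add: d_def)
  moreover have "\<forall>t. \<bar>0 - t\<bar> < d \<longrightarrow> \<phi> 0 \<le> \<phi> t"
  proof (intro allI impI)
    fix t assume t: "\<bar>0 - t\<bar> < d"
    define e' :: "real^'n" where "e' = (\<chi> l. e $ l + (if l = i then t else 0) - (if l = j then t else 0))"
    have "(\<Sum>l\<in>UNIV. e' $ l) = E"
      using e by (simp add: e'_def energies_def sum.distrib sum_subtractf)
    moreover have "m l \<le> e' $ l" for l
      using t e False by (auto simp: e'_def energies_def d_def abs_less_iff)
    ultimately have "e' \<in> energies" by (simp add: energies_def)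
    then have "(\<Sum>l\<in>UNIV. ar l (e $ l)) \<le> (\<Sum>l\<in>UNIV. ar l (e' $ l))" by (rule min)
    also have "\<dots> = (\<Sum>l\<in>UNIV. ar l (e $ l) + (if l = i then ar i (e $ i + t) - ar i (e $ i) else 0)
        + (if l = j then ar j (e $ j - t) - ar j (e $ j) else 0))"
      using False by (intro sum.cong) (auto simp: e'_def)
    also have "\<dots> = (\<Sum>l\<in>UNIV. ar l (e $ l)) + (ar i (e $ i + t) - ar i (e $ i)) + (ar j (e $ j - t) - ar j (e $ j))"
      by (simp add: sum.distrib)
    finally show "\<phi> 0 \<le> \<phi> t" by (simp add: \<phi>_def)
  qed
  ultimately have "T * 1 + T' * (-1) = 0" by (rule DERIV_local_min)
  then show ?thesis by simp
qed

end

lemma ereal_power_mono_nonneg: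
  fixes a b :: ereal
  assumes "0 \<le> a" "a \<le> b"
  shows "a ^ n \<le> b ^ n"
proof (induction n)
  case (Suc n)
  have "a ^ Suc n \<le> a * b ^ n" using Suc assms(1) by (simp add: ereal_mult_left_mono)
  also have "\<dots> \<le> b ^ Suc n" using assms by (simp add: ereal_mult_right_mono)
  finally show ?case .
qed simp

context uncoupled_hamiltonians
begin

text \<open>
  Components at their minimum stay at rest; all others move on periodic orbits whose period is the
  derivative of the area, and these periods agree by \<open>equal_periods\<close>. So the combined motion closes up after
  one common period.
\<close>
lemma closed_characteristic_of_minimal_energies:
  assumes e: "e \<in> energies" and min: "\<And>e'. e' \<in> energies \<Longrightarrow> (\<Sum>i\<in>UNIV. ar i (e $ i)) \<le> (\<Sum>i\<in>UNIV. ar i (e' $ i))"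
  obtains \<gamma> where "closed_characteristic H E \<gamma>" "action \<gamma> = (\<Sum>i\<in>UNIV. ar i (e $ i))"
proof -
  have em: "m i \<le> e $ i" for i using e by (simp add: energies_def)
  have eE: "(\<Sum>i\<in>UNIV. e $ i) = E" using e by (simp add: energies_def)
  have "\<exists>i. m i < e $ i"
  proof (rule ccontr)
    assume "\<not> (\<exists>i. m i < e $ i)"
    then have "(\<Sum>i\<in>UNIV. e $ i) \<le> (\<Sum>i\<in>UNIV. m i)" by (intro sum_mono) (simp add: not_less)
    then show False using eE E_gt by simp
  qed
  then obtain i0 where i0: "m i0 < e $ i0" ..
  obtain x0 T where o0: "planar_hamiltonian.periodic_orbit (k i0) (G i0) (e $ i0) x0 T"
    using planar_hamiltonian.level_orbit[OF planar i0] .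
  have dT: "(ar i0 has_real_derivative T) (at (e $ i0))"
    by (rule planar_hamiltonian.area_derivative(2)[OF planar o0 i0])
  have T: "T > 0" using o0 by (simp add: planar_hamiltonian.periodic_orbit_def[OF planar])
  define component where "component i y \<longleftrightarrow>
      (\<forall>t. (y has_vector_derivative \<i> * G i (y t)) (at t)) \<and> y T = y 0 \<and> (\<forall>t. k i (y t) = e $ i) \<and>
      ar i (e $ i) = integral {0..1} (\<lambda>t. Re (y (T * t)) * Im (T *\<^sub>R (\<i> * G i (y (T * t)))))" for i y
  have "\<exists>y. component i y" for i
  proof (cases "m i < e $ i")
    case True
    obtain x T' where o: "planar_hamiltonian.periodic_orbit (k i) (G i) (e $ i) x T'"
      using planar_hamiltonian.level_orbit[OF planar True] .
    have "T' = T"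
      by (rule equal_periods[OF e min True planar_hamiltonian.area_derivative(2)[OF planar o True] i0 dT])
    note o' = o[unfolded \<open>T' = T\<close>]
    note od = o'[unfolded planar_hamiltonian.periodic_orbit_def[OF planar] planar_hamiltonian.solution_def[OF planar]]
    show ?thesis unfolding component_def
    proof (intro exI[of _ x] conjI)
      have "x (0 + T) = x 0" using od by blast
      then show "x T = x 0" by simp
      show "\<forall>t. (x has_vector_derivative \<i> * G i (x t)) (at t)" using od by blast
      show "\<forall>t. k i (x t) = e $ i" using od by blast
      show "ar i (e $ i) = integral {0..1} (\<lambda>t. Re (x (T * t)) * Im (T *\<^sub>R (\<i> * G i (x (T * t)))))"
        by (rule planar_hamiltonian.area_derivative(1)[OF planar o' True])
    qed
  next
    case False
    then have ei: "e $ i = m i" using em[of i] by simp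
    have "G i (zm i) = 0" by (rule planar_hamiltonian.G_zm[OF planar])
    then show ?thesis unfolding component_def
      by (intro exI[of _ "\<lambda>_. zm i"]) (simp add: ei planar_hamiltonian.area_min[OF planar])
  qed
  then obtain y where y: "\<And>i. component i (y i)" by metis
  have y': "(y i has_vector_derivative \<i> * G i (y i t)) (at t)" and yT: "y i T = y i 0"
    and ky: "k i (y i t) = e $ i"
    and ya: "ar i (e $ i) = integral {0..1} (\<lambda>t. Re (y i (T * t)) * Im (T *\<^sub>R (\<i> * G i (y i (T * t)))))" for i t
    using y[of i] unfolding component_def by blast+
  have yc: "continuous_on S (y i)" for S i
    by (rule continuous_on_vector_derivative) (rule has_vector_derivative_at_within[OF y'])
  have yTc: "continuous_on S (\<lambda>t. y i (T * t))" for S i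
    by (rule continuous_on_compose2[OF yc[of UNIV]]) (auto intro: continuous_intros)
  define \<gamma> where "\<gamma> t = phase_point (\<lambda>i. y i (T * t))" for t
  have proj: "plane_proj i (\<gamma> t) = y i (T * t)" for i t by (simp add: \<gamma>_def)
  have "((\<lambda>t. phase_point (\<lambda>i. y i (T * t))) has_vector_derivative phase_point (\<lambda>i. T *\<^sub>R (\<i> * G i (y i (T * t))))) (at t)" for t
  proof (rule phase_point_has_vector_derivative)
    fix i
    have "((\<lambda>s. T * s) has_vector_derivative T) (at t)" by (auto intro!: derivative_eq_intros)
    from vector_diff_chain_at[OF this y'] show "((\<lambda>t. y i (T * t)) has_vector_derivative T *\<^sub>R (\<i> * G i (y i (T * t)))) (at t)"
      by (simp add: o_def)
  qed
  then have \<gamma>': "(\<gamma> has_vector_derivative T *\<^sub>R vfield (\<gamma> t)) (at t)" for t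
    unfolding phase_point_scaleR vfield_def proj unfolding \<gamma>_def[abs_def] .
  have vd: "vector_derivative \<gamma> (at t) = T *\<^sub>R vfield (\<gamma> t)" for t
    by (rule vector_derivative_at[OF \<gamma>'])
  have c\<gamma>: "continuous_on S \<gamma>" for S
    by (rule continuous_on_vector_derivative) (rule has_vector_derivative_at_within[OF \<gamma>'])
  have H\<gamma>: "H (\<gamma> t) = E" for t by (simp add: H_eq proj ky eE)
  have nz: "vfield (\<gamma> t) \<noteq> 0" for t
  proof
    assume "vfield (\<gamma> t) = 0"
    then have "plane_proj i0 (vfield (\<gamma> t)) = plane_proj i0 0" by simp
    then have "G i0 (y i0 (T * t)) = 0" by (simp add: vfield_def proj) (simp add: plane_proj_def complex_eq_iff)
    then show False using planar_hamiltonian.G_nz[OF planar, of i0 "y i0 (T * t)"] ky i0 by simp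
  qed
  have "closed_characteristic H E \<gamma>"
    unfolding closed_characteristic_def
  proof (intro conjI ballI)
    show "\<gamma> C1_differentiable_on {0..1}"
      unfolding C1_differentiable_on_def
      by (intro exI[of _ "\<lambda>t. T *\<^sub>R vfield (\<gamma> t)"] conjI ballI \<gamma>' continuous_intros
          continuous_on_compose2[OF vfield_cont[of UNIV] c\<gamma>]) auto
    show "pathfinish \<gamma> = pathstart \<gamma>" using yT by (simp add: pathfinish_def pathstart_def \<gamma>_def)
    show "path_image \<gamma> \<subseteq> {z. H z = E}" using H\<gamma> by (auto simp: path_image_def)
    fix t :: real
    show "vector_derivative \<gamma> (at t) \<noteq> 0" using nz T by (simp add: vd)
    show "vector_derivative \<gamma> (at t) \<in> characteristic_line H (\<gamma> t)" unfolding vd by (rule characteristic_vfield)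
    show "\<exists>c>0. vector_derivative \<gamma> (at t) = c *\<^sub>R hamiltonian_field H (\<gamma> t)"
      unfolding vd hamiltonian_field_eq using T by blast
  qed
  moreover have "action \<gamma> = (\<Sum>i\<in>UNIV. ar i (e $ i))"
  proof -
    have "fst (\<gamma> t) $ i * snd (vector_derivative \<gamma> (at t)) $ i = Re (y i (T * t)) * Im (T *\<^sub>R (\<i> * G i (y i (T * t))))" for i t
      unfolding vd vfield_def proj by (simp add: phase_point_def \<gamma>_def)
    then have "action \<gamma> = integral {0..1} (\<lambda>t. \<Sum>i\<in>UNIV. Re (y i (T * t)) * Im (T *\<^sub>R (\<i> * G i (y i (T * t)))))"
      unfolding action_def by simp
    also have "\<dots> = (\<Sum>i\<in>UNIV. integral {0..1} (\<lambda>t. Re (y i (T * t)) * Im (T *\<^sub>R (\<i> * G i (y i (T * t))))))"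
    proof (rule Henstock_Kurzweil_Integration.integral_sum)
      show "(\<lambda>t. Re (y i (T * t)) * Im (T *\<^sub>R (\<i> * G i (y i (T * t))))) integrable_on {0..1}" for i
        by (intro integrable_continuous_interval continuous_on_mult continuous_on_Re continuous_on_Im
            continuous_on_scaleR continuous_on_const yTc
            continuous_on_compose2[OF planar_hamiltonian.G_cont[OF planar, of UNIV] yTc]) auto
    qed simp
    also have "\<dots> = (\<Sum>i\<in>UNIV. ar i (e $ i))" by (simp only: ya[symmetric])
    finally show ?thesis .
  qed
  ultimately show thesis by (rule that)
qed

text \<open>
  In the area coordinates of the components this set is a simplex.
\<close>
lemma volume_area_simplex:
  assumes "c \<ge> 0"
  shows "emeasure lborel {w. (\<Sum>i\<in>UNIV. ar i (k i (plane_proj i w))) \<le> c} = ennreal (c ^ CARD('n) / fact CARD('n))"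
proof -
  let ?g = "\<lambda>i z. ar i (k i z)"
  let ?M = "\<Pi>\<^sub>M i\<in>(UNIV::'n set). (lborel :: complex measure)"
  let ?S = "{w. (\<Sum>i\<in>UNIV. ?g i (plane_proj i w)) \<le> c}"
  have gc: "continuous_on S (?g i)" for S i
    by (rule continuous_on_compose2[OF planar_hamiltonian.area_cont_UNIV[OF planar] planar_hamiltonian.k_cont[OF planar]]) auto
  have "closed ?S"
    by (intro closed_Collect_le continuous_on_sum continuous_on_const
        continuous_on_compose2[OF gc[of UNIV] linear_continuous_on[OF bounded_linear_plane_proj]]) auto
  then have S: "?S \<in> sets borel" by simp
  have \<Phi>: "phase_point \<in> borel_measurable ?M"
    unfolding phase_point_def[abs_def] by (rule phase_point_measurable)
  have "emeasure lborel ?S = emeasure (distr ?M borel phase_point) ?S"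
    using lborel_phase_space[where 'n = 'n] by (simp add: phase_point_def[abs_def])
  also have "\<dots> = emeasure ?M (phase_point -` ?S \<inter> space ?M)"
    by (rule emeasure_distr[OF \<Phi> S])
  also have "phase_point -` ?S \<inter> space ?M = {f \<in> space ?M. (\<Sum>i\<in>UNIV. ?g i (f i)) \<le> c}"
    by auto
  also have "emeasure ?M \<dots> = ennreal (c ^ CARD('n) / fact CARD('n))"
    by (rule emeasure_sum_sublevel)
      (auto intro!: borel_measurable_continuous_onI gc assms planar_hamiltonian.distr_area[OF planar]
        planar_hamiltonian.area_nonneg[OF planar])
  finally show ?thesis .
qed

text \<open>
  The capacity is at most the action \<open>c\<close> of the closed characteristic that minimises the total area, and
  \<open>X\<close> contains the simplex of size \<open>c\<close> in area coordinates.
\<close>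
theorem viterbo_inequality:
  "c_EHZ H E ^ CARD('n) / ereal (fact CARD('n)) \<le> enn2ereal (emeasure lebesgue {w. H w \<le> E})"
proof -
  obtain e where e: "e \<in> energies" and min: "\<And>e'. e' \<in> energies \<Longrightarrow> (\<Sum>i\<in>UNIV. ar i (e $ i)) \<le> (\<Sum>i\<in>UNIV. ar i (e' $ i))"
    using minimal_energies by blast
  define c where "c = (\<Sum>i\<in>UNIV. ar i (e $ i))"
  have c: "c \<ge> 0" unfolding c_def by (intro sum_nonneg planar_hamiltonian.area_nonneg[OF planar])
  obtain \<gamma> where \<gamma>: "closed_characteristic H E \<gamma>" "action \<gamma> = c"
    using closed_characteristic_of_minimal_energies[OF e min] unfolding c_def by blast
  have nonneg: "0 \<le> c_EHZ H E"
    unfolding c_EHZ_def by (rule INF_greatest) (simp add: action_nonneg)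
  have "c_EHZ H E \<le> ereal c"
    unfolding c_EHZ_def using \<gamma> by (intro INF_lower2[of \<gamma>]) auto
  then have "c_EHZ H E ^ CARD('n) \<le> ereal c ^ CARD('n)"
    using nonneg by (intro ereal_power_mono_nonneg)
  then have "c_EHZ H E ^ CARD('n) / ereal (fact CARD('n)) \<le> ereal c ^ CARD('n) / ereal (fact CARD('n))"
    by (intro ereal_divide_right_mono) auto
  also have "\<dots> = ereal (c ^ CARD('n) / fact CARD('n))" by simp
  also have "\<dots> = enn2ereal (ennreal (c ^ CARD('n) / fact CARD('n)))" using c by (simp add: enn2ereal_ennreal)
  also have "\<dots> = enn2ereal (emeasure lborel {w. (\<Sum>i\<in>UNIV. ar i (k i (plane_proj i w))) \<le> c})"
    by (simp only: volume_area_simplex[OF c])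
  also have "\<dots> \<le> enn2ereal (emeasure lborel {w. H w \<le> E})"
  proof -
    have "continuous_on UNIV H" using H_deriv by (meson continuous_at_imp_continuous_on has_derivative_continuous)
    then have "closed {w. H w \<le> E}" by (intro closed_Collect_le continuous_on_const)
    moreover have "{w. (\<Sum>i\<in>UNIV. ar i (k i (plane_proj i w))) \<le> c} \<subseteq> {w. H w \<le> E}"
      using sublevel_inclusion[of c] min unfolding c_def by blast
    ultimately have "emeasure lborel {w. (\<Sum>i\<in>UNIV. ar i (k i (plane_proj i w))) \<le> c} \<le> emeasure lborel {w. H w \<le> E}"
      by (intro emeasure_mono) auto
    then show ?thesis by (simp add: less_eq_ennreal.rep_eq)
  qed
  also have "emeasure lborel {w. H w \<le> E} = emeasure lebesgue {w. H w \<le> E}"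
  proof -
    have "continuous_on UNIV H" using H_deriv by (meson continuous_at_imp_continuous_on has_derivative_continuous)
    then have "closed {w. H w \<le> E}" by (intro closed_Collect_le continuous_on_const)
    then show ?thesis by simp
  qed
  finally show ?thesis .
qed

end

section \<open>Smooth Hamiltonians\<close>

definition planar_grad :: "(real \<times> real \<Rightarrow> real) \<Rightarrow> complex \<Rightarrow> complex" where
  "planar_grad f z = Complex (frechet_derivative f (at (Re z, Im z)) (1, 0)) (frechet_derivative f (at (Re z, Im z)) (0, 1))"

definition planar_hess :: "(real \<times> real \<Rightarrow> real) \<Rightarrow> complex \<Rightarrow> complex \<Rightarrow> complex" where
  "planar_hess f z v = Complex
     (frechet_derivative (\<lambda>w. frechet_derivative f (at w) (1, 0)) (at (Re z, Im z)) (Re v, Im v))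
     (frechet_derivative (\<lambda>w. frechet_derivative f (at w) (0, 1)) (at (Re z, Im z)) (Re v, Im v))"

lemma planar_hamiltonian_of_smooth:
  assumes smooth: "smooth f" and proper: "proper_function f"
    and unique: "\<exists>!z. minimum_point f z" and crit: "\<And>z. critical_point f z \<Longrightarrow> minimum_point f z"
    and z0: "minimum_point f (Re z0, Im z0)"
  shows "planar_hamiltonian (\<lambda>z. f (Re z, Im z)) (planar_grad f) (planar_hess f) z0"
proof
  have Ck2: "Ck (Suc (Suc 0)) f" using smooth unfolding smooth_def by blast
  have "f differentiable (at w)" for w using Ck2 by (simp del: split_paired_All)
  then have d1: "(f has_derivative frechet_derivative f (at w)) (at w)" for w
    by (simp add: frechet_derivative_works[symmetric])
  have "(\<lambda>w. frechet_derivative f (at w) v) differentiable (at w)" for v w using Ck2 by (simp del: split_paired_All)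
  then have d2: "((\<lambda>w. frechet_derivative f (at w) v) has_derivative frechet_derivative (\<lambda>w. frechet_derivative f (at w) v) (at w)) (at w)" for v w
    by (simp add: frechet_derivative_works[symmetric])
  have c2: "continuous_on UNIV (\<lambda>w. frechet_derivative (\<lambda>w. frechet_derivative f (at w) v) (at w) u)" for v u
    using Ck2 by (simp del: split_paired_All)
  let ?\<rho> = "\<lambda>z. (Re z, Im z)"
  have \<rho>: "(?\<rho> has_derivative ?\<rho>) (at z)" for z
    by (intro bounded_linear_imp_has_derivative bounded_linear_Pair bounded_linear_Re bounded_linear_Im)
  have \<rho>c: "continuous_on S ?\<rho>" for S by (intro continuous_intros)
  have grad: "frechet_derivative f (at (?\<rho> z)) (?\<rho> v) = planar_grad f z \<bullet> v" for z v
  proof -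
    interpret bounded_linear "frechet_derivative f (at (?\<rho> z))" using d1 by (rule has_derivative_bounded_linear)
    have "?\<rho> v = Re v *\<^sub>R (1, 0) + Im v *\<^sub>R (0, 1)" by simp
    then have "frechet_derivative f (at (?\<rho> z)) (?\<rho> v) = Re v *\<^sub>R frechet_derivative f (at (?\<rho> z)) (1, 0) + Im v *\<^sub>R frechet_derivative f (at (?\<rho> z)) (0, 1)"
      by (simp only: add scaleR)
    then show ?thesis by (simp add: planar_grad_def inner_complex_def)
  qed
  fix z v
  show "((\<lambda>z. f (?\<rho> z)) has_derivative (\<lambda>v. planar_grad f z \<bullet> v)) (at z)"
    using has_derivative_compose[OF \<rho> d1] by (simp add: grad)
  show "(planar_grad f has_derivative planar_hess f z) (at z)"
  proof -
    have "((\<lambda>z. frechet_derivative f (at (?\<rho> z)) u) has_derivative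
        (\<lambda>v. frechet_derivative (\<lambda>w. frechet_derivative f (at w) u) (at (?\<rho> z)) (?\<rho> v))) (at z)" for u
      using has_derivative_compose[OF \<rho> d2] by simp
    then show ?thesis unfolding planar_grad_def[abs_def] planar_hess_def[abs_def] Complex_eq
      by (intro derivative_eq_intros refl) (auto simp: fun_eq_iff)
  qed
  show "continuous_on UNIV (\<lambda>z. planar_hess f z v)"
    unfolding planar_hess_def Complex_eq
    by (intro continuous_intros continuous_on_compose2[OF c2 \<rho>c]) auto
  show "LIM z at_infinity. f (?\<rho> z) :> at_top"
  proof (rule filterlim_compose[OF proper[unfolded proper_function_def]])
    have "filterlim (\<lambda>z. norm (?\<rho> z)) at_top at_infinity"
      using filterlim_norm_at_top by (simp add: norm_Pair cmod_def[symmetric])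
    then show "filterlim ?\<rho> at_infinity at_infinity"
      by (simp add: filterlim_at_infinity_conv_norm_at_top)
  qed
  show "f (?\<rho> z0) \<le> f (?\<rho> z)" using z0 by (simp add: minimum_point_def)
  assume "planar_grad f z = 0"
  then have "frechet_derivative f (at (?\<rho> z)) w = 0" for w
    using grad[of z "Complex (fst w) (snd w)"] by simp
  then have "critical_point f (?\<rho> z)" by (simp add: critical_point_def fun_eq_iff)
  then have "minimum_point f (?\<rho> z)" by (rule crit)
  then have "?\<rho> z = ?\<rho> z0" using unique z0 by blast
  then show "z = z0" by (simp add: complex_eq_iff)
qed

theorem theorem3p1:
  fixes h :: "'n::finite \<Rightarrow> real \<times> real \<Rightarrow> real" and E :: real
  assumes "\<And>i. smooth (h i)"
    and "\<And>i z. 0 \<le> h i z"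
    and "\<And>i. proper_function (h i)"
    and "\<And>i. \<exists>!z. minimum_point (h i) z"
    and "\<And>i z. critical_point (h i) z \<Longrightarrow> minimum_point (h i) z"
    and "(INF z. split_hamiltonian h z) < E"
  shows "enn2ereal (emeasure lebesgue {z. split_hamiltonian h z \<le> E})
           \<ge> c_EHZ (split_hamiltonian h) E ^ CARD('n) / ereal (fact CARD('n))"
proof -
  have "\<exists>z. minimum_point (h i) (Re z, Im z)" for i
  proof -
    obtain z where "minimum_point (h i) z" using assms(4) by blast
    then show ?thesis by (intro exI[of _ "Complex (fst z) (snd z)"]) simp
  qed
  then obtain zm where zm: "\<And>i. minimum_point (h i) (Re (zm i), Im (zm i))" by metis
  have "uncoupled_hamiltonians (\<lambda>i z. h i (Re z, Im z)) (\<lambda>i. planar_grad (h i)) (\<lambda>i. planar_hess (h i)) zm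
      (split_hamiltonian h) E"
  proof (rule uncoupled_hamiltonians.intro)
    show "planar_hamiltonian (\<lambda>z. h i (Re z, Im z)) (planar_grad (h i)) (planar_hess (h i)) (zm i)" for i
      by (rule planar_hamiltonian_of_smooth[OF assms(1,3,4,5) zm])
    show "split_hamiltonian h w = (\<Sum>i\<in>UNIV. h i (Re (plane_proj i w), Im (plane_proj i w)))" for w
      by (simp add: split_hamiltonian_def plane_proj_def split_beta)
    have "\<exists>z. split_hamiltonian h z < E"
    proof -
      have "bdd_below (range (split_hamiltonian h))"
        by (intro bdd_belowI[of _ 0]) (auto simp: split_hamiltonian_def intro!: sum_nonneg assms(2))
      then show ?thesis using assms(6) cInf_less_iff[of "range (split_hamiltonian h)" E] by auto
    qed
    then obtain z where z: "split_hamiltonian h z < E" ..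
    have "(\<Sum>i\<in>UNIV. h i (Re (zm i), Im (zm i))) \<le> split_hamiltonian h z"
      unfolding split_hamiltonian_def split_beta
      by (intro sum_mono) (use zm in \<open>simp add: minimum_point_def\<close>)
    then show "(\<Sum>i\<in>UNIV. h i (Re (zm i), Im (zm i))) < E" using z by simp
  qed
  then show ?thesis by (rule uncoupled_hamiltonians.viterbo_inequality)
qed

end
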